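(* Let $K\ge 2$, $0<p_1<\dots<p_K<p_{K+1}\le 1$, let $A\subset(1,\infty)$ be compact, let $\alpha_0$ be an interior point of $A$, and let $\{Y_i\}_{i=1}^n$ be i.i.d. Pareto with exponent $\alpha_0$ and minimum size $c>0$. Let $\widehat W$ be (possibly random, depending on $n$) symmetric positive definite $(K-1)\times(K-1)$ weighting matrices with $\widehat W\xrightarrow{p}W$ as $n\to\infty$, where $W$ is positive definite. Let $$\widehat\alpha=\operatorname*{arg\,min}_{\alpha\in A}\,(r(\alpha)-\bar s)^\top\widehat W(r(\alpha)-\bar s),$$ where $\bar s$, $r(\alpha)$ and $\Omega(\alpha)$ are as defined in the context. Then $$\sqrt n(\widehat\alpha-\alpha_0)\xrightarrow{d}N(0,V)$$ as $n\to\infty$, where $$V=(R^\top WR)^{-1}R^\top W\Omega WR(R^\top WR)^{-1}$$ for $\Omega=\Omega(\alpha_0)$ and $R=\nabla r(\alpha_0)$ (the derivative of $\alpha\mapsto r(\alpha)\in\mathbb{R}^{K-1}$ at $\alpha_0$).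
   Context: Pareto with exponent $\alpha_0$ and minimum size $c$ means the CDF is $F(y)=1-(y/c)^{-\alpha_0}$ for $y\ge c$. Let $Y_{(1)}\ge\dots\ge Y_{(n)}$ denote the order statistics in decreasing order. The top income shares are $$S_k=\frac{\sum_{i=1}^{\lfloor np_k\rfloor}Y_{(i)}}{\sum_{i=1}^n Y_{(i)}},\quad k=1,\dots,K+1,$$ and the self-normalized non-overlapping top income shares are $$\bar s=(\bar s_1,\dots,\bar s_{K-1})^\top=\left(\frac{S_2-S_1}{S_{K+1}-S_K},\dots,\frac{S_K-S_{K-1}}{S_{K+1}-S_K}\right)^\top.$$ For $\alpha>1$ let $\xi=1/\alpha$, and for $0<p<q\le1$ put $$\mu(p,q)=c\,\frac{q^{1-\xi}-p^{1-\xi}}{1-\xi},$$ $$\sigma^2(p,q)=\frac{2c^2\xi^2}{1-\xi}\left(\frac{q^{1-2\xi}-p^{1-2\xi}}{1-2\xi}+p^{1-\xi}\frac{q^{-\xi}-p^{-\xi}}{\xi}+\frac{2p^{1-\xi}q^{1-\xi}-p^{2-2\xi}-q^{2-2\xi}}{2-2\xi}\right),$$ where $\frac{q^{1-2\xi}-p^{1-2\xi}}{1-2\xi}$ is interpreted as $\log\frac{q}{p}$ if $\xi=1/2$. Set $\mu_k=\mu(p_k,p_{k+1})$ for $k=1,\dots,K$, $r_k(\alpha)=\mu_k/\mu_K$, and $r(\alpha)=(r_1(\alpha),\dots,r_{K-1}(\alpha))^\top$. The $K\times K$ matrix $\Sigma$ is symmetric with $\Sigma_{kk}=\sigma^2(p_k,p_{k+1})$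 and, for $j<k$, $$\Sigma_{jk}=-c^2\xi^2\frac{p_{j+1}^{1-\xi}-p_j^{1-\xi}}{1-\xi}\left(\frac{p_{k+1}^{-\xi}-p_k^{-\xi}}{\xi}+\frac{p_{k+1}^{1-\xi}-p_k^{1-\xi}}{1-\xi}\right).$$ With the $(K-1)\times K$ matrix $H=\frac{1}{\mu_K}\begin{bmatrix} I_{K-1} & -r(\alpha)\end{bmatrix}$, define $\Omega(\alpha)=H\Sigma H^\top$. Both $r(\alpha)$ and $\Omega(\alpha)$ depend only on $\alpha$ and not on $c$, and $\Omega(\alpha)$ is positive definite. *)

theory Defs
  imports "HOL-Probability.Probability" "Jordan_Normal_Form.Matrix"
begin

text \<open>
  The percentiles are a function \<open>p :: nat \<Rightarrow> real\<close>, of which only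
  \<open>p 1, \<dots>, p (K + 1)\<close> matter. Functions of \<open>k\<close> use the indices \<open>1, 2, \<dots>\<close>; entries of
  the vectors and matrices of \<open>Jordan_Normal_Form\<close> are counted from 0, so that position
  \<open>i\<close> holds the quantity with index \<open>Suc i\<close>.
\<close>

definition pareto_cdf :: "real \<Rightarrow> real \<Rightarrow> real \<Rightarrow> real" where
  "pareto_cdf \<alpha> c y = (if c \<le> y then 1 - (y / c) powr (- \<alpha>) else 0)"

text \<open>The \<open>i\<close>-th largest of the \<open>n\<close> observations \<open>y 0, \<dots>, y (n - 1)\<close>, for \<open>1 \<le> i \<le> n\<close>.\<close>

definition order_stat :: "nat \<Rightarrow> (nat \<Rightarrow> real) \<Rightarrow> nat \<Rightarrow> real" where
  "order_stat n y i = rev (sort (map y [0..<n])) ! (i - 1)"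

definition top_share :: "nat \<Rightarrow> (nat \<Rightarrow> real) \<Rightarrow> (nat \<Rightarrow> real) \<Rightarrow> nat \<Rightarrow> real" where
  "top_share n y p k =
     (\<Sum>i = 1..nat \<lfloor>real n * p k\<rfloor>. order_stat n y i) / (\<Sum>i = 1..n. order_stat n y i)"

text \<open>
  For the finitely many \<open>n\<close> with \<open>\<lfloor>n p\<^sub>K\<rfloor> = \<lfloor>n p\<^sub>K\<^sub>+\<^sub>1\<rfloor>\<close> the shares below are not defined
  mathematically; here they are 0 by the convention \<open>x / 0 = 0\<close>.
\<close>

definition normalized_shares :: "nat \<Rightarrow> (nat \<Rightarrow> real) \<Rightarrow> (nat \<Rightarrow> real) \<Rightarrow> nat \<Rightarrow> real Matrix.vec" where
  "normalized_shares K p y n =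
     Matrix.vec (K - 1) (\<lambda>i. (top_share n y p (Suc i + 1) - top_share n y p (Suc i))
                           / (top_share n y p (K + 1) - top_share n y p K))"

definition pareto_mu :: "real \<Rightarrow> real \<Rightarrow> real \<Rightarrow> real \<Rightarrow> real" where
  "pareto_mu c \<alpha> p q = (let \<xi> = 1 / \<alpha> in
     c * ((q powr (1 - \<xi>) - p powr (1 - \<xi>)) / (1 - \<xi>)))"

definition pareto_sigma2 :: "real \<Rightarrow> real \<Rightarrow> real \<Rightarrow> real \<Rightarrow> real" where
  "pareto_sigma2 c \<alpha> p q = (let \<xi> = 1 / \<alpha> in
     2 * c\<^sup>2 * \<xi>\<^sup>2 / (1 - \<xi>) *
       ((if \<xi> = 1 / 2 then ln (q / p)
         else (q powr (1 - 2 * \<xi>) - p powr (1 - 2 * \<xi>)) / (1 - 2 * \<xi>))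
        + p powr (1 - \<xi>) * ((q powr (- \<xi>) - p powr (- \<xi>)) / \<xi>)
        + (2 * p powr (1 - \<xi>) * q powr (1 - \<xi>) - p powr (2 - 2 * \<xi>) - q powr (2 - 2 * \<xi>))
            / (2 - 2 * \<xi>)))"

definition pareto_cov :: "real \<Rightarrow> real \<Rightarrow> real \<Rightarrow> real \<Rightarrow> real \<Rightarrow> real \<Rightarrow> real" where
  "pareto_cov c \<alpha> p q p' q' = (let \<xi> = 1 / \<alpha> in
     - c\<^sup>2 * \<xi>\<^sup>2 * ((q powr (1 - \<xi>) - p powr (1 - \<xi>)) / (1 - \<xi>)) *
       ((q' powr (- \<xi>) - p' powr (- \<xi>)) / \<xi> + (q' powr (1 - \<xi>) - p' powr (1 - \<xi>)) / (1 - \<xi>)))"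

definition Sigma_entry :: "(nat \<Rightarrow> real) \<Rightarrow> real \<Rightarrow> real \<Rightarrow> nat \<Rightarrow> nat \<Rightarrow> real" where
  "Sigma_entry p c \<alpha> j k =
     (if j = k then pareto_sigma2 c \<alpha> (p k) (p (k + 1))
      else if j < k then pareto_cov c \<alpha> (p j) (p (j + 1)) (p k) (p (k + 1))
      else pareto_cov c \<alpha> (p k) (p (k + 1)) (p j) (p (j + 1)))"

definition Sigma_mat :: "nat \<Rightarrow> (nat \<Rightarrow> real) \<Rightarrow> real \<Rightarrow> real \<Rightarrow> real Matrix.mat" where
  "Sigma_mat K p c \<alpha> = Matrix.mat K K (\<lambda>(i, j). Sigma_entry p c \<alpha> (Suc i) (Suc j))"

definition mu_k :: "(nat \<Rightarrow> real) \<Rightarrow> real \<Rightarrow> real \<Rightarrow> nat \<Rightarrow> real" where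
  "mu_k p c \<alpha> k = pareto_mu c \<alpha> (p k) (p (k + 1))"

definition r_k :: "nat \<Rightarrow> (nat \<Rightarrow> real) \<Rightarrow> real \<Rightarrow> real \<Rightarrow> nat \<Rightarrow> real" where
  "r_k K p c \<alpha> k = mu_k p c \<alpha> k / mu_k p c \<alpha> K"

definition r_vec :: "nat \<Rightarrow> (nat \<Rightarrow> real) \<Rightarrow> real \<Rightarrow> real \<Rightarrow> real Matrix.vec" where
  "r_vec K p c \<alpha> = Matrix.vec (K - 1) (\<lambda>i. r_k K p c \<alpha> (Suc i))"

definition grad_r :: "nat \<Rightarrow> (nat \<Rightarrow> real) \<Rightarrow> real \<Rightarrow> real \<Rightarrow> real Matrix.vec" where
  "grad_r K p c \<alpha> = Matrix.vec (K - 1) (\<lambda>i. deriv (\<lambda>a. r_k K p c a (Suc i)) \<alpha>)"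

definition H_mat :: "nat \<Rightarrow> (nat \<Rightarrow> real) \<Rightarrow> real \<Rightarrow> real \<Rightarrow> real Matrix.mat" where
  "H_mat K p c \<alpha> =
     (1 / mu_k p c \<alpha> K) \<cdot>\<^sub>m mat_of_cols (K - 1) (unit_vecs (K - 1) @ [- r_vec K p c \<alpha>])"

definition Omega_mat :: "nat \<Rightarrow> (nat \<Rightarrow> real) \<Rightarrow> real \<Rightarrow> real \<Rightarrow> real Matrix.mat" where
  "Omega_mat K p c \<alpha> = H_mat K p c \<alpha> * Sigma_mat K p c \<alpha> * transpose_mat (H_mat K p c \<alpha>)"

definition quad_form :: "real Matrix.mat \<Rightarrow> real Matrix.vec \<Rightarrow> real" where
  "quad_form B v = scalar_prod v (B *\<^sub>v v)"

text \<open>Symmetry is not part of \<open>pos_def_mat\<close>.\<close>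

definition pos_def_mat :: "nat \<Rightarrow> real Matrix.mat \<Rightarrow> bool" where
  "pos_def_mat d B \<longleftrightarrow>
     B \<in> carrier_mat d d \<and> (\<forall>v \<in> carrier_vec d. v \<noteq> 0\<^sub>v d \<longrightarrow> 0 < quad_form B v)"

definition symmetric_mat :: "real Matrix.mat \<Rightarrow> bool" where
  "symmetric_mat B \<longleftrightarrow> transpose_mat B = B"

definition conv_in_prob :: "'a measure \<Rightarrow> (nat \<Rightarrow> 'a \<Rightarrow> real) \<Rightarrow> real \<Rightarrow> bool" where
  "conv_in_prob M X x \<longleftrightarrow>
     (\<forall>\<epsilon> > 0. (\<lambda>n. measure M {\<omega> \<in> space M. \<bar>X n \<omega> - x\<bar> > \<epsilon>}) \<longlonglongrightarrow> 0)"

text \<open>A genuine probability measure only for \<open>V > 0\<close>.\<close>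

definition normal_law :: "real \<Rightarrow> real \<Rightarrow> real measure" where
  "normal_law m V = density lborel (normal_density m (sqrt V))"

definition asymp_variance ::
  "real Matrix.mat \<Rightarrow> real Matrix.mat \<Rightarrow> real Matrix.vec \<Rightarrow> real" where
  "asymp_variance W \<Omega> R =
     inverse (quad_form W R) * quad_form (W * \<Omega> * W) R * inverse (quad_form W R)"

end

theory Submission
  imports Defs "HOL-Real_Asymp.Real_Asymp"
begin

text \<open>
  The sum of the \<open>m\<close> largest observations is \<open>min\<^sub>s (m s + \<Sum>\<^sub>i (Y\<^sub>i - s)\<^sup>+)\<close>; the minimum is attained at
  the \<open>m\<close>-th largest observation. For \<open>m \<approx> n u\<close> this minimiser tends in probability to the quantile
  \<open>t\<close> with \<open>P(Y > t) = u\<close>, and the slope of the convex objective at \<open>t\<close> is \<open>m\<close> minus the number of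
  observations above \<open>t\<close>, of order \<open>\<surd>n\<close>. Hence replacing the minimiser by \<open>t\<close> changes the value by
  \<open>o\<^sub>P(\<surd>n)\<close> only (\<open>top_sum_approx\<close>, \<open>top_sum_linear_representation\<close>). This removes the order
  statistics: the sum of the observations between two ranks is, up to \<open>o\<^sub>P(\<surd>n)\<close> and a constant, a sum
  of i.i.d. variables \<open>layer\<close>, each the part of \<open>Y\<^sub>i\<close> that lies between two population quantiles. Layers
  are bounded, since \<open>p 1 > 0\<close>, even where \<open>Y\<^sub>i\<close> has infinite variance, and their covariances are
  elementary integrals, which give the matrix \<open>Sigma_mat\<close> (\<open>covariance_layer_k\<close>).

  The estimator depends on the sample only through the block sums and the weights, and this dependence
  is differentiable at the population values (\<open>min_distance_linearization\<close>,
  \<open>estimator_linearization\<close>). The reason is that near the population values the objective is close to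
  the quadratic form obtained by replacing \<open>r\<close> by its tangent, so its minimiser is close to the
  minimiser of that form, which is explicit. That the minimiser is near \<open>\<alpha>\<^sub>0\<close> at all follows
  from identifiability: every ratio \<open>r_k\<close> with \<open>k < K\<close> is strictly decreasing in \<open>\<alpha>\<close>, with nonzero derivative
  (\<open>r_k_derivative_neg\<close>), so that on the compact set \<open>A\<close> the distance \<open>\<bar>\<alpha> - \<alpha>\<^sub>0\<bar>\<close> is bounded by a
  multiple of the distance of the ratios (\<open>inverse_lipschitz_at\<close>).

  Together, \<open>\<surd>n (\<alpha>hat - \<alpha>\<^sub>0)\<close> equals \<open>n\<^sup>-\<^sup>1\<^sup>/\<^sup>2 \<Sum>\<^sub>i (h(Y\<^sub>i) - E h(Y\<^sub>i)) + o\<^sub>P(1)\<close> for one bounded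
  piecewise linear function \<open>h\<close>, a combination of layers with the coefficients \<open>influence\<close>, and the
  central limit theorem applies. The variance of \<open>h(Y)\<close> is the sandwich formula
  (\<open>asymp_variance_eq\<close>). It is positive because \<open>h\<close> has nonzero slope on some interval
  that carries mass (\<open>variance_layer_comb_pos\<close>).
\<close>

section \<open>Sums of the largest observations\<close>

definition top_sum :: "nat \<Rightarrow> (nat \<Rightarrow> real) \<Rightarrow> nat \<Rightarrow> real" where
  "top_sum n y m = (\<Sum>i = 1..m. order_stat n y i)"

definition exceedances :: "nat \<Rightarrow> (nat \<Rightarrow> real) \<Rightarrow> real \<Rightarrow> real" where
  "exceedances n y t = (\<Sum>i<n. if t < y i then 1 else 0)"

definition total_excess :: "nat \<Rightarrow> (nat \<Rightarrow> real) \<Rightarrow> real \<Rightarrow> real" where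
  "total_excess n y t = (\<Sum>i<n. max 0 (y i - t))"

lemma sum_list_map_descending:
  fixes y :: "nat \<Rightarrow> real" and f :: "real \<Rightarrow> real"
  shows "sum_list (map f (rev (sort (map y [0..<n])))) = (\<Sum>i<n. f (y i))"
proof -
  have "mset (map f (rev (sort (map y [0..<n])))) = mset (map (\<lambda>i. f (y i)) [0..<n])"
    by (simp add: image_mset.compositionality o_def)
  then have "sum_list (map f (rev (sort (map y [0..<n])))) = sum_list (map (\<lambda>i. f (y i)) [0..<n])"
    by (metis sum_mset_sum_list)
  then show ?thesis
    by (simp add: interv_sum_list_conv_sum_set_nat atLeast0LessThan)
qed

lemma top_sum_eq_sum_list:
  assumes "m \<le> n"
  shows "top_sum n y m = sum_list (take m (rev (sort (map y [0..<n]))))"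
proof -
  have "top_sum n y m = (\<Sum>i<m. rev (sort (map y [0..<n])) ! i)"
    unfolding top_sum_def order_stat_def
    by (rule sum.reindex_bij_witness[of _ Suc "\<lambda>i. i - 1"]) auto
  also have "\<dots> = sum_list (take m (rev (sort (map y [0..<n]))))"
    using assms by (simp add: sum_list_sum_nth atLeast0LessThan)
  finally show ?thesis .
qed

lemma order_stat_ge:
  assumes "1 \<le> m" "m \<le> n" "x \<in> set (take m (rev (sort (map y [0..<n]))))"
  shows "order_stat n y m \<le> x"
proof -
  let ?ys = "rev (sort (map y [0..<n]))"
  have len: "length ?ys = n" by simp
  have d: "sorted_wrt (\<ge>) ?ys" by (simp add: sorted_wrt_rev)
  obtain i where i: "i < m" "x = ?ys ! i"
    using assms(2,3) len by (auto simp: in_set_conv_nth simp del: length_rev length_sort)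
  have "?ys ! i \<ge> ?ys ! (m - 1)"
  proof (cases "i = m - 1")
    case False
    then show ?thesis using sorted_wrt_nth_less[OF d, of i "m - 1"] i assms by simp
  qed simp
  then show ?thesis using i by (simp add: order_stat_def)
qed

lemma order_stat_le:
  assumes "1 \<le> m" "m \<le> n" "x \<in> set (drop (m - 1) (rev (sort (map y [0..<n]))))"
  shows "x \<le> order_stat n y m"
proof -
  let ?ys = "rev (sort (map y [0..<n]))"
  have len: "length ?ys = n" by simp
  have d: "sorted_wrt (\<ge>) ?ys" by (simp add: sorted_wrt_rev)
  obtain i where "i < length (drop (m - 1) ?ys)" "drop (m - 1) ?ys ! i = x"
    using assms(3) by (metis in_set_conv_nth)
  then have i: "m - 1 + i < n" "x = ?ys ! (m - 1 + i)" using assms(1,2) by auto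
  have "?ys ! (m - 1 + i) \<le> ?ys ! (m - 1)"
  proof (cases "i = 0")
    case False
    then show ?thesis using sorted_wrt_nth_less[OF d, of "m - 1" "m - 1 + i"] i assms by simp
  qed simp
  then show ?thesis using i by (simp add: order_stat_def)
qed

text \<open>
  The pointwise bound \<open>x \<le> t + (x - t)\<^sup>+\<close>, summed over the largest \<open>m\<close> observations: every \<open>t\<close> is
  a candidate in the minimisation problem whose value is the top sum.
\<close>

lemma top_sum_le:
  assumes "m \<le> n"
  shows "top_sum n y m \<le> real m * t + total_excess n y t"
proof -
  let ?ys = "rev (sort (map y [0..<n]))"
  have "sum_list (take m ?ys) \<le> sum_list (map (\<lambda>x. t + max 0 (x - t)) (take m ?ys))"
    by (rule order_trans[OF _ sum_list_mono[where f = "\<lambda>x. x"]]) auto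
  also have "\<dots> = real m * t + sum_list (map (\<lambda>x. max 0 (x - t)) (take m ?ys))"
    using assms by (simp add: sum_list_addf sum_list_triv)
  also have "\<dots> \<le> real m * t + sum_list (map (\<lambda>x. max 0 (x - t)) (take m ?ys @ drop m ?ys))"
    unfolding map_append sum_list_append by (auto intro!: sum_list_nonneg)
  finally show ?thesis
    using assms by (simp only: append_take_drop_id sum_list_map_descending top_sum_eq_sum_list total_excess_def)
qed

text \<open>
  At the \<open>m\<close>-th largest observation the bound above is tight: the first \<open>m\<close> sorted values are at
  least \<open>s\<close> and the others contribute no excess. The case \<open>m = 0\<close> has no such minimiser.
\<close>

lemma top_sum_eq_at_order_stat:
  fixes y :: "nat \<Rightarrow> real"
  assumes "1 \<le> m" "m \<le> n"
  defines "s \<equiv> order_stat n y m"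
  shows "top_sum n y m = real m * s + total_excess n y s"
proof -
  let ?ys = "rev (sort (map y [0..<n]))"
  have "set (drop m ?ys) \<subseteq> set (drop (m - 1) ?ys)" by (rule set_drop_subset_set_drop) simp
  then have "x \<le> s" if "x \<in> set (drop m ?ys)" for x
    using order_stat_le[OF assms(1,2), of x y] that unfolding s_def by blast
  then have "map (\<lambda>x. max 0 (x - s)) (drop m ?ys) = map (\<lambda>x. 0) (drop m ?ys)"
    by (intro map_cong refl) (smt (verit) max_def)
  then have d: "sum_list (map (\<lambda>x. max 0 (x - s)) (drop m ?ys)) = 0" by (simp only: sum_list_triv mult_zero_right)
  have "map (\<lambda>x. x) (take m ?ys) = map (\<lambda>x. s + max 0 (x - s)) (take m ?ys)"
    using order_stat_ge[OF assms(1,2), of _ y] unfolding s_def by (intro map_cong) (auto simp: max_def)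
  then have "sum_list (take m ?ys) = sum_list (map (\<lambda>x. s + max 0 (x - s)) (take m ?ys))" by simp
  also have "\<dots> = real m * s + sum_list (map (\<lambda>x. max 0 (x - s)) (take m ?ys @ drop m ?ys))"
    unfolding map_append sum_list_append d using assms(2) by (simp add: sum_list_addf sum_list_triv)
  finally show ?thesis
    using assms(2) by (simp only: append_take_drop_id sum_list_map_descending top_sum_eq_sum_list total_excess_def)
qed

lemma exceedances_ge_if_order_stat_gt:
  assumes "1 \<le> m" "m \<le> n" "t < order_stat n y m"
  shows "real m \<le> exceedances n y t"
proof -
  let ?ys = "rev (sort (map y [0..<n]))" and ?f = "\<lambda>x::real. if t < x then 1 else (0::real)"
  have "map ?f (take m ?ys) = map (\<lambda>x. 1) (take m ?ys)"
    using order_stat_ge[OF assms(1,2), of _ y] assms(3) by (intro map_cong) force+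
  then have "sum_list (map ?f (take m ?ys)) = real m"
    using assms(2) by (simp only: sum_list_triv) simp
  then have "real m = sum_list (map ?f (take m ?ys))" by simp
  also have "\<dots> \<le> sum_list (map ?f (take m ?ys @ drop m ?ys))"
    unfolding map_append sum_list_append by (auto intro!: sum_list_nonneg)
  finally show ?thesis
    by (simp only: append_take_drop_id sum_list_map_descending exceedances_def)
qed

lemma exceedances_less_if_order_stat_le:
  assumes "1 \<le> m" "m \<le> n" "order_stat n y m \<le> t"
  shows "exceedances n y t < real m"
proof -
  let ?ys = "rev (sort (map y [0..<n]))" and ?f = "\<lambda>x::real. if t < x then 1 else (0::real)"
  have "map ?f (drop (m - 1) ?ys) = map (\<lambda>x. 0) (drop (m - 1) ?ys)"
    using order_stat_le[OF assms(1,2), of _ y] assms(3) by (intro map_cong) force+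
  then have d: "sum_list (map ?f (drop (m - 1) ?ys)) = 0" by (simp only: sum_list_triv mult_zero_right)
  have "sum_list (map ?f (take (m - 1) ?ys @ drop (m - 1) ?ys)) = sum_list (map ?f (take (m - 1) ?ys))"
    by (simp only: map_append sum_list_append d add_0_right)
  also have "\<dots> \<le> sum_list (map (\<lambda>x. 1) (take (m - 1) ?ys))"
    by (rule sum_list_mono) auto
  also have "\<dots> = real m - 1"
    using assms by (simp add: sum_list_triv)
  finally show ?thesis
    by (simp only: append_take_drop_id sum_list_map_descending exceedances_def)
qed

text \<open>
  \<open>total_excess n y\<close> is convex, and minus the number of exceedances of \<open>t\<close> is a subgradient at \<open>t\<close>.
\<close>

lemma total_excess_subgradient:
  "total_excess n y t - exceedances n y t * (s - t) \<le> total_excess n y s"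
proof -
  have "max 0 (y i - t) - (if t < y i then 1 else 0) * (s - t) \<le> max 0 (y i - s)" for i
    by auto
  then show ?thesis
    unfolding total_excess_def exceedances_def sum_distrib_right sum_subtractf[symmetric]
    by (intro sum_mono) auto
qed

text \<open>
  The key deterministic estimate. The two counting conditions say that the \<open>m\<close>-th largest observation
  \<open>s\<close> lies within \<open>\<delta>\<close> of \<open>t\<close>. Between the optimal value at \<open>s\<close> and the value at \<open>t\<close> lies at most the slope at
  \<open>t\<close> times \<open>\<bar>s - t\<bar>\<close>, by convexity. In the application the slope is of order \<open>\<surd>n\<close> and \<open>\<delta>\<close> is arbitrarily small.
\<close>

lemma top_sum_approx:
  assumes m: "1 \<le> m" "m \<le> n"
    and q: "exceedances n y (t + \<delta>) < real m" "real m \<le> exceedances n y (t - \<delta>)"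
  shows "\<bar>top_sum n y m - (real m * t + total_excess n y t)\<bar> \<le> \<bar>exceedances n y t - real m\<bar> * \<delta>"
proof -
  define s where "s = order_stat n y m"
  have "s \<le> t + \<delta>" "t - \<delta> < s"
    using exceedances_ge_if_order_stat_gt[OF m, of "t + \<delta>" y]
      exceedances_less_if_order_stat_le[OF m, of y "t - \<delta>"] q unfolding s_def by force+
  then have "\<bar>s - t\<bar> \<le> \<delta>" by simp
  then have "\<bar>(exceedances n y t - real m) * (s - t)\<bar> \<le> \<bar>exceedances n y t - real m\<bar> * \<delta>"
    by (simp add: abs_mult mult_left_mono)
  moreover have "top_sum n y m = real m * s + total_excess n y s"
    unfolding s_def by (rule top_sum_eq_at_order_stat[OF m])
  ultimately show ?thesis
    using top_sum_le[OF m(2), of y t] total_excess_subgradient[of n y t s] by (simp add: algebra_simps)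
qed

section \<open>Stochastic order symbols\<close>

text \<open>
  Events are described by predicates that need not be measurable; the measurable witness \<open>E\<close> makes
  this harmless. It lets estimates that hold pointwise be used without measurability proofs for order
  statistics and shares.
\<close>

definition likely :: "'a measure \<Rightarrow> real \<Rightarrow> ('a \<Rightarrow> bool) \<Rightarrow> bool" where
  "likely M \<eta> P \<longleftrightarrow> (\<exists>E\<in>sets M. 1 - \<eta> \<le> measure M E \<and> (\<forall>\<omega>\<in>E. P \<omega>))"

definition whp :: "'a measure \<Rightarrow> (nat \<Rightarrow> 'a \<Rightarrow> bool) \<Rightarrow> bool" where
  "whp M P \<longleftrightarrow> (\<forall>\<eta>>0. \<forall>\<^sub>F n in sequentially. likely M \<eta> (P n))"

definition small_oP :: "'a measure \<Rightarrow> (nat \<Rightarrow> 'a \<Rightarrow> real) \<Rightarrow> bool" where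
  "small_oP M X \<longleftrightarrow> (\<forall>\<epsilon>>0. whp M (\<lambda>n \<omega>. \<bar>X n \<omega>\<bar> \<le> \<epsilon>))"

definition big_OP :: "'a measure \<Rightarrow> (nat \<Rightarrow> 'a \<Rightarrow> real) \<Rightarrow> bool" where
  "big_OP M X \<longleftrightarrow> (\<forall>\<eta>>0. \<exists>B. \<forall>\<^sub>F n in sequentially. likely M \<eta> (\<lambda>\<omega>. \<bar>X n \<omega>\<bar> \<le> B))"

context prob_space
begin

lemma likely_mono:
  assumes "likely M \<eta> P" "\<And>\<omega>. \<omega> \<in> space M \<Longrightarrow> P \<omega> \<Longrightarrow> Q \<omega>"
  shows "likely M \<eta> Q"
  using assms sets.sets_into_space unfolding likely_def by blast

lemma likely_conj:
  assumes "likely M \<eta>\<^sub>1 P" "likely M \<eta>\<^sub>2 Q"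
  shows "likely M (\<eta>\<^sub>1 + \<eta>\<^sub>2) (\<lambda>\<omega>. P \<omega> \<and> Q \<omega>)"
proof -
  obtain E F where E: "E \<in> sets M" "1 - \<eta>\<^sub>1 \<le> prob E" "\<forall>\<omega>\<in>E. P \<omega>"
    and F: "F \<in> sets M" "1 - \<eta>\<^sub>2 \<le> prob F" "\<forall>\<omega>\<in>F. Q \<omega>"
    using assms unfolding likely_def by blast
  have "prob (E \<union> F) \<le> 1" by simp
  moreover have "prob (E \<union> F) = prob E + prob F - prob (E \<inter> F)"
    using E(1) F(1) by (simp add: finite_measure_Union' finite_measure_Diff' Int_commute)
  ultimately have "1 - (\<eta>\<^sub>1 + \<eta>\<^sub>2) \<le> prob (E \<inter> F)" using E(2) F(2) by linarith
  then show ?thesis using E F unfolding likely_def by (intro bexI[of _ "E \<inter> F"]) auto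
qed

lemma likely_AE:
  assumes "AE \<omega> in M. P \<omega>" "0 \<le> \<eta>"
  shows "likely M \<eta> P"
proof -
  obtain N where N: "{\<omega> \<in> space M. \<not> P \<omega>} \<subseteq> N" "N \<in> sets M" "prob N = 0"
    using AE_E2[OF assms(1)] assms(1) by (auto elim!: AE_E simp: measure_def)
  have "prob (space M - N) = 1" using N by (simp add: prob_compl)
  then show ?thesis using N assms(2) unfolding likely_def by (intro bexI[of _ "space M - N"]) auto
qed

lemma likely_if_prob:
  assumes "{\<omega> \<in> space M. \<not> P \<omega>} \<in> sets M" "prob {\<omega> \<in> space M. \<not> P \<omega>} \<le> \<eta>"
  shows "likely M \<eta> P"
proof -
  have "prob (space M - {\<omega> \<in> space M. \<not> P \<omega>}) = 1 - prob {\<omega> \<in> space M. \<not> P \<omega>}"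
    using assms(1) by (rule prob_compl)
  then show ?thesis using assms unfolding likely_def
    by (intro bexI[of _ "space M - {\<omega> \<in> space M. \<not> P \<omega>}"]) auto
qed

lemma whp_mono:
  assumes "whp M P" "\<forall>\<^sub>F n in sequentially. \<forall>\<omega>\<in>space M. P n \<omega> \<longrightarrow> Q n \<omega>"
  shows "whp M Q"
  unfolding whp_def
proof safe
  fix \<eta> :: real assume "0 < \<eta>"
  then have "\<forall>\<^sub>F n in sequentially. likely M \<eta> (P n)" using assms(1) by (simp add: whp_def)
  with assms(2) show "\<forall>\<^sub>F n in sequentially. likely M \<eta> (Q n)"
    by eventually_elim (auto elim!: likely_mono)
qed

lemma whp_conj:
  assumes "whp M P" "whp M Q"
  shows "whp M (\<lambda>n \<omega>. P n \<omega> \<and> Q n \<omega>)"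
  unfolding whp_def
proof safe
  fix \<eta> :: real assume "0 < \<eta>"
  then have "\<forall>\<^sub>F n in sequentially. likely M (\<eta>/2) (P n)" "\<forall>\<^sub>F n in sequentially. likely M (\<eta>/2) (Q n)"
    using assms by (simp_all add: whp_def)
  then show "\<forall>\<^sub>F n in sequentially. likely M \<eta> (\<lambda>\<omega>. P n \<omega> \<and> Q n \<omega>)"
    by eventually_elim (use likely_conj[of "\<eta>/2" _ "\<eta>/2"] in fastforce)
qed

lemma whp_AE:
  assumes "\<And>n. AE \<omega> in M. P n \<omega>"
  shows "whp M P"
  unfolding whp_def using likely_AE[OF assms] by simp

lemma whp_if_eventually:
  assumes "\<forall>\<^sub>F n in sequentially. \<forall>\<omega>\<in>space M. P n \<omega>"
  shows "whp M P"
  by (rule whp_mono[OF whp_AE[where P = "\<lambda>n \<omega>. True"]]) (use assms in auto)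

lemma whp_finite_ball:
  assumes "finite I" "\<And>i. i \<in> I \<Longrightarrow> whp M (P i)"
  shows "whp M (\<lambda>n \<omega>. \<forall>i\<in>I. P i n \<omega>)"
  using assms
proof (induction I)
  case empty
  show ?case by (rule whp_AE) simp
next
  case (insert i I)
  then show ?case using whp_conj[of "P i" "\<lambda>n \<omega>. \<forall>i\<in>I. P i n \<omega>"] by simp
qed

lemma small_oP_D: "small_oP M X \<Longrightarrow> 0 < \<epsilon> \<Longrightarrow> whp M (\<lambda>n \<omega>. \<bar>X n \<omega>\<bar> \<le> \<epsilon>)"
  unfolding small_oP_def by blast

text \<open>
  Tightness enters here: if \<open>\<bar>D\<bar> \<le> \<eta> \<bar>X\<bar>\<close> holds with high probability for each fixed \<open>\<eta>\<close> and \<open>X\<close> is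
  bounded by \<open>B\<close> up to small probability, then taking \<open>\<eta> = \<epsilon> / B\<close> gives \<open>\<bar>D\<bar> \<le> \<epsilon>\<close>.
\<close>

lemma small_oP_dominated:
  assumes "big_OP M X" "\<And>\<eta>. 0 < \<eta> \<Longrightarrow> whp M (\<lambda>n \<omega>. \<bar>D n \<omega>\<bar> \<le> \<eta> * \<bar>X n \<omega>\<bar>)"
  shows "small_oP M D"
  unfolding small_oP_def whp_def
proof safe
  fix \<epsilon> \<eta> :: real assume pos: "0 < \<epsilon>" "0 < \<eta>"
  then obtain B where B: "\<forall>\<^sub>F n in sequentially. likely M (\<eta>/2) (\<lambda>\<omega>. \<bar>X n \<omega>\<bar> \<le> B)"
    using assms(1) unfolding big_OP_def by (meson half_gt_zero)
  define B' where "B' = max B 1"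
  have B': "B' > 0" "B \<le> B'" by (auto simp: B'_def)
  have "\<forall>\<^sub>F n in sequentially. likely M (\<eta>/2) (\<lambda>\<omega>. \<bar>D n \<omega>\<bar> \<le> \<epsilon> / B' * \<bar>X n \<omega>\<bar>)"
    using assms(2)[of "\<epsilon> / B'"] pos B' by (simp add: whp_def)
  with B show "\<forall>\<^sub>F n in sequentially. likely M \<eta> (\<lambda>\<omega>. \<bar>D n \<omega>\<bar> \<le> \<epsilon>)"
  proof eventually_elim
    case (elim n)
    from likely_conj[OF elim] show ?case
      unfolding field_sum_of_halves
    proof (rule likely_mono)
      fix \<omega> assume "\<bar>X n \<omega>\<bar> \<le> B \<and> \<bar>D n \<omega>\<bar> \<le> \<epsilon> / B' * \<bar>X n \<omega>\<bar>"
      then have "\<bar>X n \<omega>\<bar> \<le> B'" "\<bar>D n \<omega>\<bar> \<le> \<epsilon> / B' * \<bar>X n \<omega>\<bar>" using B' by auto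
      then have "\<bar>D n \<omega>\<bar> \<le> \<epsilon> / B' * B'"
        using pos B' by (smt (verit) divide_nonneg_pos mult_left_mono)
      then show "\<bar>D n \<omega>\<bar> \<le> \<epsilon>" using B' by simp
    qed
  qed
qed

lemma small_oP_if_whp_le:
  assumes "small_oP M X" "whp M (\<lambda>n \<omega>. \<bar>D n \<omega>\<bar> \<le> \<bar>X n \<omega>\<bar>)"
  shows "small_oP M D"
  unfolding small_oP_def
proof safe
  fix \<epsilon> :: real assume "0 < \<epsilon>"
  from whp_conj[OF small_oP_D[OF assms(1) this] assms(2)]
  show "whp M (\<lambda>n \<omega>. \<bar>D n \<omega>\<bar> \<le> \<epsilon>)" by (rule whp_mono) auto
qed

lemma small_oP_if_tendsto:
  assumes "x \<longlonglongrightarrow> 0"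
  shows "small_oP M (\<lambda>n \<omega>. x n)"
  unfolding small_oP_def
proof safe
  fix \<epsilon> :: real assume "0 < \<epsilon>"
  then have "\<forall>\<^sub>F n in sequentially. \<bar>x n\<bar> \<le> \<epsilon>"
    using tendstoD[OF assms, of \<epsilon>] by (auto elim!: eventually_mono simp: dist_real_def)
  then show "whp M (\<lambda>n \<omega>. \<bar>x n\<bar> \<le> \<epsilon>)"
    by (intro whp_mono[OF whp_AE[where P = "\<lambda>n \<omega>. True"]]) auto
qed

lemma small_oP_add:
  assumes "small_oP M X" "small_oP M Z"
  shows "small_oP M (\<lambda>n \<omega>. X n \<omega> + Z n \<omega>)"
  unfolding small_oP_def
proof safe
  fix \<epsilon> :: real assume "0 < \<epsilon>"
  then have "\<epsilon>/2 > 0" by simp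
  from whp_conj[OF small_oP_D[OF assms(1) this] small_oP_D[OF assms(2) this]]
  show "whp M (\<lambda>n \<omega>. \<bar>X n \<omega> + Z n \<omega>\<bar> \<le> \<epsilon>)" by (rule whp_mono) (auto intro!: always_eventually)
qed

lemma small_oP_cmult:
  assumes "small_oP M X"
  shows "small_oP M (\<lambda>n \<omega>. a * X n \<omega>)"
  unfolding small_oP_def
proof safe
  fix \<epsilon> :: real assume "0 < \<epsilon>"
  then have "\<epsilon> / (\<bar>a\<bar> + 1) > 0" by simp
  from small_oP_D[OF assms this]
  show "whp M (\<lambda>n \<omega>. \<bar>a * X n \<omega>\<bar> \<le> \<epsilon>)"
  proof (rule whp_mono, intro always_eventually allI ballI impI)
    fix n \<omega> assume "\<bar>X n \<omega>\<bar> \<le> \<epsilon> / (\<bar>a\<bar> + 1)"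
    then have "(\<bar>a\<bar> + 1) * \<bar>X n \<omega>\<bar> \<le> \<epsilon>" by (simp add: field_simps)
    then show "\<bar>a * X n \<omega>\<bar> \<le> \<epsilon>" by (simp add: abs_mult algebra_simps)
  qed
qed

lemma small_oP_diff:
  assumes "small_oP M X" "small_oP M Z"
  shows "small_oP M (\<lambda>n \<omega>. X n \<omega> - Z n \<omega>)"
  using small_oP_add[OF assms(1) small_oP_cmult[OF assms(2), of "-1"]] by simp

lemma small_oP_sum:
  assumes "finite I" "\<And>i. i \<in> I \<Longrightarrow> small_oP M (X i)"
  shows "small_oP M (\<lambda>n \<omega>. \<Sum>i\<in>I. X i n \<omega>)"
  using assms
proof (induction I)
  case empty
  show ?case using small_oP_if_tendsto[of "\<lambda>n. 0"] by simp
next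
  case (insert i I)
  then show ?case using small_oP_add[of "X i" "\<lambda>n \<omega>. \<Sum>i\<in>I. X i n \<omega>"] by simp
qed

lemma small_oP_imp_big_OP: "small_oP M X \<Longrightarrow> big_OP M X"
  using small_oP_D[of X 1] unfolding big_OP_def whp_def by auto

lemma big_OP_add:
  assumes "big_OP M X" "big_OP M Z"
  shows "big_OP M (\<lambda>n \<omega>. X n \<omega> + Z n \<omega>)"
  unfolding big_OP_def
proof safe
  fix \<eta> :: real assume "0 < \<eta>"
  then obtain B C where "\<forall>\<^sub>F n in sequentially. likely M (\<eta>/2) (\<lambda>\<omega>. \<bar>X n \<omega>\<bar> \<le> B)"
    "\<forall>\<^sub>F n in sequentially. likely M (\<eta>/2) (\<lambda>\<omega>. \<bar>Z n \<omega>\<bar> \<le> C)"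
    using assms unfolding big_OP_def by (meson half_gt_zero)
  then have "\<forall>\<^sub>F n in sequentially. likely M \<eta> (\<lambda>\<omega>. \<bar>X n \<omega> + Z n \<omega>\<bar> \<le> B + C)"
  proof eventually_elim
    case (elim n)
    from likely_conj[OF elim] show ?case
      unfolding field_sum_of_halves by (rule likely_mono) auto
  qed
  then show "\<exists>B. \<forall>\<^sub>F n in sequentially. likely M \<eta> (\<lambda>\<omega>. \<bar>X n \<omega> + Z n \<omega>\<bar> \<le> B)" by blast
qed

lemma big_OP_abs: "big_OP M X \<Longrightarrow> big_OP M (\<lambda>n \<omega>. \<bar>X n \<omega>\<bar>)"
  unfolding big_OP_def by simp

lemma big_OP_sum:
  assumes "finite I" "\<And>i. i \<in> I \<Longrightarrow> big_OP M (X i)"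
  shows "big_OP M (\<lambda>n \<omega>. \<Sum>i\<in>I. X i n \<omega>)"
  using assms
proof (induction I)
  case empty
  show ?case using small_oP_imp_big_OP[OF small_oP_if_tendsto[of "\<lambda>n. 0"]] by simp
next
  case (insert i I)
  then show ?case using big_OP_add[of "X i" "\<lambda>n \<omega>. \<Sum>i\<in>I. X i n \<omega>"] by simp
qed

lemma small_oP_tendsto_mult_big_OP:
  assumes "x \<longlonglongrightarrow> 0" "big_OP M X"
  shows "small_oP M (\<lambda>n \<omega>. x n * X n \<omega>)"
proof (rule small_oP_dominated[OF assms(2)])
  fix \<eta> :: real assume "0 < \<eta>"
  from small_oP_D[OF small_oP_if_tendsto[OF assms(1)] this]
  show "whp M (\<lambda>n \<omega>. \<bar>x n * X n \<omega>\<bar> \<le> \<eta> * \<bar>X n \<omega>\<bar>)"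
    by (rule whp_mono) (auto intro!: always_eventually mult_right_mono simp: abs_mult)
qed

lemma small_oP_if_conv_in_prob:
  assumes "\<And>n. X n \<in> borel_measurable M" "conv_in_prob M X x"
  shows "small_oP M (\<lambda>n \<omega>. X n \<omega> - x)"
  unfolding small_oP_def whp_def
proof safe
  fix \<epsilon> \<eta> :: real assume "0 < \<epsilon>" "0 < \<eta>"
  note [measurable] = assms(1)
  have "(\<lambda>n. prob {\<omega> \<in> space M. \<bar>X n \<omega> - x\<bar> > \<epsilon>}) \<longlonglongrightarrow> 0"
    using assms(2) \<open>0 < \<epsilon>\<close> unfolding conv_in_prob_def by simp
  from order_tendstoD(2)[OF this \<open>0 < \<eta>\<close>]
  show "\<forall>\<^sub>F n in sequentially. likely M \<eta> (\<lambda>\<omega>. \<bar>X n \<omega> - x\<bar> \<le> \<epsilon>)"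
    by eventually_elim (intro likely_if_prob, auto simp: not_le)
qed

text \<open>
  A nonrandom statement that holds with high probability is true, as an event of positive probability
  is not empty.
\<close>

lemma whp_const:
  assumes "whp M (\<lambda>n \<omega>. P)"
  shows P
proof -
  have "\<forall>\<^sub>F n in sequentially. likely M (1/2) (\<lambda>\<omega>. P)"
    using assms unfolding whp_def by (rule allE[of _ "1/2"]) simp
  then have "likely M (1/2) (\<lambda>\<omega>. P)" by simp
  then obtain E where "1/2 \<le> prob E" "\<forall>\<omega>\<in>E. P" unfolding likely_def by auto
  moreover have "E \<noteq> {}" using \<open>1/2 \<le> prob E\<close> by auto
  ultimately show P by blast
qed

lemma limit_in_prob_unique:
  assumes "small_oP M (\<lambda>n \<omega>. X n \<omega> - x)" "small_oP M (\<lambda>n \<omega>. X n \<omega> - y)"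
  shows "x = y"
proof (rule ccontr)
  assume "x \<noteq> y"
  then have pos: "0 < \<bar>x - y\<bar> / 2" by simp
  have "small_oP M (\<lambda>n \<omega>. x - y)"
    using small_oP_diff[OF assms(2,1)] by simp
  from small_oP_D[OF this pos] have "\<bar>x - y\<bar> \<le> \<bar>x - y\<bar> / 2"
    by (rule whp_const)
  then show False using \<open>x \<noteq> y\<close> by simp
qed

end

section \<open>Convergence in distribution\<close>

context prob_space
begin

lemma prob_le_if_likely:
  assumes "A \<in> sets M" "B \<in> sets M" "likely M \<eta> (\<lambda>\<omega>. \<omega> \<in> A \<longrightarrow> \<omega> \<in> B)"
  shows "prob A \<le> prob B + \<eta>"
proof -
  obtain E where E: "E \<in> sets M" "1 - \<eta> \<le> prob E" "\<forall>\<omega>\<in>E. \<omega> \<in> A \<longrightarrow> \<omega> \<in> B"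
    using assms(3) unfolding likely_def by blast
  have "prob A \<le> prob (B \<union> (space M - E))"
    using E assms sets.sets_into_space by (intro finite_measure_mono) auto
  also have "\<dots> \<le> prob B + prob (space M - E)"
    using E assms by (intro measure_Un_le) auto
  also have "prob (space M - E) = 1 - prob E" using E by (simp add: prob_compl)
  finally show ?thesis using E by simp
qed

lemma cdf_distr_eq_prob:
  assumes "X \<in> borel_measurable M"
  shows "cdf (distr M borel X) x = prob {\<omega> \<in> space M. X \<omega> \<le> x}"
  using assms by (simp add: cdf_def measure_distr vimage_def Int_def conj_commute)

text \<open>
  Slutsky's lemma at a continuity point \<open>x\<close> of the limit: up to small probability
  \<open>X\<^sub>n \<le> x - h\<close> implies \<open>Z\<^sub>n \<le> x\<close>, which implies \<open>X\<^sub>n \<le> x + h\<close>.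
\<close>

lemma cdf_tendsto_if_diff_small_oP:
  assumes [measurable]: "\<And>n. X n \<in> borel_measurable M" "\<And>n. Z n \<in> borel_measurable M"
    and diff: "small_oP M (\<lambda>n \<omega>. Z n \<omega> - X n \<omega>)"
    and conv: "\<And>x. (\<lambda>n. cdf (distr M borel (X n)) x) \<longlonglongrightarrow> F x"
    and cont: "isCont F x"
  shows "(\<lambda>n. cdf (distr M borel (Z n)) x) \<longlonglongrightarrow> F x"
proof (rule tendstoI)
  fix e :: real assume "0 < e"
  define \<eta> where "\<eta> = e / 4"
  have \<eta>: "0 < \<eta>" using \<open>0 < e\<close> by (simp add: \<eta>_def)
  obtain d where d: "0 < d" "\<And>y. \<bar>y - x\<bar> < d \<Longrightarrow> \<bar>F y - F x\<bar> < \<eta>"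
    using cont \<eta> unfolding isCont_def LIM_eq
    by (metis abs_zero diff_self real_norm_def)
  define h where "h = d / 2"
  have h: "0 < h" "\<bar>F (x + h) - F x\<bar> < \<eta>" "\<bar>F (x - h) - F x\<bar> < \<eta>"
    using d by (auto simp: h_def)
  have "\<forall>\<^sub>F n in sequentially. likely M \<eta> (\<lambda>\<omega>. \<bar>Z n \<omega> - X n \<omega>\<bar> \<le> h)"
    using diff h \<eta> by (simp add: small_oP_def whp_def)
  moreover have "\<forall>\<^sub>F n in sequentially. \<bar>cdf (distr M borel (X n)) (x + h) - F (x + h)\<bar> < \<eta>"
    using tendstoD[OF conv \<eta>] by (simp add: dist_real_def)
  moreover have "\<forall>\<^sub>F n in sequentially. \<bar>cdf (distr M borel (X n)) (x - h) - F (x - h)\<bar> < \<eta>"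
    using tendstoD[OF conv \<eta>] by (simp add: dist_real_def)
  ultimately show "\<forall>\<^sub>F n in sequentially. dist (cdf (distr M borel (Z n)) x) (F x) < e"
  proof eventually_elim
    case (elim n)
    have "prob {\<omega> \<in> space M. Z n \<omega> \<le> x} \<le> prob {\<omega> \<in> space M. X n \<omega> \<le> x + h} + \<eta>"
      by (rule prob_le_if_likely) (auto intro: likely_mono[OF elim(1)])
    moreover have "prob {\<omega> \<in> space M. X n \<omega> \<le> x - h} \<le> prob {\<omega> \<in> space M. Z n \<omega> \<le> x} + \<eta>"
      by (rule prob_le_if_likely) (auto intro: likely_mono[OF elim(1)])
    ultimately show ?case
      using elim(2,3) h unfolding \<eta>_def dist_real_def cdf_distr_eq_prob[OF assms(1)] cdf_distr_eq_prob[OF assms(2)]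
      by linarith
  qed
qed

end

context prob_space begin

text \<open>
  Hoeffding's inequality bounds the probability that the normalised sum exceeds \<open>B\<close> uniformly in \<open>n\<close>.
  In contrast to the central limit theorem it also covers variables of variance zero, such as the
  indicator of an event of probability one.
\<close>

lemma centered_sum_big_OP:
  fixes X :: "nat \<Rightarrow> 'a \<Rightarrow> real"
  assumes indep: "indep_vars (\<lambda>_. borel) X UNIV"
    and bound: "\<And>i \<omega>. \<omega> \<in> space M \<Longrightarrow> \<bar>X i \<omega>\<bar> \<le> b"
    and mean: "\<And>i. expectation (X i) = m"
  shows "big_OP M (\<lambda>n \<omega>. (\<Sum>i<n. X i \<omega> - m) / sqrt (real n))"
  unfolding big_OP_def
proof safe
  fix \<eta> :: real assume \<eta>: "0 < \<eta>"
  have rv [measurable]: "random_variable borel (X i)" for i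
    using indep unfolding indep_vars_def by simp
  \<comment> \<open>The bound is enlarged to a positive one because Hoeffding's inequality needs a nondegenerate interval.\<close>
  define c where "c = max b 1"
  have c: "0 < c" "b \<le> c" by (auto simp: c_def)
  have "((\<lambda>B::real. 2 * exp (- (B\<^sup>2 / (2 * c\<^sup>2)))) \<longlongrightarrow> 2 * 0) at_top"
  proof (intro tendsto_mult tendsto_const filterlim_compose[OF exp_at_bot])
    show "filterlim (\<lambda>B::real. - (B\<^sup>2 / (2 * c\<^sup>2))) at_bot at_top"
      unfolding filterlim_uminus_at_bot minus_minus divide_inverse mult.commute[of "_\<^sup>2"]
      using c by (intro filterlim_tendsto_pos_mult_at_top[OF tendsto_const] filterlim_pow_at_top filterlim_ident) auto
  qed
  then have "\<forall>\<^sub>F B::real in at_top. 2 * exp (- (B\<^sup>2 / (2 * c\<^sup>2))) < \<eta>"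
    using order_tendstoD(2)[of _ "2 * 0" at_top \<eta>] \<eta> by simp
  then obtain B where B: "0 < B" "2 * exp (- (B\<^sup>2 / (2 * c\<^sup>2))) < \<eta>"
    using eventually_conj[OF eventually_gt_at_top[of "0::real"]] eventually_happens'[OF trivial_limit_at_top_linorder]
    by (smt (verit, best))
  have "likely M \<eta> (\<lambda>\<omega>. \<bar>(\<Sum>i<n. X i \<omega> - m) / sqrt (real n)\<bar> \<le> B)" if n: "0 < n" for n
  proof (rule likely_if_prob)
    interpret Hoeffding_ineq M "{..<n}" X "\<lambda>_. - c" "\<lambda>_. c" "\<Sum>i<n. expectation (X i)"
    proof unfold_locales
      show "indep_vars (\<lambda>_. borel) X {..<n}" using indep by (rule indep_vars_subset) simp
      show "AE x in M. X i x \<in> {- c..c}" for i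
        by (rule AE_I2) (use bound[of _ i] c in force)
    qed auto
    have eq: "{\<omega> \<in> space M. \<not> \<bar>(\<Sum>i<n. X i \<omega> - m) / sqrt (real n)\<bar> \<le> B} =
        {\<omega> \<in> space M. \<bar>(\<Sum>i<n. X i \<omega>) - (\<Sum>i<n. expectation (X i))\<bar> > B * sqrt n}"
      using n by (simp add: sum_subtractf mean field_simps not_le abs_divide)
    show "{\<omega> \<in> space M. \<not> \<bar>(\<Sum>i<n. X i \<omega> - m) / sqrt (real n)\<bar> \<le> B} \<in> events"
      by measurable
    have "prob {\<omega> \<in> space M. \<bar>(\<Sum>i<n. X i \<omega>) - (\<Sum>i<n. expectation (X i))\<bar> > B * sqrt n}
      \<le> prob {\<omega> \<in> space M. \<bar>(\<Sum>i<n. X i \<omega>) - (\<Sum>i<n. expectation (X i))\<bar> \<ge> B * sqrt n}"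
      by (intro finite_measure_mono) auto
    also have "\<dots> \<le> 2 * exp (- 2 * (B * sqrt n)\<^sup>2 / (\<Sum>i<n. (c - - c)\<^sup>2))"
      by (rule Hoeffding_ineq_abs_ge) (use B n c in auto)
    also have "- 2 * (B * sqrt n)\<^sup>2 / (\<Sum>i<n. (c - - c)\<^sup>2) = - (B\<^sup>2 / (2 * c\<^sup>2))"
      using n c by (simp add: power_mult_distrib field_simps power2_eq_square)
    finally show "prob {\<omega> \<in> space M. \<not> \<bar>(\<Sum>i<n. X i \<omega> - m) / sqrt (real n)\<bar> \<le> B} \<le> \<eta>"
      using B unfolding eq by simp
  qed
  then show "\<exists>B. \<forall>\<^sub>F n in sequentially. likely M \<eta> (\<lambda>\<omega>. \<bar>(\<Sum>i<n. X i \<omega> - m) / sqrt (real n)\<bar> \<le> B)"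
    by (intro exI[of _ B] eventually_mono[OF eventually_gt_at_top[of 0]]) auto
qed

lemma sample_mean_small_oP:
  fixes X :: "nat \<Rightarrow> 'a \<Rightarrow> real"
  assumes indep: "indep_vars (\<lambda>_. borel) X UNIV"
    and bound: "\<And>i \<omega>. \<omega> \<in> space M \<Longrightarrow> \<bar>X i \<omega>\<bar> \<le> b"
    and mean: "\<And>i. expectation (X i) = m"
  shows "small_oP M (\<lambda>n \<omega>. (\<Sum>i<n. X i \<omega>) / real n - m)"
proof -
  have "(\<lambda>n. 1 / sqrt (real n)) \<longlonglongrightarrow> 0" by real_asymp
  moreover have "big_OP M (\<lambda>n \<omega>. (\<Sum>i<n. X i \<omega> - m) / sqrt (real n))"
    by (rule centered_sum_big_OP[OF indep _ mean]) (rule bound)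
  ultimately have "small_oP M (\<lambda>n \<omega>. 1 / sqrt (real n) * ((\<Sum>i<n. X i \<omega> - m) / sqrt (real n)))"
    by (rule small_oP_tendsto_mult_big_OP)
  then show ?thesis
  proof (rule small_oP_if_whp_le, intro whp_if_eventually)
    show "\<forall>\<^sub>F n in sequentially. \<forall>\<omega>\<in>space M.
      \<bar>(\<Sum>i<n. X i \<omega>) / real n - m\<bar> \<le> \<bar>1 / sqrt (real n) * ((\<Sum>i<n. X i \<omega> - m) / sqrt (real n))\<bar>"
      using eventually_gt_at_top[of 0] by eventually_elim (simp add: sum_subtractf diff_divide_distrib)
  qed
qed

end

lemma normal_law_eq_distr:
  assumes "0 < V"
  shows "normal_law 0 V = distr std_normal_distribution borel (\<lambda>x. sqrt V * x)"
proof -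
  interpret prob_space std_normal_distribution by (rule prob_space_normal_density) simp
  have "distributed std_normal_distribution lborel (\<lambda>x. x) std_normal_density"
    unfolding distributed_def by (auto simp: distr_id2)
  then have "distributed std_normal_distribution lborel (\<lambda>x. 0 + sqrt V * x) (normal_density (0 + sqrt V * 0) (\<bar>sqrt V\<bar> * 1))"
    by (intro normal_density_affine) (use assms in auto)
  then have "distr std_normal_distribution lborel (\<lambda>x. sqrt V * x) = normal_law 0 V"
    using assms by (simp add: distributed_def normal_law_def)
  then show ?thesis by (metis distr_cong sets_lborel)
qed

lemma isCont_cdf_std_normal: "isCont (cdf std_normal_distribution) x"
proof -
  interpret real_distribution std_normal_distribution by (rule real_dist_normal_dist)
  have "emeasure std_normal_distribution {x} = 0"
    by (subst emeasure_density) (auto intro!: nn_integral_null_set simp: null_sets_def)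
  then show ?thesis by (simp add: isCont_cdf measure_def)
qed

lemma cdf_distr_scale:
  assumes "X \<in> borel_measurable M" "0 < s"
  shows "cdf (distr M borel (\<lambda>\<omega>. s * X \<omega>)) x = cdf (distr M borel X) (x / (s::real))"
proof -
  have "(\<lambda>\<omega>. s * X \<omega>) -` {..x} \<inter> space M = X -` {..x / s} \<inter> space M"
    using assms(2) by (auto simp: field_simps)
  then show ?thesis using assms(1) by (simp add: cdf_def measure_distr)
qed

text \<open>
  Central limit theorem for an asymptotically linear statistic \<open>Z\<close>. After division by the standard
  deviation the limit has a continuous distribution function, so the version of Slutsky's lemma
  above applies at every point.
\<close>

lemma (in prob_space) weak_conv_normal_law_if_diff_small_oP:
  fixes X :: "nat \<Rightarrow> 'a \<Rightarrow> real" and \<sigma> :: real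
  assumes indep: "indep_vars (\<lambda>_. borel) X UNIV"
    and distr: "\<And>i. distr M borel (X i) = \<mu>"
    and bound: "\<And>i \<omega>. \<omega> \<in> space M \<Longrightarrow> \<bar>X i \<omega>\<bar> \<le> b"
    and mean: "\<And>i. expectation (X i) = m"
    and var: "\<And>i. variance (X i) = V" and V: "0 < V"
    and Z [measurable]: "\<And>n. Z n \<in> borel_measurable M"
    and diff: "small_oP M (\<lambda>n \<omega>. Z n \<omega> - (\<Sum>i<n. X i \<omega> - m) / sqrt (real n))"
  shows "weak_conv_m (\<lambda>n. distr M borel (Z n)) (normal_law 0 V)"
proof -
  define \<sigma> where "\<sigma> = sqrt V"
  have \<sigma>: "0 < \<sigma>" "\<sigma>\<^sup>2 = V" using V by (auto simp: \<sigma>_def)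
  have rv [measurable]: "random_variable borel (X i)" for i
    using indep unfolding indep_vars_def by simp
  define S where "S n \<omega> = (\<Sum>i<n. X i \<omega> - m) / sqrt (real n * \<sigma>\<^sup>2)" for n \<omega>
  have [measurable]: "S n \<in> borel_measurable M" for n unfolding S_def by measurable
  have CLT: "weak_conv_m (\<lambda>n. distr M borel (S n)) std_normal_distribution"
    unfolding S_def
  proof (rule central_limit_theorem[OF indep mean \<sigma>(1) _ _ distr])
    show "integrable M (\<lambda>\<omega>. (X n \<omega>)\<^sup>2)" for n
      by (rule integrable_const_bound[where B = "b\<^sup>2"])
        (auto intro!: AE_I2 power2_le_iff_abs_le[THEN iffD2] bound order_trans[OF bound abs_ge_self] simp flip: abs_le_square_iff)
  qed (use var \<sigma> in auto)
  have "small_oP M (\<lambda>n \<omega>. (1 / \<sigma>) * (Z n \<omega> - (\<Sum>i<n. X i \<omega> - m) / sqrt (real n)))"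
    by (rule small_oP_cmult[OF diff])
  moreover have "1 / \<sigma> * (Z n \<omega> - (\<Sum>i<n. X i \<omega> - m) / sqrt (real n)) = Z n \<omega> / \<sigma> - S n \<omega>" for n \<omega>
    using \<sigma>(1) by (simp add: S_def diff_divide_distrib real_sqrt_mult right_diff_distrib)
  ultimately have d: "small_oP M (\<lambda>n \<omega>. Z n \<omega> / \<sigma> - S n \<omega>)" by simp
  have Zn: "cdf (distr M borel (Z n)) x = cdf (distr M borel (\<lambda>\<omega>. Z n \<omega> / \<sigma>)) (x / \<sigma>)" for n x
    using cdf_distr_scale[of "\<lambda>\<omega>. Z n \<omega> / \<sigma>" M \<sigma> x] \<sigma> by simp
  have N: "cdf (normal_law 0 V) x = cdf std_normal_distribution (x / \<sigma>)" for x
  proof -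
    have "cdf (distr std_normal_distribution borel (\<lambda>x. \<sigma> * x)) x
      = cdf (distr std_normal_distribution borel (\<lambda>x. x)) (x / \<sigma>)"
      by (rule cdf_distr_scale) (use \<sigma> in auto)
    also have "distr std_normal_distribution borel (\<lambda>x. x) = std_normal_distribution"
      by (rule distr_id2) simp
    finally show ?thesis by (simp add: normal_law_eq_distr[OF V] \<sigma>_def)
  qed
  have "(\<lambda>n. cdf (distr M borel (\<lambda>\<omega>. Z n \<omega> / \<sigma>)) x) \<longlonglongrightarrow> cdf std_normal_distribution x" for x
    by (rule cdf_tendsto_if_diff_small_oP[OF _ _ d])
      (use CLT isCont_cdf_std_normal in \<open>auto simp: weak_conv_m_def weak_conv_def\<close>)
  then show ?thesis
    unfolding weak_conv_m_def weak_conv_def Zn N by blast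
qed

section \<open>Minimum distance estimation\<close>

definition l1_norm :: "nat \<Rightarrow> (nat \<Rightarrow> real) \<Rightarrow> real" where
  "l1_norm d v = (\<Sum>i<d. \<bar>v i\<bar>)"

text \<open>
  Quadratic forms in coordinates. Vectors are functions of which only the arguments below \<open>d\<close> matter;
  this keeps the analysis free of dimension side conditions.
\<close>

definition bilin :: "nat \<Rightarrow> (nat \<Rightarrow> nat \<Rightarrow> real) \<Rightarrow> (nat \<Rightarrow> real) \<Rightarrow> (nat \<Rightarrow> real) \<Rightarrow> real" where
  "bilin d w u v = (\<Sum>i<d. \<Sum>j<d. u i * w i j * v j)"

lemma l1_norm_nonneg: "0 \<le> l1_norm d v"
  by (simp add: l1_norm_def sum_nonneg)

lemma l1_norm_add: "l1_norm d (\<lambda>i. u i + v i) \<le> l1_norm d u + l1_norm d v"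
  unfolding l1_norm_def sum.distrib[symmetric] by (intro sum_mono) simp

lemma l1_norm_scale: "l1_norm d (\<lambda>i. a * v i) = \<bar>a\<bar> * l1_norm d v"
  by (simp add: l1_norm_def abs_mult sum_distrib_left)

lemma l1_norm_eq_0_iff: "l1_norm d v = 0 \<longleftrightarrow> (\<forall>i<d. v i = 0)"
  by (auto simp: l1_norm_def sum_nonneg_eq_0_iff)

lemma bilin_add_left: "bilin d w (\<lambda>i. u i + v i) x = bilin d w u x + bilin d w v x"
  by (simp add: bilin_def algebra_simps sum.distrib)

lemma bilin_add_right: "bilin d w x (\<lambda>i. u i + v i) = bilin d w x u + bilin d w x v"
  by (simp add: bilin_def algebra_simps sum.distrib)

lemma bilin_scale_left: "bilin d w (\<lambda>i. a * u i) x = a * bilin d w u x"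
  by (simp add: bilin_def sum_distrib_left mult.assoc)

lemma bilin_scale_right: "bilin d w x (\<lambda>i. a * u i) = a * bilin d w x u"
  by (simp add: bilin_def sum_distrib_left mult_ac)

lemma bilin_commute:
  assumes "\<And>i j. i < d \<Longrightarrow> j < d \<Longrightarrow> w i j = w j i"
  shows "bilin d w u v = bilin d w v u"
  unfolding bilin_def by (subst sum.swap) (intro sum.cong refl, simp add: assms)

lemma bilin_weight_diff: "bilin d (\<lambda>i j. w' i j - w i j) u v = bilin d w' u v - bilin d w u v"
  by (simp add: bilin_def sum_subtractf left_diff_distrib right_diff_distrib)

lemma abs_entry_le_sum_abs:
  fixes w :: "nat \<Rightarrow> nat \<Rightarrow> real"
  assumes "i < d" "j < d"
  shows "\<bar>w i j\<bar> \<le> (\<Sum>i<d. \<Sum>j<d. \<bar>w i j\<bar>)"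
proof -
  have "\<bar>w i j\<bar> \<le> (\<Sum>j<d. \<bar>w i j\<bar>)" using assms by (intro member_le_sum) auto
  also have "\<dots> \<le> (\<Sum>i<d. \<Sum>j<d. \<bar>w i j\<bar>)" using assms
    by (intro member_le_sum[of i _ "\<lambda>i. \<Sum>j<d. \<bar>w i j\<bar>"]) (auto intro: sum_nonneg)
  finally show ?thesis .
qed

lemma abs_bilin_le:
  assumes "\<And>i j. i < d \<Longrightarrow> j < d \<Longrightarrow> \<bar>w i j\<bar> \<le> b"
  shows "\<bar>bilin d w u v\<bar> \<le> b * (l1_norm d u * l1_norm d v)"
proof -
  have "\<bar>bilin d w u v\<bar> \<le> (\<Sum>i<d. \<Sum>j<d. \<bar>u i * w i j * v j\<bar>)"
    unfolding bilin_def by (rule order_trans[OF sum_abs sum_mono]) (rule sum_abs)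
  also have "\<dots> \<le> (\<Sum>i<d. \<Sum>j<d. b * (\<bar>u i\<bar> * \<bar>v j\<bar>))"
  proof (intro sum_mono)
    fix i j assume "i \<in> {..<d}" "j \<in> {..<d}"
    then have "\<bar>w i j\<bar> * (\<bar>u i\<bar> * \<bar>v j\<bar>) \<le> b * (\<bar>u i\<bar> * \<bar>v j\<bar>)"
      by (intro mult_right_mono assms) auto
    then show "\<bar>u i * w i j * v j\<bar> \<le> b * (\<bar>u i\<bar> * \<bar>v j\<bar>)" by (simp add: abs_mult mult_ac)
  qed
  also have "\<dots> = b * (l1_norm d u * l1_norm d v)"
    unfolding l1_norm_def sum_product by (simp add: sum_distrib_left)
  finally show ?thesis .
qed

text \<open>
  By homogeneity it suffices to bound the form below on the unit sphere, where it attains a positive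
  minimum. The sphere is compact in the product topology once the irrelevant coordinates are fixed to 0.
\<close>

lemma pos_def_lower_bound:
  assumes pd: "\<And>v. \<exists>i<d. v i \<noteq> 0 \<Longrightarrow> 0 < bilin d w v v"
  shows "\<exists>\<theta>>0. \<forall>v. \<theta> * (l1_norm d v)\<^sup>2 \<le> bilin d w v v"
proof -
  define B where "B = PiE UNIV (\<lambda>i. if i < d then {-1..1::real} else {0})"
  define S where "S = B \<inter> {v. l1_norm d v = 1}"
  have "compactin (product_topology (\<lambda>i::nat. euclidean) UNIV) B"
    unfolding B_def compactin_PiE by auto
  then have "compact B" by (simp only: euclidean_product_topology compactin_euclidean_iff)
  moreover have "closed {v. l1_norm d v = 1}"
    unfolding l1_norm_def by (intro closed_Collect_eq continuous_intros continuous_on_product_coordinates)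
  ultimately have S: "compact S" unfolding S_def by (rule compact_Int_closed)
  have cont: "continuous_on S (\<lambda>v. bilin d w v v)"
    unfolding bilin_def
    by (intro continuous_intros continuous_on_subset[OF continuous_on_product_coordinates]) auto
  have "\<exists>\<theta>>0. \<forall>v\<in>S. \<theta> \<le> bilin d w v v"
  proof (cases "S = {}")
    case False
    obtain u where u: "u \<in> S" "\<And>v. v \<in> S \<Longrightarrow> bilin d w u u \<le> bilin d w v v"
      using continuous_attains_inf[OF S False cont] by auto
    have "l1_norm d u \<noteq> 0" using u(1) by (simp add: S_def)
    then have "0 < bilin d w u u" by (intro pd) (auto simp: l1_norm_eq_0_iff)
    with u(2) show ?thesis by blast
  qed (auto intro: exI[of _ 1])
  then obtain m where m: "m > 0" "\<And>v. v \<in> S \<Longrightarrow> m \<le> bilin d w v v" by auto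
  have "m * (l1_norm d v)\<^sup>2 \<le> bilin d w v v" for v
  proof (cases "l1_norm d v = 0")
    case True
    then have "\<forall>i<d. v i = 0" by (simp add: l1_norm_eq_0_iff)
    then show ?thesis using True by (simp add: bilin_def)
  next
    case False
    define a where "a = l1_norm d v"
    have a: "a > 0" using False l1_norm_nonneg[of d v] by (simp add: a_def)
    define u where "u i = (if i < d then inverse a * v i else 0)" for i
    have lu: "l1_norm d u = l1_norm d (\<lambda>i. inverse a * v i)" by (simp add: l1_norm_def u_def)
    also have "\<dots> = 1" unfolding l1_norm_scale using a by (simp add: a_def[symmetric])
    finally have u1: "l1_norm d u = 1" .
    have "\<bar>u i\<bar> \<le> 1" if "i < d" for i
      using member_le_sum[of i "{..<d}" "\<lambda>i. \<bar>u i\<bar>"] that u1 by (simp add: l1_norm_def)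
    then have "u \<in> S" using u1 by (auto simp: S_def B_def PiE_iff abs_le_iff u_def minus_le_iff)
    then have "m \<le> bilin d w u u" by (rule m)
    also have "bilin d w u u = bilin d w (\<lambda>i. inverse a * v i) (\<lambda>i. inverse a * v i)"
      by (simp add: bilin_def u_def)
    also have "\<dots> = bilin d w v v / a\<^sup>2"
      unfolding bilin_scale_left bilin_scale_right by (simp add: power2_eq_square field_simps)
    finally show ?thesis using a by (simp add: field_simps a_def)
  qed
  with m(1) show ?thesis by blast
qed

text \<open>
  Perturbing weights and argument relative to a scale \<open>D\<close> changes the value by \<open>O(\<epsilon>) D\<^sup>2\<close>, one order
  of \<open>\<epsilon>\<close> below the size \<open>D\<^sup>2\<close> of the form itself.
\<close>

lemma bilin_perturbation:
  assumes w': "\<And>i j. i < d \<Longrightarrow> j < d \<Longrightarrow> \<bar>w' i j - w i j\<bar> \<le> \<epsilon>"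
    and w: "\<And>i j. i < d \<Longrightarrow> j < d \<Longrightarrow> \<bar>w i j\<bar> \<le> \<Lambda>"
    and v: "l1_norm d v \<le> C * D" and e: "l1_norm d e \<le> \<epsilon> * D"
    and "0 \<le> \<epsilon>" "\<epsilon> \<le> 1" "0 \<le> C" "0 \<le> \<Lambda>" "0 \<le> D"
  shows "\<bar>bilin d w' (\<lambda>i. v i + e i) (\<lambda>i. v i + e i) - bilin d w v v\<bar>
    \<le> \<epsilon> * ((C + 1)\<^sup>2 + \<Lambda> * (2 * C + 1)) * D\<^sup>2"
proof -
  let ?x = "\<lambda>i. v i + e i"
  have e1: "l1_norm d e \<le> D"
    using e mult_right_mono[OF \<open>\<epsilon> \<le> 1\<close> \<open>0 \<le> D\<close>] by simp
  have x: "l1_norm d ?x \<le> (C + 1) * D"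
    using l1_norm_add[of d v e] v e1 by (simp add: algebra_simps)
  have "\<bar>bilin d (\<lambda>i j. w' i j - w i j) ?x ?x\<bar> \<le> \<epsilon> * (l1_norm d ?x * l1_norm d ?x)"
    by (rule abs_bilin_le[OF w'])
  also have "\<dots> \<le> \<epsilon> * (((C + 1) * D) * ((C + 1) * D))"
    using assms x by (intro mult_left_mono mult_mono l1_norm_nonneg) auto
  finally have 1: "\<bar>bilin d w' ?x ?x - bilin d w ?x ?x\<bar> \<le> \<epsilon> * (C + 1)\<^sup>2 * D\<^sup>2"
    by (simp add: bilin_weight_diff power2_eq_square mult_ac)
  have 2: "\<bar>bilin d w v e\<bar> \<le> \<Lambda> * ((C * D) * (\<epsilon> * D))"
    using assms by (intro order_trans[OF abs_bilin_le[OF w]] mult_left_mono mult_mono l1_norm_nonneg) auto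
  have 3: "\<bar>bilin d w e v\<bar> \<le> \<Lambda> * ((\<epsilon> * D) * (C * D))"
    using assms by (intro order_trans[OF abs_bilin_le[OF w]] mult_left_mono mult_mono l1_norm_nonneg) auto
  have 4: "\<bar>bilin d w e e\<bar> \<le> \<Lambda> * ((\<epsilon> * D) * D)"
    using assms e1 by (intro order_trans[OF abs_bilin_le[OF w]] mult_left_mono mult_mono l1_norm_nonneg) auto
  have "bilin d w ?x ?x - bilin d w v v = bilin d w v e + bilin d w e v + bilin d w e e"
    by (simp add: bilin_add_left bilin_add_right)
  then have "\<bar>bilin d w ?x ?x - bilin d w v v\<bar> \<le> \<Lambda> * ((C * D) * (\<epsilon> * D)) + \<Lambda> * ((\<epsilon> * D) * (C * D)) + \<Lambda> * ((\<epsilon> * D) * D)"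
    using 2 3 4 by linarith
  also have "\<dots> = \<epsilon> * (\<Lambda> * (2 * C + 1)) * D\<^sup>2" by (simp add: algebra_simps power2_eq_square)
  finally show ?thesis using 1 by (simp add: algebra_simps)
qed

lemma l1_norm_linear_approx:
  fixes f :: "real \<Rightarrow> nat \<Rightarrow> real"
  assumes deriv: "\<And>i. i < d \<Longrightarrow> ((\<lambda>a. f a i) has_real_derivative R i) (at a\<^sub>0)" and "0 < \<epsilon>"
  shows "\<exists>\<rho>>0. \<forall>h. \<bar>h\<bar> < \<rho> \<longrightarrow> l1_norm d (\<lambda>i. f (a\<^sub>0 + h) i - f a\<^sub>0 i - R i * h) \<le> \<epsilon> * \<bar>h\<bar>"
proof -
  define \<epsilon>' where "\<epsilon>' = \<epsilon> / (real d + 1)"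
  have \<epsilon>': "0 < \<epsilon>'" "real d * \<epsilon>' \<le> \<epsilon>" using \<open>0 < \<epsilon>\<close> by (auto simp: \<epsilon>'_def field_simps)
  have "\<forall>\<^sub>F h in at 0. \<bar>f (a\<^sub>0 + h) i - f a\<^sub>0 i - R i * h\<bar> \<le> \<epsilon>' * \<bar>h\<bar>" if "i < d" for i
  proof -
    have "((\<lambda>h. (f (a\<^sub>0 + h) i - f a\<^sub>0 i) / h) \<longlongrightarrow> R i) (at 0)"
      using deriv[OF that] by (simp add: DERIV_def)
    from tendstoD[OF this \<epsilon>'(1)] eventually_neq_at_within[of 0 0 UNIV]
    show ?thesis
    proof eventually_elim
      case (elim h)
      have "\<bar>f (a\<^sub>0 + h) i - f a\<^sub>0 i - R i * h\<bar> = \<bar>(f (a\<^sub>0 + h) i - f a\<^sub>0 i) / h - R i\<bar> * \<bar>h\<bar>"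
        using elim(2) by (simp add: abs_mult[symmetric] field_simps)
      also have "\<dots> \<le> \<epsilon>' * \<bar>h\<bar>" using elim(1) by (intro mult_right_mono) (auto simp: dist_real_def)
      finally show ?case .
    qed
  qed
  then have "\<forall>\<^sub>F h in at 0. \<forall>i\<in>{..<d}. \<bar>f (a\<^sub>0 + h) i - f a\<^sub>0 i - R i * h\<bar> \<le> \<epsilon>' * \<bar>h\<bar>"
    by (subst eventually_ball_finite_distrib) auto
  then obtain \<rho> where \<rho>: "\<rho> > 0"
    "\<And>h i. h \<noteq> 0 \<Longrightarrow> \<bar>h\<bar> < \<rho> \<Longrightarrow> i < d \<Longrightarrow> \<bar>f (a\<^sub>0 + h) i - f a\<^sub>0 i - R i * h\<bar> \<le> \<epsilon>' * \<bar>h\<bar>"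
    unfolding eventually_at by (auto simp: dist_real_def)
  have "l1_norm d (\<lambda>i. f (a\<^sub>0 + h) i - f a\<^sub>0 i - R i * h) \<le> \<epsilon> * \<bar>h\<bar>" if "\<bar>h\<bar> < \<rho>" for h
  proof (cases "h = 0")
    case False
    have "l1_norm d (\<lambda>i. f (a\<^sub>0 + h) i - f a\<^sub>0 i - R i * h) \<le> (\<Sum>i<d. \<epsilon>' * \<bar>h\<bar>)"
      unfolding l1_norm_def using \<rho>(2)[OF False that] by (intro sum_mono) auto
    also have "\<dots> = (real d * \<epsilon>') * \<bar>h\<bar>" by simp
    also have "\<dots> \<le> \<epsilon> * \<bar>h\<bar>" using \<epsilon>' by (intro mult_right_mono) auto
    finally show ?thesis .
  qed (simp add: l1_norm_def)
  with \<rho>(1) show ?thesis by blast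
qed

text \<open>
  The minimiser depends differentiably on the target \<open>s\<close>, uniformly for weights near \<open>w\<close>. Put
  \<open>u = s - f a\<^sub>0\<close> and \<open>D = \<parallel>u\<parallel>\<close>. Comparing \<open>a\<close> with \<open>a\<^sub>0\<close> gives \<open>\<parallel>f a - f a\<^sub>0\<parallel> = O(D)\<close>, hence
  \<open>\<bar>a - a\<^sub>0\<bar> = O(D)\<close> by the inverse Lipschitz assumption. On that scale the objective at \<open>a\<^sub>0 + k\<close> is
  the quadratic \<open>k \<mapsto> bilin d w (R k - u) (R k - u)\<close> up to \<open>o(D\<^sup>2)\<close>. Comparing \<open>a\<close> with the minimiser
  \<open>h\<^sub>0 = bilin d w R u / bilin d w R R\<close> of the quadratic yields \<open>(a - a\<^sub>0 - h\<^sub>0)\<^sup>2 = o(D\<^sup>2)\<close>.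
\<close>

lemma min_distance_linearization:
  fixes f :: "real \<Rightarrow> nat \<Rightarrow> real"
  assumes a\<^sub>0: "a\<^sub>0 \<in> interior A"
    and deriv: "\<And>i. i < d \<Longrightarrow> ((\<lambda>a. f a i) has_real_derivative R i) (at a\<^sub>0)"
    and R: "\<exists>i<d. R i \<noteq> 0"
    and lip: "\<And>a. a \<in> A \<Longrightarrow> \<bar>a - a\<^sub>0\<bar> \<le> C * l1_norm d (\<lambda>i. f a i - f a\<^sub>0 i)"
    and pd: "\<And>v. \<exists>i<d. v i \<noteq> 0 \<Longrightarrow> 0 < bilin d w v v"
    and sym: "\<And>i j. i < d \<Longrightarrow> j < d \<Longrightarrow> w i j = w j i"
    and \<eta>: "0 < \<eta>"
  obtains \<delta> where "0 < \<delta>"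
    "\<And>w' s a. \<lbrakk>\<And>i j. i < d \<Longrightarrow> j < d \<Longrightarrow> \<bar>w' i j - w i j\<bar> \<le> \<delta>; \<And>i. i < d \<Longrightarrow> \<bar>s i - f a\<^sub>0 i\<bar> \<le> \<delta>; a \<in> A;
      \<And>b. b \<in> A \<Longrightarrow> bilin d w' (\<lambda>i. f a i - s i) (\<lambda>i. f a i - s i) \<le> bilin d w' (\<lambda>i. f b i - s i) (\<lambda>i. f b i - s i)\<rbrakk>
     \<Longrightarrow> \<bar>a - a\<^sub>0 - bilin d w R (\<lambda>i. s i - f a\<^sub>0 i) / bilin d w R R\<bar> \<le> \<eta> * l1_norm d (\<lambda>i. s i - f a\<^sub>0 i)"
proof -
  obtain \<theta> where \<theta>: "0 < \<theta>" "\<And>v. \<theta> * (l1_norm d v)\<^sup>2 \<le> bilin d w v v"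
    using pos_def_lower_bound[of d w] pd by blast
  define \<kappa> where "\<kappa> = bilin d w R R"
  have \<kappa>: "0 < \<kappa>" unfolding \<kappa>_def by (rule pd[OF R])
  define \<Lambda> where "\<Lambda> = (\<Sum>i<d. \<Sum>j<d. \<bar>w i j\<bar>)"
  have \<Lambda>0: "0 \<le> \<Lambda>" unfolding \<Lambda>_def by (intro sum_nonneg) auto
  have \<Lambda>: "\<bar>w i j\<bar> \<le> \<Lambda>" if "i < d" "j < d" for i j
    unfolding \<Lambda>_def by (rule abs_entry_le_sum_abs[OF that])
  \<comment> \<open>\<open>C\<^sub>1\<close> bounds the residual at the minimiser, \<open>C\<^sub>2\<close> the two increments \<open>a - a\<^sub>0\<close> and \<open>h\<^sub>0\<close>, \<open>C\<^sub>3\<close> the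
    linearised residuals, all as multiples of \<open>D\<close>; \<open>C\<^sub>4\<close> is the constant of \<open>bilin_perturbation\<close>.\<close>
  define C\<^sub>1 where "C\<^sub>1 = sqrt (2 * (\<Lambda> + 1) / \<theta>)"
  define C\<^sub>2 where "C\<^sub>2 = \<bar>C\<bar> * (C\<^sub>1 + 1) + \<Lambda> * l1_norm d R / \<kappa> + 1"
  define C\<^sub>3 where "C\<^sub>3 = l1_norm d R * C\<^sub>2 + 1"
  define C\<^sub>4 where "C\<^sub>4 = (C\<^sub>3 + 1)\<^sup>2 + \<Lambda> * (2 * C\<^sub>3 + 1)"
  have C1: "0 \<le> C\<^sub>1" "C\<^sub>1\<^sup>2 = 2 * (\<Lambda> + 1) / \<theta>" using \<Lambda>0 \<theta> by (auto simp: C\<^sub>1_def)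
  have C2: "\<bar>C\<bar> * (C\<^sub>1 + 1) \<le> C\<^sub>2" "\<Lambda> * l1_norm d R / \<kappa> \<le> C\<^sub>2" "0 < C\<^sub>2"
    using C1 \<Lambda>0 \<kappa> l1_norm_nonneg[of d R] by (auto simp: C\<^sub>2_def add_nonneg_pos)
  have C3: "1 \<le> C\<^sub>3" using C2 l1_norm_nonneg[of d R] by (simp add: C\<^sub>3_def)
  have C4: "0 < C\<^sub>4" using C3 \<Lambda>0 by (auto simp: C\<^sub>4_def intro!: add_pos_nonneg)
  \<comment> \<open>Both values of the objective are approximated up to \<open>\<epsilon> C\<^sub>4 D\<^sup>2\<close>, so \<open>\<epsilon>\<close> is chosen to make twice
    this error at most \<open>\<kappa> (\<eta> D)\<^sup>2\<close>.\<close>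
  define \<epsilon> where "\<epsilon> = min 1 (\<kappa> * \<eta>\<^sup>2 / (2 * C\<^sub>4))"
  have \<epsilon>: "0 < \<epsilon>" "\<epsilon> \<le> 1" "\<epsilon> \<le> \<kappa> * \<eta>\<^sup>2 / (2 * C\<^sub>4)" using \<kappa> \<eta> C4 by (auto simp: \<epsilon>_def)
  obtain \<rho>\<^sub>1 where \<rho>1: "0 < \<rho>\<^sub>1"
    "\<And>h. \<bar>h\<bar> < \<rho>\<^sub>1 \<Longrightarrow> l1_norm d (\<lambda>i. f (a\<^sub>0 + h) i - f a\<^sub>0 i - R i * h) \<le> \<epsilon> / C\<^sub>2 * \<bar>h\<bar>"
    using l1_norm_linear_approx[of d f R a\<^sub>0 "\<epsilon> / C\<^sub>2"] deriv \<epsilon> C2 by auto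
  obtain \<rho>\<^sub>2 where \<rho>2: "0 < \<rho>\<^sub>2" "ball a\<^sub>0 \<rho>\<^sub>2 \<subseteq> A"
    using a\<^sub>0 by (meson mem_interior)
  define \<rho> where "\<rho> = min \<rho>\<^sub>1 \<rho>\<^sub>2"
  have \<rho>: "0 < \<rho>" using \<rho>1 \<rho>2 by (simp add: \<rho>_def)
  \<comment> \<open>The last bound ensures \<open>C\<^sub>2 D < \<rho>\<close>, as \<open>D\<close> is at most \<open>d \<delta>\<close>.\<close>
  define \<delta> where "\<delta> = min \<epsilon> (min (\<theta> / 2) (\<rho> / (C\<^sub>2 * (real d + 1))))"
  have \<delta>: "0 < \<delta>" "\<delta> \<le> \<epsilon>" "\<delta> \<le> \<theta> / 2" "\<delta> \<le> \<rho> / (C\<^sub>2 * (real d + 1))"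
    using \<epsilon> \<theta> \<rho> C2 unfolding \<delta>_def min_less_iff_conj by (simp, linarith, linarith, linarith)
  show ?thesis
  proof (rule that[OF \<delta>(1)])
    fix w' :: "nat \<Rightarrow> nat \<Rightarrow> real" and s :: "nat \<Rightarrow> real" and a
    assume w': "\<And>i j. i < d \<Longrightarrow> j < d \<Longrightarrow> \<bar>w' i j - w i j\<bar> \<le> \<delta>"
      and s: "\<And>i. i < d \<Longrightarrow> \<bar>s i - f a\<^sub>0 i\<bar> \<le> \<delta>" and a: "a \<in> A"
      and arg_min: "\<And>b. b \<in> A \<Longrightarrow> bilin d w' (\<lambda>i. f a i - s i) (\<lambda>i. f a i - s i) \<le> bilin d w' (\<lambda>i. f b i - s i) (\<lambda>i. f b i - s i)"
    define u where "u i = s i - f a\<^sub>0 i" for i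
    define D where "D = l1_norm d u"
    have D: "0 \<le> D" unfolding D_def by (rule l1_norm_nonneg)
    have "D \<le> (\<Sum>i<d. \<delta>)" unfolding D_def l1_norm_def u_def using s by (intro sum_mono) auto
    also have "\<dots> = real d * \<delta>" by simp
    finally have "C\<^sub>2 * D \<le> C\<^sub>2 * (real d * \<delta>)" using C2 by simp
    also have "\<dots> < C\<^sub>2 * (real d + 1) * \<delta>" using C2 \<delta> by (simp add: algebra_simps)
    also have "\<dots> \<le> \<rho>" using \<delta>(4) C2 by (simp add: pos_le_divide_eq add_pos_nonneg mult.commute)
    finally have C2D: "C\<^sub>2 * D < \<rho>" .
    define x where "x i = f a i - s i" for i
    have lower: "\<theta> / 2 * (l1_norm d x)\<^sup>2 \<le> bilin d w' x x"
    proof -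
      have "\<bar>bilin d (\<lambda>i j. w' i j - w i j) x x\<bar> \<le> \<theta> / 2 * (l1_norm d x * l1_norm d x)"
        using w' \<delta>(3) by (intro abs_bilin_le) force
      then show ?thesis
        using \<theta>(2)[of x] unfolding bilin_weight_diff power2_eq_square by (simp only: abs_le_iff) argo
    qed
    have "bilin d w' x x \<le> bilin d w' (\<lambda>i. f a\<^sub>0 i - s i) (\<lambda>i. f a\<^sub>0 i - s i)"
      unfolding x_def using a\<^sub>0 interior_subset by (intro arg_min) blast
    also have "\<dots> = bilin d w' (\<lambda>i. - 1 * u i) (\<lambda>i. - 1 * u i)" by (simp add: u_def)
    also have "\<dots> = bilin d w' u u" unfolding bilin_scale_left bilin_scale_right by simp
    also have "\<dots> \<le> (\<Lambda> + 1) * (l1_norm d u * l1_norm d u)"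
    proof (rule order_trans[OF abs_ge_self abs_bilin_le])
      fix i j assume "i < d" "j < d"
      then show "\<bar>w' i j\<bar> \<le> \<Lambda> + 1" using w'[of i j] \<Lambda>[of i j] \<delta> \<epsilon> by linarith
    qed
    finally have "\<theta> / 2 * (l1_norm d x)\<^sup>2 \<le> (\<Lambda> + 1) * D\<^sup>2"
      using lower by (simp add: D_def power2_eq_square)
    then have "(l1_norm d x)\<^sup>2 \<le> 2 * (\<Lambda> + 1) / \<theta> * D\<^sup>2"
      using \<theta>(1) by (simp add: field_simps)
    then have "(l1_norm d x)\<^sup>2 \<le> (C\<^sub>1 * D)\<^sup>2"
      by (simp only: power_mult_distrib C1(2))
    then have x1: "l1_norm d x \<le> C\<^sub>1 * D" by (rule power2_le_imp_le) (intro mult_nonneg_nonneg C1(1) D)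
    define h where "h = a - a\<^sub>0"
    have "l1_norm d (\<lambda>i. f a i - f a\<^sub>0 i) = l1_norm d (\<lambda>i. x i + u i)" by (simp add: x_def u_def)
    also have "\<dots> \<le> (C\<^sub>1 + 1) * D" using l1_norm_add[of d x u] x1 by (simp add: D_def algebra_simps)
    finally have fa: "l1_norm d (\<lambda>i. f a i - f a\<^sub>0 i) \<le> (C\<^sub>1 + 1) * D" .
    have "\<bar>h\<bar> \<le> C * l1_norm d (\<lambda>i. f a i - f a\<^sub>0 i)" unfolding h_def by (rule lip[OF a])
    also have "\<dots> \<le> \<bar>C\<bar> * ((C\<^sub>1 + 1) * D)"
      by (rule order_trans[OF mult_right_mono[OF abs_ge_self] mult_left_mono[OF fa]]) (auto simp: l1_norm_nonneg)
    also have "\<dots> \<le> C\<^sub>2 * D" using mult_right_mono[OF C2(1) D] by (simp add: mult.assoc)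
    finally have h: "\<bar>h\<bar> \<le> C\<^sub>2 * D" .
    define h\<^sub>0 where "h\<^sub>0 = bilin d w R u / \<kappa>"
    have "\<bar>h\<^sub>0\<bar> = \<bar>bilin d w R u\<bar> / \<kappa>" using \<kappa> by (simp add: h\<^sub>0_def)
    also have "\<dots> \<le> \<Lambda> * (l1_norm d R * l1_norm d u) / \<kappa>"
      using \<kappa> by (intro divide_right_mono abs_bilin_le \<Lambda>) auto
    also have "\<dots> = (\<Lambda> * l1_norm d R / \<kappa>) * D" by (simp add: D_def)
    also have "\<dots> \<le> C\<^sub>2 * D" by (rule mult_right_mono[OF C2(2) D])
    finally have h0: "\<bar>h\<^sub>0\<bar> \<le> C\<^sub>2 * D" .
    \<comment> \<open>The residual \<open>f (a\<^sub>0 + k) - s\<close> is \<open>v k\<close> up to the error of the tangent approximation.\<close>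
    define v where "v k i = R i * k + - 1 * u i" for k i
    have approx: "\<bar>bilin d w' (\<lambda>i. f (a\<^sub>0 + k) i - s i) (\<lambda>i. f (a\<^sub>0 + k) i - s i) - bilin d w (v k) (v k)\<bar> \<le> \<epsilon> * C\<^sub>4 * D\<^sup>2"
      if k: "\<bar>k\<bar> \<le> C\<^sub>2 * D" for k
    proof -
      define e where "e i = f (a\<^sub>0 + k) i - f a\<^sub>0 i - R i * k" for i
      have "l1_norm d e \<le> \<epsilon> / C\<^sub>2 * \<bar>k\<bar>" unfolding e_def using k C2D by (intro \<rho>1) (simp add: \<rho>_def)
      also have "\<dots> \<le> \<epsilon> / C\<^sub>2 * (C\<^sub>2 * D)" using k \<epsilon> C2 by (intro mult_left_mono) auto
      also have "\<dots> = \<epsilon> * D" using C2 by simp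
      finally have e: "l1_norm d e \<le> \<epsilon> * D" .
      have "l1_norm d (v k) \<le> l1_norm d (\<lambda>i. k * R i) + l1_norm d (\<lambda>i. - 1 * u i)"
        unfolding v_def by (rule order_trans[OF _ l1_norm_add]) (simp add: mult.commute)
      also have "\<dots> = \<bar>k\<bar> * l1_norm d R + D" unfolding l1_norm_scale D_def by simp
      also have "\<dots> \<le> (C\<^sub>2 * D) * l1_norm d R + D" using k by (intro add_right_mono mult_right_mono l1_norm_nonneg)
      also have "\<dots> = C\<^sub>3 * D" by (simp add: C\<^sub>3_def algebra_simps)
      finally have v: "l1_norm d (v k) \<le> C\<^sub>3 * D" .
      have eq: "(\<lambda>i. f (a\<^sub>0 + k) i - s i) = (\<lambda>i. v k i + e i)" by (simp add: v_def e_def u_def)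
      show ?thesis unfolding eq C\<^sub>4_def
        by (rule bilin_perturbation[OF _ \<Lambda> v e]) (use w' \<delta> \<epsilon> C3 \<Lambda>0 D in \<open>force+\<close>)
    qed
    have q: "bilin d w (v k) (v k) = \<kappa> * k\<^sup>2 - 2 * k * (\<kappa> * h\<^sub>0) + bilin d w u u" for k
    proof -
      have "bilin d w (v k) (v k) = k * k * bilin d w R R - k * bilin d w R u - k * bilin d w u R + bilin d w u u"
        unfolding v_def mult.commute[of "R _" k] bilin_add_left bilin_add_right bilin_scale_left bilin_scale_right
        by (simp add: algebra_simps)
      moreover have "bilin d w u R = bilin d w R u" by (rule bilin_commute[OF sym])
      ultimately show ?thesis using \<kappa> by (simp add: h\<^sub>0_def \<kappa>_def[symmetric] power2_eq_square)
    qed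
    \<comment> \<open>This is where \<open>a\<^sub>0\<close> being interior is used: the minimiser of the quadratic is an admissible competitor.\<close>
    have "a\<^sub>0 + h\<^sub>0 \<in> A" using \<rho>2 h0 C2D by (auto simp: \<rho>_def dist_real_def subset_iff)
    then have "bilin d w' (\<lambda>i. f (a\<^sub>0 + h) i - s i) (\<lambda>i. f (a\<^sub>0 + h) i - s i)
      \<le> bilin d w' (\<lambda>i. f (a\<^sub>0 + h\<^sub>0) i - s i) (\<lambda>i. f (a\<^sub>0 + h\<^sub>0) i - s i)"
      using arg_min by (simp add: h_def)
    with approx[OF h] approx[OF h0] have "bilin d w (v h) (v h) - bilin d w (v h\<^sub>0) (v h\<^sub>0) \<le> 2 * \<epsilon> * C\<^sub>4 * D\<^sup>2"
      by linarith
    moreover have "bilin d w (v h) (v h) - bilin d w (v h\<^sub>0) (v h\<^sub>0) = \<kappa> * (h - h\<^sub>0)\<^sup>2"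
      unfolding q by (simp add: power2_eq_square algebra_simps)
    moreover have "2 * \<epsilon> * C\<^sub>4 \<le> \<kappa> * \<eta>\<^sup>2" using \<epsilon>(3) C4 by (simp add: field_simps)
    then have "2 * \<epsilon> * C\<^sub>4 * D\<^sup>2 \<le> \<kappa> * \<eta>\<^sup>2 * D\<^sup>2" by (rule mult_right_mono) simp
    ultimately have "\<kappa> * (h - h\<^sub>0)\<^sup>2 \<le> \<kappa> * (\<eta> * D)\<^sup>2"
      by (simp add: power_mult_distrib mult.assoc)
    then have "(h - h\<^sub>0)\<^sup>2 \<le> (\<eta> * D)\<^sup>2"
      using \<kappa> by simp
    then have "\<bar>h - h\<^sub>0\<bar> \<le> \<eta> * D"
      using \<eta> D by (simp add: abs_le_square_iff[symmetric])
    then show "\<bar>a - a\<^sub>0 - bilin d w R (\<lambda>i. s i - f a\<^sub>0 i) / bilin d w R R\<bar> \<le> \<eta> * l1_norm d (\<lambda>i. s i - f a\<^sub>0 i)"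
      by (simp add: h_def h\<^sub>0_def \<kappa>_def D_def u_def[abs_def])
  qed
qed

section \<open>The estimator as a function of the block sums\<close>

text \<open>
  The exact identity \<open>(\<mu>\<^sub>i + y\<^sub>i) / (\<mu>\<^sub>K + y\<^sub>K) - r\<^sub>i = (y\<^sub>i - r\<^sub>i y\<^sub>K) / (\<mu>\<^sub>K + y\<^sub>K)\<close> shows that only the
  denominator has to be replaced by \<open>\<mu>\<^sub>K\<close>, at a relative cost of order \<open>\<bar>y\<^sub>K\<bar>\<close>.
\<close>

lemma ratio_linearization:
  fixes \<mu> :: "nat \<Rightarrow> real"
  assumes K: "1 \<le> K" and \<mu>: "0 < \<mu> K" and \<eta>: "0 < \<eta>"
  defines "r \<equiv> \<lambda>i. \<mu> (Suc i) / \<mu> K"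
  obtains \<delta> where "0 < \<delta>"
    "\<And>y. (\<And>k. k \<in> {1..K} \<Longrightarrow> \<bar>y k\<bar> \<le> \<delta>) \<Longrightarrow>
      l1_norm (K - 1) (\<lambda>i. (\<mu> (Suc i) + y (Suc i)) / (\<mu> K + y K) - r i - (y (Suc i) - r i * y K) / \<mu> K)
        \<le> \<eta> * (\<Sum>k\<in>{1..K}. \<bar>y k\<bar>)"
proof -
  define C where "C = (\<Sum>i<K - 1. 1 + \<bar>r i\<bar>)"
  have C: "0 \<le> C" unfolding C_def by (intro sum_nonneg) auto
  define \<delta> where "\<delta> = min (\<mu> K / 2) (\<eta> * (\<mu> K)\<^sup>2 / (2 * (C + 1)))"
  have \<delta>: "0 < \<delta>" "\<delta> \<le> \<mu> K / 2" "\<delta> \<le> \<eta> * (\<mu> K)\<^sup>2 / (2 * (C + 1))"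
  proof -
    show "0 < \<delta>" using \<mu> \<eta> C by (simp add: \<delta>_def)
  qed (unfold \<delta>_def, linarith+)
  show thesis
  proof (rule that[OF \<delta>(1)])
    fix y :: "nat \<Rightarrow> real" assume y: "\<And>k. k \<in> {1..K} \<Longrightarrow> \<bar>y k\<bar> \<le> \<delta>"
    define S where "S = (\<Sum>k\<in>{1..K}. \<bar>y k\<bar>)"
    have S: "\<bar>y k\<bar> \<le> S" if "k \<in> {1..K}" for k
      unfolding S_def by (rule member_le_sum[OF that]) auto
    have S0: "0 \<le> S" unfolding S_def by (intro sum_nonneg) auto
    have yK: "\<bar>y K\<bar> \<le> \<delta>" using y[of K] K by simp
    have x: "\<mu> K / 2 \<le> \<mu> K + y K" using yK \<delta>(2) by linarith
    have entry: "\<bar>(\<mu> (Suc i) + y (Suc i)) / (\<mu> K + y K) - r i - (y (Suc i) - r i * y K) / \<mu> K\<bar>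
        \<le> (1 + \<bar>r i\<bar>) * (2 * \<delta> / (\<mu> K)\<^sup>2 * S)" if i: "i < K - 1" for i
    proof -
      have pos: "0 < \<mu> K + y K" using x \<mu> by linarith
      have "(\<mu> (Suc i) + y (Suc i)) / (\<mu> K + y K) - r i - (y (Suc i) - r i * y K) / \<mu> K =
        (y (Suc i) - r i * y K) * (- y K / ((\<mu> K + y K) * \<mu> K))"
        using \<mu> pos by (simp add: r_def divide_simps) (simp add: algebra_simps)
      also have "\<bar>\<dots>\<bar> = \<bar>y (Suc i) - r i * y K\<bar> * (\<bar>y K\<bar> / ((\<mu> K + y K) * \<mu> K))"
        using \<mu> pos by (simp add: abs_mult)
      also have "\<dots> \<le> ((1 + \<bar>r i\<bar>) * S) * (\<delta> / (\<mu> K / 2 * \<mu> K))"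
      proof (intro mult_mono frac_le)
        have "\<bar>y (Suc i) - r i * y K\<bar> \<le> \<bar>y (Suc i)\<bar> + \<bar>r i\<bar> * \<bar>y K\<bar>"
          by (rule order_trans[OF abs_triangle_ineq4]) (simp add: abs_mult)
        also have "\<dots> \<le> S + \<bar>r i\<bar> * S"
          using i K by (intro add_mono mult_left_mono S) auto
        finally show "\<bar>y (Suc i) - r i * y K\<bar> \<le> (1 + \<bar>r i\<bar>) * S" by (simp add: algebra_simps)
      qed (use \<mu> x yK \<delta> S0 in \<open>auto intro!: mult_nonneg_nonneg divide_nonneg_nonneg\<close>)
      also have "\<dots> = (1 + \<bar>r i\<bar>) * (2 * \<delta> / (\<mu> K)\<^sup>2 * S)"
        by (simp add: power2_eq_square)
      finally show ?thesis .
    qed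
    have "l1_norm (K - 1) (\<lambda>i. (\<mu> (Suc i) + y (Suc i)) / (\<mu> K + y K) - r i - (y (Suc i) - r i * y K) / \<mu> K)
      \<le> (\<Sum>i<K - 1. (1 + \<bar>r i\<bar>) * (2 * \<delta> / (\<mu> K)\<^sup>2 * S))"
      unfolding l1_norm_def by (intro sum_mono entry) auto
    also have "\<dots> = C * (2 * \<delta> / (\<mu> K)\<^sup>2) * S" unfolding C_def sum_distrib_right by (simp only: mult.assoc)
    also have "\<dots> \<le> (C + 1) * (2 * \<delta> / (\<mu> K)\<^sup>2) * S"
      using \<delta> S0 by (intro mult_right_mono) auto
    also have "(C + 1) * (2 * \<delta> / (\<mu> K)\<^sup>2) \<le> \<eta>"
      using \<delta>(3) C \<mu> by (simp add: field_simps)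
    then have "(C + 1) * (2 * \<delta> / (\<mu> K)\<^sup>2) * S \<le> \<eta> * S" using S0 by (rule mult_right_mono)
    finally show "l1_norm (K - 1) (\<lambda>i. (\<mu> (Suc i) + y (Suc i)) / (\<mu> K + y K) - r i - (y (Suc i) - r i * y K) / \<mu> K)
        \<le> \<eta> * (\<Sum>k\<in>{1..K}. \<bar>y k\<bar>)" by (simp add: S_def)
  qed
qed

text \<open>
  The vector \<open>H\<^sup>T W R / (R\<^sup>T W R)\<close>: the derivative of the estimator with respect to the block sum (over \<open>n\<close>) of
  index \<open>k\<close>, for \<open>1 \<le> k \<le> K\<close>. The last block enters every ratio through the denominator.
\<close>

definition influence :: "nat \<Rightarrow> (nat \<Rightarrow> nat \<Rightarrow> real) \<Rightarrow> (nat \<Rightarrow> real) \<Rightarrow> (nat \<Rightarrow> real) \<Rightarrow> nat \<Rightarrow> real" where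
  "influence K w R \<mu> k =
    (if k < K then \<Sum>j<K - 1. w (k - 1) j * R j
     else - (\<Sum>i<K - 1. \<mu> (Suc i) / \<mu> K * (\<Sum>j<K - 1. w i j * R j))) / (\<mu> K * bilin (K - 1) w R R)"

lemma sum_influence:
  fixes \<mu> R y :: "nat \<Rightarrow> real"
  assumes K: "1 \<le> K" and sym: "\<And>i j. i < K - 1 \<Longrightarrow> j < K - 1 \<Longrightarrow> w i j = w j i"
  shows "(\<Sum>k\<in>{1..K}. influence K w R \<mu> k * y k) =
    bilin (K - 1) w R (\<lambda>i. (y (Suc i) - \<mu> (Suc i) / \<mu> K * y K) / \<mu> K) / bilin (K - 1) w R R"
proof -
  define \<kappa> where "\<kappa> = bilin (K - 1) w R R"
  define u where "u i = (\<Sum>j<K - 1. w i j * R j)" for i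
  have 1: "(\<Sum>k\<in>{1..K}. influence K w R \<mu> k * y k) =
      (\<Sum>i<K - 1. influence K w R \<mu> (Suc i) * y (Suc i)) + influence K w R \<mu> K * y K"
  proof -
    have "{1..K} = insert K {1..K - 1}" "K \<notin> {1..K - 1}" using K by auto
    then have "(\<Sum>k\<in>{1..K}. influence K w R \<mu> k * y k) =
        influence K w R \<mu> K * y K + (\<Sum>k\<in>{1..K - 1}. influence K w R \<mu> k * y k)" by simp
    also have "(\<Sum>k\<in>{1..K - 1}. influence K w R \<mu> k * y k) = (\<Sum>i<K - 1. influence K w R \<mu> (Suc i) * y (Suc i))"
      by (rule sum.reindex_bij_witness[of _ Suc "\<lambda>k. k - 1"]) auto
    finally show ?thesis by simp
  qed
  have 2: "(\<Sum>i<K - 1. influence K w R \<mu> (Suc i) * y (Suc i)) = (\<Sum>i<K - 1. u i * y (Suc i)) / (\<mu> K * \<kappa>)"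
    unfolding sum_divide_distrib by (intro sum.cong refl) (auto simp: influence_def u_def \<kappa>_def)
  have 3: "influence K w R \<mu> K * y K = - (\<Sum>i<K - 1. u i * (\<mu> (Suc i) / \<mu> K * y K)) / (\<mu> K * \<kappa>)"
  proof -
    have "influence K w R \<mu> K = - (\<Sum>i<K - 1. \<mu> (Suc i) / \<mu> K * u i) / (\<mu> K * \<kappa>)"
      by (simp only: influence_def u_def \<kappa>_def less_irrefl if_False)
    moreover have "(\<Sum>i<K - 1. \<mu> (Suc i) / \<mu> K * u i) * y K = (\<Sum>i<K - 1. u i * (\<mu> (Suc i) / \<mu> K * y K))"
      unfolding sum_distrib_right by (intro sum.cong) (simp_all add: mult_ac)
    ultimately show ?thesis by (simp only: times_divide_eq_left mult_minus_left)
  qed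
  have 4: "(\<Sum>k\<in>{1..K}. influence K w R \<mu> k * y k)
      = (\<Sum>i<K - 1. u i * (y (Suc i) - \<mu> (Suc i) / \<mu> K * y K)) / (\<mu> K * \<kappa>)"
    unfolding 1 2 3 by (simp add: right_diff_distrib sum_subtractf diff_divide_distrib)
  have "bilin (K - 1) w R v = (\<Sum>i<K - 1. u i * v i)" for v
  proof -
    have "bilin (K - 1) w R v = bilin (K - 1) w v R" by (rule bilin_commute[OF sym])
    also have "\<dots> = (\<Sum>i<K - 1. u i * v i)"
      unfolding bilin_def u_def by (simp add: sum_distrib_left sum_distrib_right mult_ac)
    finally show ?thesis .
  qed
  moreover have "(\<Sum>i<K - 1. u i * (v i / \<mu> K)) / \<kappa> = (\<Sum>i<K - 1. u i * v i) / (\<mu> K * \<kappa>)" for v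
    by (simp only: times_divide_eq_right sum_divide_distrib[symmetric] divide_divide_eq_left)
  ultimately show ?thesis unfolding 4 \<kappa>_def[symmetric] by (simp only:)
qed

text \<open>
  Chain rule: the linearisation of the estimator in the ratios composed with that of the ratios in the
  deviations \<open>y\<close> of the block sums from \<open>\<mu>\<close>.
\<close>

lemma estimator_linearization:
  fixes f :: "real \<Rightarrow> nat \<Rightarrow> real" and \<mu> :: "nat \<Rightarrow> real"
  assumes K: "1 \<le> K" and \<mu>: "0 < \<mu> K" and f: "\<And>i. i < K - 1 \<Longrightarrow> f a\<^sub>0 i = \<mu> (Suc i) / \<mu> K"
    and a\<^sub>0: "a\<^sub>0 \<in> interior A"
    and deriv: "\<And>i. i < K - 1 \<Longrightarrow> ((\<lambda>a. f a i) has_real_derivative R i) (at a\<^sub>0)"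
    and R: "\<exists>i<K - 1. R i \<noteq> 0"
    and lip: "\<And>a. a \<in> A \<Longrightarrow> \<bar>a - a\<^sub>0\<bar> \<le> C * l1_norm (K - 1) (\<lambda>i. f a i - f a\<^sub>0 i)"
    and pd: "\<And>v. \<exists>i<K - 1. v i \<noteq> 0 \<Longrightarrow> 0 < bilin (K - 1) w v v"
    and sym: "\<And>i j. i < K - 1 \<Longrightarrow> j < K - 1 \<Longrightarrow> w i j = w j i"
    and \<eta>: "0 < \<eta>"
  obtains \<delta> where "0 < \<delta>"
    "\<And>w' s y a. \<lbrakk>\<And>i j. i < K - 1 \<Longrightarrow> j < K - 1 \<Longrightarrow> \<bar>w' i j - w i j\<bar> \<le> \<delta>; \<And>k. k \<in> {1..K} \<Longrightarrow> \<bar>y k\<bar> \<le> \<delta>;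
      \<And>i. i < K - 1 \<Longrightarrow> s i = (\<mu> (Suc i) + y (Suc i)) / (\<mu> K + y K); a \<in> A;
      \<And>b. b \<in> A \<Longrightarrow> bilin (K - 1) w' (\<lambda>i. f a i - s i) (\<lambda>i. f a i - s i)
        \<le> bilin (K - 1) w' (\<lambda>i. f b i - s i) (\<lambda>i. f b i - s i)\<rbrakk>
     \<Longrightarrow> \<bar>a - a\<^sub>0 - (\<Sum>k\<in>{1..K}. influence K w R \<mu> k * y k)\<bar> \<le> \<eta> * (\<Sum>k\<in>{1..K}. \<bar>y k\<bar>)"
proof -
  let ?d = "K - 1"
  define r where "r i = \<mu> (Suc i) / \<mu> K" for i
  define \<kappa> where "\<kappa> = bilin ?d w R R"
  have \<kappa>: "0 < \<kappa>" unfolding \<kappa>_def by (rule pd[OF R])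
  define \<Lambda> where "\<Lambda> = (\<Sum>i<?d. \<Sum>j<?d. \<bar>w i j\<bar>)"
  have \<Lambda>0: "0 \<le> \<Lambda>" unfolding \<Lambda>_def by (intro sum_nonneg) auto
  have \<Lambda>: "\<bar>w i j\<bar> \<le> \<Lambda>" if "i < ?d" "j < ?d" for i j
    unfolding \<Lambda>_def by (rule abs_entry_le_sum_abs[OF that])
  \<comment> \<open>\<open>C\<^sub>1\<close> is a Lipschitz constant of the linearised ratios and \<open>C\<^sub>2\<close> one of the linearised estimator.
    The allowed error \<open>\<eta>\<close> is split equally between the two linearisations.\<close>
  define C\<^sub>1 where "C\<^sub>1 = (\<Sum>i<?d. (1 + \<bar>r i\<bar>) / \<mu> K)"
  have C1: "0 \<le> C\<^sub>1" unfolding C\<^sub>1_def using \<mu> by (intro sum_nonneg) auto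
  define C\<^sub>2 where "C\<^sub>2 = \<Lambda> * l1_norm ?d R / \<kappa>"
  have C2: "0 \<le> C\<^sub>2" unfolding C\<^sub>2_def using \<Lambda>0 \<kappa> l1_norm_nonneg[of ?d R] by simp
  define \<eta>\<^sub>1 where "\<eta>\<^sub>1 = \<eta> / (2 * (C\<^sub>1 + 1))"
  define \<eta>\<^sub>2 where "\<eta>\<^sub>2 = min 1 (\<eta> / (2 * (C\<^sub>2 + 1)))"
  have \<eta>1: "0 < \<eta>\<^sub>1" "\<eta>\<^sub>1 * (C\<^sub>1 + 1) = \<eta> / 2" using \<eta> C1 by (simp_all add: \<eta>\<^sub>1_def field_simps)
  have \<eta>2: "0 < \<eta>\<^sub>2" "\<eta>\<^sub>2 \<le> 1" "C\<^sub>2 * \<eta>\<^sub>2 \<le> \<eta> / 2"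
  proof -
    show "0 < \<eta>\<^sub>2" "\<eta>\<^sub>2 \<le> 1" using \<eta> C2 by (auto simp: \<eta>\<^sub>2_def)
    have "C\<^sub>2 * \<eta>\<^sub>2 \<le> (C\<^sub>2 + 1) * (\<eta> / (2 * (C\<^sub>2 + 1)))"
      using C2 \<eta> \<open>0 < \<eta>\<^sub>2\<close> by (intro mult_mono) (auto simp: \<eta>\<^sub>2_def)
    also have "\<dots> = \<eta> / 2" using C2 by (simp add: field_simps)
    finally show "C\<^sub>2 * \<eta>\<^sub>2 \<le> \<eta> / 2" .
  qed
  obtain \<delta>\<^sub>1 where \<delta>1: "0 < \<delta>\<^sub>1"
    "\<And>w' s a. \<lbrakk>\<And>i j. i < ?d \<Longrightarrow> j < ?d \<Longrightarrow> \<bar>w' i j - w i j\<bar> \<le> \<delta>\<^sub>1; \<And>i. i < ?d \<Longrightarrow> \<bar>s i - f a\<^sub>0 i\<bar> \<le> \<delta>\<^sub>1; a \<in> A;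
      \<And>b. b \<in> A \<Longrightarrow> bilin ?d w' (\<lambda>i. f a i - s i) (\<lambda>i. f a i - s i) \<le> bilin ?d w' (\<lambda>i. f b i - s i) (\<lambda>i. f b i - s i)\<rbrakk>
     \<Longrightarrow> \<bar>a - a\<^sub>0 - bilin ?d w R (\<lambda>i. s i - f a\<^sub>0 i) / bilin ?d w R R\<bar> \<le> \<eta>\<^sub>1 * l1_norm ?d (\<lambda>i. s i - f a\<^sub>0 i)"
  proof (rule min_distance_linearization[of a\<^sub>0 A ?d f R C w \<eta>\<^sub>1], goal_cases)
    case (8 \<delta>)
    show ?case by (rule 8(1)) (fact 8(2), fact 8(3))
  qed (rule a\<^sub>0 R \<eta>1(1) deriv lip pd sym; assumption?; assumption?)+
  obtain \<delta>\<^sub>2 where \<delta>2: "0 < \<delta>\<^sub>2"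
    "\<And>y. (\<And>k. k \<in> {1..K} \<Longrightarrow> \<bar>y k\<bar> \<le> \<delta>\<^sub>2) \<Longrightarrow>
      l1_norm ?d (\<lambda>i. (\<mu> (Suc i) + y (Suc i)) / (\<mu> K + y K) - r i - (y (Suc i) - r i * y K) / \<mu> K)
        \<le> \<eta>\<^sub>2 * (\<Sum>k\<in>{1..K}. \<bar>y k\<bar>)"
    unfolding r_def
  proof (rule ratio_linearization[of K \<mu>, OF K \<mu> \<eta>2(1)], goal_cases)
    case (1 \<delta>)
    show ?case by (rule 1(1)) (fact 1(2), fact 1(3))
  qed
  define \<delta> where "\<delta> = min \<delta>\<^sub>1 (min \<delta>\<^sub>2 (\<delta>\<^sub>1 / ((C\<^sub>1 + 1) * (real K + 1))))"
  have \<delta>: "0 < \<delta>" "\<delta> \<le> \<delta>\<^sub>1" "\<delta> \<le> \<delta>\<^sub>2" "\<delta> \<le> \<delta>\<^sub>1 / ((C\<^sub>1 + 1) * (real K + 1))"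
  proof -
    show "0 < \<delta>" using \<delta>1(1) \<delta>2(1) C1 by (simp add: \<delta>_def)
  qed (unfold \<delta>_def, linarith+)
  show ?thesis
  proof (rule that[OF \<delta>(1)])
    fix w' :: "nat \<Rightarrow> nat \<Rightarrow> real" and s y :: "nat \<Rightarrow> real" and a
    assume w': "\<And>i j. i < ?d \<Longrightarrow> j < ?d \<Longrightarrow> \<bar>w' i j - w i j\<bar> \<le> \<delta>"
      and y: "\<And>k. k \<in> {1..K} \<Longrightarrow> \<bar>y k\<bar> \<le> \<delta>"
      and s: "\<And>i. i < ?d \<Longrightarrow> s i = (\<mu> (Suc i) + y (Suc i)) / (\<mu> K + y K)" and a: "a \<in> A"
      and arg_min: "\<And>b. b \<in> A \<Longrightarrow> bilin ?d w' (\<lambda>i. f a i - s i) (\<lambda>i. f a i - s i)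
        \<le> bilin ?d w' (\<lambda>i. f b i - s i) (\<lambda>i. f b i - s i)"
    define S where "S = (\<Sum>k\<in>{1..K}. \<bar>y k\<bar>)"
    have S: "\<bar>y k\<bar> \<le> S" if "k \<in> {1..K}" for k
      unfolding S_def by (rule member_le_sum[OF that]) auto
    have S0: "0 \<le> S" unfolding S_def by (intro sum_nonneg) auto
    define lin where "lin i = (y (Suc i) - r i * y K) / \<mu> K" for i
    define err where "err i = s i - r i - lin i" for i
    have err: "l1_norm ?d err \<le> \<eta>\<^sub>2 * S"
    proof -
      have "l1_norm ?d err = l1_norm ?d (\<lambda>i. (\<mu> (Suc i) + y (Suc i)) / (\<mu> K + y K) - r i - (y (Suc i) - r i * y K) / \<mu> K)"
        unfolding l1_norm_def err_def lin_def by (intro sum.cong) (auto simp: s)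
      also have "\<dots> \<le> \<eta>\<^sub>2 * S" unfolding S_def using y \<delta>(3) by (intro \<delta>2(2)) force
      finally show ?thesis .
    qed
    have "\<bar>lin i\<bar> \<le> (1 + \<bar>r i\<bar>) / \<mu> K * S" if "i < ?d" for i
    proof -
      have "\<bar>y (Suc i) - r i * y K\<bar> \<le> \<bar>y (Suc i)\<bar> + \<bar>r i\<bar> * \<bar>y K\<bar>"
        by (rule order_trans[OF abs_triangle_ineq4]) (simp add: abs_mult)
      also have "\<dots> \<le> S + \<bar>r i\<bar> * S"
        using that K by (intro add_mono mult_left_mono S) auto
      finally have "\<bar>y (Suc i) - r i * y K\<bar> \<le> (1 + \<bar>r i\<bar>) * S" by (simp add: algebra_simps)
      from divide_right_mono[OF this, of "\<mu> K"] show ?thesis using \<mu> by (simp add: lin_def)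
    qed
    then have "l1_norm ?d lin \<le> (\<Sum>i<?d. (1 + \<bar>r i\<bar>) / \<mu> K * S)"
      unfolding l1_norm_def by (intro sum_mono) auto
    also have "\<dots> = C\<^sub>1 * S" by (simp only: C\<^sub>1_def sum_distrib_right)
    finally have lin: "l1_norm ?d lin \<le> C\<^sub>1 * S" .
    have diff: "l1_norm ?d (\<lambda>i. s i - f a\<^sub>0 i) = l1_norm ?d (\<lambda>i. lin i + err i)"
      unfolding l1_norm_def by (intro sum.cong) (auto simp: err_def f r_def)
    also have "\<dots> \<le> C\<^sub>1 * S + \<eta>\<^sub>2 * S" by (rule order_trans[OF l1_norm_add add_mono[OF lin err]])
    also have "\<dots> \<le> (C\<^sub>1 + 1) * S" using mult_right_mono[OF \<eta>2(2) S0] by (simp add: algebra_simps)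
    finally have total: "l1_norm ?d (\<lambda>i. s i - f a\<^sub>0 i) \<le> (C\<^sub>1 + 1) * S" .
    have "S \<le> (\<Sum>k\<in>{1..K}. \<delta>)" unfolding S_def by (intro sum_mono y)
    also have "\<dots> = real K * \<delta>" by simp
    also have "\<dots> \<le> (real K + 1) * \<delta>" using \<delta>(1) by simp
    finally have "(C\<^sub>1 + 1) * S \<le> (C\<^sub>1 + 1) * ((real K + 1) * \<delta>)" using C1 by (intro mult_left_mono) auto
    also have "\<dots> = ((C\<^sub>1 + 1) * (real K + 1)) * \<delta>" by (simp only: mult.assoc)
    also have "\<dots> \<le> \<delta>\<^sub>1" using \<delta>(4) C1 by (simp add: pos_le_divide_eq mult.commute)
    finally have le: "l1_norm ?d (\<lambda>i. s i - f a\<^sub>0 i) \<le> \<delta>\<^sub>1" using total by linarith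
    have "\<bar>a - a\<^sub>0 - bilin ?d w R (\<lambda>i. s i - f a\<^sub>0 i) / bilin ?d w R R\<bar> \<le> \<eta>\<^sub>1 * l1_norm ?d (\<lambda>i. s i - f a\<^sub>0 i)"
    proof (rule \<delta>1(2)[OF _ _ a arg_min])
      show "\<bar>w' i j - w i j\<bar> \<le> \<delta>\<^sub>1" if "i < ?d" "j < ?d" for i j using w'[OF that] \<delta>(2) by linarith
      show "\<bar>s i - f a\<^sub>0 i\<bar> \<le> \<delta>\<^sub>1" if "i < ?d" for i
        using member_le_sum[of i "{..<?d}" "\<lambda>i. \<bar>s i - f a\<^sub>0 i\<bar>"] that le unfolding l1_norm_def by simp
    qed
    also have "\<dots> \<le> \<eta>\<^sub>1 * ((C\<^sub>1 + 1) * S)" using \<eta>1(1) total by (intro mult_left_mono) auto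
    also have "\<dots> = \<eta> / 2 * S" using \<eta>1(2) by (simp only: mult.assoc[symmetric])
    finally have A1: "\<bar>a - a\<^sub>0 - bilin ?d w R (\<lambda>i. s i - f a\<^sub>0 i) / \<kappa>\<bar> \<le> \<eta> / 2 * S" unfolding \<kappa>_def .
    have "bilin ?d w R (\<lambda>i. s i - f a\<^sub>0 i) = bilin ?d w R (\<lambda>i. lin i + err i)"
      unfolding bilin_def by (intro sum.cong) (auto simp: err_def f r_def)
    then have split: "bilin ?d w R (\<lambda>i. s i - f a\<^sub>0 i) / \<kappa> = bilin ?d w R lin / \<kappa> + bilin ?d w R err / \<kappa>"
      by (simp add: bilin_add_right add_divide_distrib)
    have "\<bar>bilin ?d w R err / \<kappa>\<bar> = \<bar>bilin ?d w R err\<bar> / \<kappa>" using \<kappa> by simp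
    also have "\<dots> \<le> \<Lambda> * (l1_norm ?d R * l1_norm ?d err) / \<kappa>"
      using \<kappa> by (intro divide_right_mono abs_bilin_le \<Lambda>) auto
    also have "\<dots> = C\<^sub>2 * l1_norm ?d err" by (simp add: C\<^sub>2_def)
    also have "\<dots> \<le> C\<^sub>2 * (\<eta>\<^sub>2 * S)" using err C2 by (rule mult_left_mono)
    also have "\<dots> \<le> \<eta> / 2 * S" using mult_right_mono[OF \<eta>2(3) S0] by (simp add: mult.assoc)
    finally have A2: "\<bar>bilin ?d w R err / \<kappa>\<bar> \<le> \<eta> / 2 * S" .
    have "(\<Sum>k\<in>{1..K}. influence K w R \<mu> k * y k) =
        bilin ?d w R (\<lambda>i. (y (Suc i) - \<mu> (Suc i) / \<mu> K * y K) / \<mu> K) / bilin ?d w R R"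
      by (rule sum_influence[OF K]) (rule sym; assumption)
    also have "(\<lambda>i. (y (Suc i) - \<mu> (Suc i) / \<mu> K * y K) / \<mu> K) = lin"
      by (simp add: lin_def r_def fun_eq_iff)
    finally have "(\<Sum>k\<in>{1..K}. influence K w R \<mu> k * y k) = bilin ?d w R lin / \<kappa>"
      by (simp only: \<kappa>_def)
    then have "\<bar>a - a\<^sub>0 - (\<Sum>k\<in>{1..K}. influence K w R \<mu> k * y k)\<bar> \<le> \<eta> / 2 * S + \<eta> / 2 * S"
      using A1 A2 unfolding split by linarith
    then show "\<bar>a - a\<^sub>0 - (\<Sum>k\<in>{1..K}. influence K w R \<mu> k * y k)\<bar> \<le> \<eta> * (\<Sum>k\<in>{1..K}. \<bar>y k\<bar>)"
      by (simp add: S_def)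
  qed
qed

section \<open>The asymptotic variance as a quadratic form\<close>

lemma quad_form_eq_bilin:
  assumes "B \<in> carrier_mat d d" "v \<in> carrier_vec d"
  shows "quad_form B v = bilin d (\<lambda>i j. B $$ (i, j)) (\<lambda>i. v $ i) (\<lambda>i. v $ i)"
proof -
  have "(B *\<^sub>v v) $ i = (\<Sum>j<d. B $$ (i, j) * v $ j)" if "i < d" for i
    using that assms by (simp add: scalar_prod_def atLeast0LessThan)
  then have "quad_form B v = (\<Sum>i<d. v $ i * (\<Sum>j<d. B $$ (i, j) * v $ j))"
    using assms by (simp add: quad_form_def scalar_prod_def[of v] atLeast0LessThan)
  then show ?thesis by (simp only: bilin_def sum_distrib_left mult.assoc)
qed

lemma pos_def_mat_imp_bilin:
  assumes "pos_def_mat d B" "\<exists>i<d. v i \<noteq> 0"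
  shows "0 < bilin d (\<lambda>i j. B $$ (i, j)) v v"
proof -
  have B: "B \<in> carrier_mat d d" using assms(1) by (simp add: pos_def_mat_def)
  have "Matrix.vec d v \<noteq> 0\<^sub>v d" using assms(2) by (auto simp: vec_eq_iff)
  then have "0 < quad_form B (Matrix.vec d v)" using assms(1) by (simp add: pos_def_mat_def)
  also have "quad_form B (Matrix.vec d v) = bilin d (\<lambda>i j. B $$ (i, j)) v v"
    using quad_form_eq_bilin[OF B, of "Matrix.vec d v"] by (simp add: bilin_def)
  finally show ?thesis .
qed

lemma quad_form_sandwich:
  assumes B: "B \<in> carrier_mat n n" and L: "L \<in> carrier_mat d n" and v: "v \<in> carrier_vec d"
  shows "quad_form (L * B * transpose_mat L) v = quad_form B (transpose_mat L *\<^sub>v v)"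
proof -
  have Lt: "transpose_mat L \<in> carrier_mat n d" using L by simp
  have z: "transpose_mat L *\<^sub>v v \<in> carrier_vec n" using Lt v by simp
  have "(L * B * transpose_mat L) *\<^sub>v v = (L * B) *\<^sub>v (transpose_mat L *\<^sub>v v)"
    by (rule assoc_mult_mat_vec[of _ d n _ d]) (use B L Lt v in auto)
  also have "\<dots> = L *\<^sub>v (B *\<^sub>v (transpose_mat L *\<^sub>v v))"
    by (rule assoc_mult_mat_vec[of _ d n _ n]) (use B L z in auto)
  finally have "quad_form (L * B * transpose_mat L) v = v \<bullet> (L *\<^sub>v (B *\<^sub>v (transpose_mat L *\<^sub>v v)))"
    by (simp add: quad_form_def)
  also have "\<dots> = (transpose_mat L *\<^sub>v v) \<bullet> (B *\<^sub>v (transpose_mat L *\<^sub>v v))"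
    using B L v z by (simp add: transpose_vec_mult_scalar[of L d n])
  finally show ?thesis by (simp add: quad_form_def)
qed

lemma H_mat_carrier: "1 \<le> K \<Longrightarrow> H_mat K p c \<alpha> \<in> carrier_mat (K - 1) K"
  using mat_of_cols_carrier(1)[of "K - 1" "unit_vecs (K - 1) @ [- r_vec K p c \<alpha>]"]
  by (simp add: H_mat_def unit_vecs_def)

lemma H_mat_entry:
  assumes "1 \<le> K" "i < K - 1" "j < K"
  shows "H_mat K p c \<alpha> $$ (i, j) =
    (if j < K - 1 then (if i = j then 1 else 0) else - r_k K p c \<alpha> (Suc i)) / mu_k p c \<alpha> K"
proof -
  have len: "length (unit_vecs (K - 1) @ [- r_vec K p c \<alpha>]) = K" using assms by (simp add: unit_vecs_def)
  have "(unit_vecs (K - 1) @ [- r_vec K p c \<alpha>]) ! j $ i =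
      (if j < K - 1 then (if i = j then 1 else 0) else - r_k K p c \<alpha> (Suc i))"
    using assms by (auto simp: nth_append unit_vecs_def r_vec_def unit_vec_def)
  then show ?thesis
    using assms len unfolding H_mat_def by (simp add: mat_of_cols_index)
qed

text \<open>
  With \<open>W\<close> symmetric, \<open>R\<^sup>T W H \<Sigma> H\<^sup>T W R\<close> is the form \<open>\<Sigma>\<close> at \<open>H\<^sup>T W R\<close>, and \<open>influence\<close> is this vector divided
  by \<open>R\<^sup>T W R\<close>.
\<close>

lemma asymp_variance_eq:
  fixes p :: "nat \<Rightarrow> real" and c \<alpha> :: real
  assumes K: "1 \<le> K" and W: "W \<in> carrier_mat (K - 1) (K - 1)"
    and sym: "\<And>i j. i < K - 1 \<Longrightarrow> j < K - 1 \<Longrightarrow> W $$ (i, j) = W $$ (j, i)"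
    and R: "R \<in> carrier_vec (K - 1)"
  defines "a \<equiv> influence K (\<lambda>i j. W $$ (i, j)) (\<lambda>i. R $ i) (mu_k p c \<alpha>)"
  shows "asymp_variance W (Omega_mat K p c \<alpha>) R = (\<Sum>j\<in>{1..K}. \<Sum>k\<in>{1..K}. a j * Sigma_entry p c \<alpha> j k * a k)"
proof -
  let ?d = "K - 1" and ?w = "\<lambda>i j. W $$ (i, j)" and ?R = "\<lambda>i. R $ i"
  let ?H = "H_mat K p c \<alpha>" and ?S = "Sigma_mat K p c \<alpha>" and ?\<Omega> = "Omega_mat K p c \<alpha>"
  have H: "?H \<in> carrier_mat ?d K" by (rule H_mat_carrier[OF K])
  have S: "?S \<in> carrier_mat K K" by (simp add: Sigma_mat_def)
  have \<Omega>: "?\<Omega> \<in> carrier_mat ?d ?d" using H S unfolding Omega_mat_def by auto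
  have Wt: "transpose_mat W = W" using W sym by (intro eq_matI) auto
  define u where "u = W *\<^sub>v R"
  have u: "u \<in> carrier_vec ?d" using W R by (simp add: u_def)
  have u_nth: "u $ i = (\<Sum>j<?d. W $$ (i, j) * R $ j)" if "i < ?d" for i
    using that W R by (simp add: u_def scalar_prod_def atLeast0LessThan)
  define z where "z = transpose_mat ?H *\<^sub>v u"
  have z: "z \<in> carrier_vec K" using H u by (simp add: z_def)
  define \<kappa> where "\<kappa> = quad_form W R"
  have \<kappa>: "\<kappa> = bilin ?d ?w ?R ?R" unfolding \<kappa>_def by (rule quad_form_eq_bilin[OF W R])
  have "quad_form (W * ?\<Omega> * W) R = quad_form ?\<Omega> u"
    using quad_form_sandwich[OF \<Omega> W R] by (simp add: Wt u_def)
  also have "\<dots> = quad_form ?S z"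
    unfolding Omega_mat_def z_def by (rule quad_form_sandwich[OF S H u])
  also have "\<dots> = bilin K (\<lambda>i j. ?S $$ (i, j)) (\<lambda>i. z $ i) (\<lambda>i. z $ i)"
    by (rule quad_form_eq_bilin[OF S z])
  finally have q: "quad_form (W * ?\<Omega> * W) R = bilin K (\<lambda>i j. ?S $$ (i, j)) (\<lambda>i. z $ i) (\<lambda>i. z $ i)" .
  have z_nth: "z $ j / \<kappa> = a (Suc j)" if j: "j < K" for j
  proof -
    have "z $ j = (\<Sum>i<?d. ?H $$ (i, j) * u $ i)"
      using j H u by (simp add: z_def scalar_prod_def atLeast0LessThan)
    also have "\<dots> = (\<Sum>i<?d. (if j < ?d then (if i = j then 1 else 0) else - r_k K p c \<alpha> (Suc i)) / mu_k p c \<alpha> K * u $ i)"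
      using j by (intro sum.cong refl) (simp add: H_mat_entry[OF K])
    finally have zj: "z $ j = \<dots>" .
    show ?thesis
    proof (cases "j < ?d")
      case True
      then have "z $ j = (\<Sum>i<?d. if i = j then u $ j / mu_k p c \<alpha> K else 0)"
        unfolding zj by (intro sum.cong) auto
      then have "z $ j = u $ j / mu_k p c \<alpha> K" using True by simp
      then show ?thesis using True by (simp add: a_def influence_def \<kappa> u_nth)
    next
      case False
      then have j: "j = ?d" "Suc j = K" using j K by auto
      have "z $ j = - (\<Sum>i<?d. mu_k p c \<alpha> (Suc i) / mu_k p c \<alpha> K * u $ i) / mu_k p c \<alpha> K"
        unfolding zj sum_negf[symmetric] sum_divide_distrib using False
        by (intro sum.cong refl) (simp add: r_k_def)
      also have "(\<Sum>i<?d. mu_k p c \<alpha> (Suc i) / mu_k p c \<alpha> K * u $ i) =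
        (\<Sum>i<?d. mu_k p c \<alpha> (Suc i) / mu_k p c \<alpha> K * (\<Sum>j<?d. W $$ (i, j) * R $ j))"
        by (intro sum.cong refl) (simp add: u_nth)
      finally show ?thesis unfolding a_def influence_def \<kappa> j(2) by simp
    qed
  qed
  have "asymp_variance W ?\<Omega> R = bilin K (\<lambda>i j. ?S $$ (i, j)) (\<lambda>i. inverse \<kappa> * z $ i) (\<lambda>i. inverse \<kappa> * z $ i)"
    unfolding asymp_variance_def q bilin_scale_left bilin_scale_right \<kappa>_def[symmetric] by simp
  also have "\<dots> = (\<Sum>i<K. \<Sum>j<K. a (Suc i) * Sigma_entry p c \<alpha> (Suc i) (Suc j) * a (Suc j))"
    unfolding bilin_def using z_nth
    by (intro sum.cong refl) (simp add: Sigma_mat_def divide_inverse mult.commute[of "inverse \<kappa>"])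
  also have "\<dots> = (\<Sum>j\<in>{1..K}. \<Sum>k\<in>{1..K}. a j * Sigma_entry p c \<alpha> j k * a k)"
    by (simp only: One_nat_def sum.atLeast1_atMost_eq)
  finally show ?thesis .
qed

section \<open>Monotonicity of the share ratios\<close>

text \<open>
  Cauchy's mean value theorem for \<open>x \<mapsto> x powr b * ln x\<close> and \<open>x \<mapsto> x powr b\<close> on \<open>[p, q]\<close>: the quotient of
  their derivatives is \<open>ln x + 1 / b\<close>. So the logarithmic derivative in \<open>b\<close> is \<open>ln x + 1 / b\<close> for some
  \<open>x\<close> strictly between \<open>p\<close> and \<open>q\<close>.
\<close>

lemma powr_diff_derivative:
  fixes p q b :: real
  assumes "0 < p" "p < q" "0 < b"
  shows "\<exists>x>p. x < q \<and>
    ((\<lambda>b. q powr b - p powr b) has_real_derivative (q powr b - p powr b) * (ln x + 1 / b)) (at b)"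
proof -
  have "\<exists>x. p < x \<and> x < q \<and> (q powr b * ln q - p powr b * ln p) * (b * x powr (b - 1)) =
      (q powr b - p powr b) * (b * x powr (b - 1) * ln x + x powr b * (1 / x))"
    using assms
    by (intro GMVT' continuous_intros derivative_eq_intros refl) (auto simp: powr_diff)
  then obtain x where x: "p < x" "x < q" and eq: "(q powr b * ln q - p powr b * ln p) * (b * x powr (b - 1)) =
      (q powr b - p powr b) * (b * x powr (b - 1) * ln x + x powr b * (1 / x))" by blast
  have pos: "0 < b * x powr (b - 1)" using assms x by simp
  have "b * x powr (b - 1) * ln x + x powr b * (1 / x) = (ln x + 1 / b) * (b * x powr (b - 1))"
    using assms x by (simp add: powr_diff field_simps)
  with eq have "(q powr b * ln q - p powr b * ln p) * (b * x powr (b - 1)) =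
      ((q powr b - p powr b) * (ln x + 1 / b)) * (b * x powr (b - 1))"
    by (simp only: mult.assoc)
  then have "q powr b * ln q - p powr b * ln p = (q powr b - p powr b) * (ln x + 1 / b)"
    using pos by (metis less_irrefl mult_cancel_right)
  moreover have "((\<lambda>b. q powr b - p powr b) has_real_derivative q powr b * ln q - p powr b * ln p) (at b)"
    using assms by (auto intro!: derivative_eq_intros)
  ultimately show ?thesis using x by auto
qed

text \<open>
  The logarithmic derivative of the ratio is \<open>ln x - ln x'\<close> with \<open>x < q \<le> p' < x'\<close>.
\<close>

lemma powr_diff_ratio_derivative_neg:
  fixes p q p' q' b :: real
  assumes "0 < p" "p < q" "q \<le> p'" "p' < q'" "0 < b"
  shows "\<exists>D<0. ((\<lambda>b. (q powr b - p powr b) / (q' powr b - p' powr b)) has_real_derivative D) (at b)"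
proof -
  define N where "N b = q powr b - p powr b" for b
  define L where "L b = q' powr b - p' powr b" for b
  have pos: "0 < N b" "0 < L b" using assms by (auto simp: N_def L_def powr_less_mono2)
  obtain x where x: "p < x" "x < q" and N': "(N has_real_derivative N b * (ln x + 1 / b)) (at b)"
    using powr_diff_derivative[of p q b] assms by (auto simp: N_def[abs_def])
  obtain x' where x': "p' < x'" "x' < q'" and L': "(L has_real_derivative L b * (ln x' + 1 / b)) (at b)"
    using powr_diff_derivative[of p' q' b] assms by (auto simp: L_def[abs_def])
  have "((\<lambda>b. N b / L b) has_real_derivative N b / L b * (ln x - ln x')) (at b)"
    by (rule DERIV_cong[OF DERIV_divide[OF N' L']]) (use pos in \<open>auto simp: field_simps\<close>)
  moreover have "ln x < ln x'" using x x' assms by simp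
  then have "N b / L b * (ln x - ln x') < 0" using pos by (intro mult_pos_neg divide_pos_pos) auto
  ultimately show ?thesis unfolding N_def L_def by blast
qed

lemma r_k_eq:
  assumes "0 < c" "1 < \<alpha>"
  shows "r_k K p c \<alpha> k = (p (k + 1) powr (1 - 1 / \<alpha>) - p k powr (1 - 1 / \<alpha>))
    / (p (K + 1) powr (1 - 1 / \<alpha>) - p K powr (1 - 1 / \<alpha>))"
  using assms by (simp add: r_k_def mu_k_def pareto_mu_def Let_def)

lemma r_k_derivative_neg:
  assumes "0 < c" "1 < \<alpha>" "0 < p k" "p k < p (k + 1)" "p (k + 1) \<le> p K" "p K < p (K + 1)"
  shows "\<exists>D<0. ((\<lambda>a. r_k K p c a k) has_real_derivative D) (at \<alpha>)"
proof -
  define g where "g b = (p (k + 1) powr b - p k powr b) / (p (K + 1) powr b - p K powr b)" for b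
  have "0 < 1 - 1 / \<alpha>" using assms by simp
  then obtain D where D: "D < 0" "(g has_real_derivative D) (at (1 - 1 / \<alpha>))"
    using powr_diff_ratio_derivative_neg[OF assms(3-6)] unfolding g_def by blast
  have "((\<lambda>a. 1 - 1 / a) has_real_derivative 1 / \<alpha>\<^sup>2) (at \<alpha>)"
    using assms by (auto intro!: derivative_eq_intros simp: power2_eq_square)
  from DERIV_chain2[OF D(2) this]
  have "((\<lambda>a. g (1 - 1 / a)) has_real_derivative D * (1 / \<alpha>\<^sup>2)) (at \<alpha>)" .
  then have "((\<lambda>a. r_k K p c a k) has_real_derivative D * (1 / \<alpha>\<^sup>2)) (at \<alpha>)"
    by (rule has_field_derivative_transform_within_open[where S = "{1<..}"])
      (use assms r_k_eq in \<open>auto simp: g_def\<close>)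
  moreover have "D * (1 / \<alpha>\<^sup>2) < 0" using D assms by (intro mult_neg_pos) auto
  ultimately show ?thesis by blast
qed

text \<open>
  The difference quotient, completed by \<open>D\<close> at \<open>a\<^sub>0\<close>, is continuous and without zeros on the compact
  set, hence bounded away from 0.
\<close>

lemma inverse_lipschitz_at:
  fixes f :: "real \<Rightarrow> real"
  assumes A: "compact A" "a\<^sub>0 \<in> A" and cont: "\<And>a. a \<in> A \<Longrightarrow> isCont f a"
    and inj: "\<And>a. a \<in> A \<Longrightarrow> a \<noteq> a\<^sub>0 \<Longrightarrow> f a \<noteq> f a\<^sub>0"
    and deriv: "(f has_real_derivative D) (at a\<^sub>0)" "D \<noteq> 0"
  shows "\<exists>C. \<forall>a\<in>A. \<bar>a - a\<^sub>0\<bar> \<le> C * \<bar>f a - f a\<^sub>0\<bar>"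
proof -
  obtain g where g: "\<And>z. f z - f a\<^sub>0 = g z * (z - a\<^sub>0)" "isCont g a\<^sub>0" "g a\<^sub>0 = D"
    using deriv(1) unfolding CARAT_DERIV by blast
  have "isCont g a" if "a \<in> A" for a
  proof (cases "a = a\<^sub>0")
    case False
    have "isCont (\<lambda>z. (f z - f a\<^sub>0) / (z - a\<^sub>0)) a"
      using cont[OF that] False by (intro continuous_intros) auto
    moreover have "\<forall>\<^sub>F z in nhds a. (f z - f a\<^sub>0) / (z - a\<^sub>0) = g z"
      using t1_space_nhds[OF False] by eventually_elim (simp add: g(1))
    ultimately show ?thesis using isCont_cong by fast
  qed (use g in simp)
  then have "continuous_on A (\<lambda>a. \<bar>g a\<bar>)"
    by (intro continuous_on_rabs continuous_at_imp_continuous_on) auto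
  then obtain u where u: "u \<in> A" "\<And>a. a \<in> A \<Longrightarrow> \<bar>g u\<bar> \<le> \<bar>g a\<bar>"
    using continuous_attains_inf[of A "\<lambda>a. \<bar>g a\<bar>"] A by blast
  have "g u \<noteq> 0"
    using inj[OF u(1)] g(1)[of u] g(3) deriv(2) by (cases "u = a\<^sub>0") auto
  have "\<bar>a - a\<^sub>0\<bar> \<le> 1 / \<bar>g u\<bar> * \<bar>f a - f a\<^sub>0\<bar>" if "a \<in> A" for a
    using mult_right_mono[OF u(2)[OF that], of "\<bar>a - a\<^sub>0\<bar>"] \<open>g u \<noteq> 0\<close>
    by (simp add: g(1) abs_mult pos_divide_le_eq pos_le_divide_eq mult.commute)
  then show ?thesis by blast
qed

section \<open>Moments of clipped Pareto variables\<close>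

text \<open>
  Layer cake formula: \<open>\<Phi>(Y) - \<Phi>(a)\<close>, with \<open>Y\<close> clipped to \<open>[a, b]\<close>, is the integral of \<open>\<phi>(s)\<close> over those \<open>s\<close> in
  \<open>[a, b]\<close> with \<open>s < Y\<close>. By Fubini its expectation is the integral of \<open>\<phi>(s) P(s < Y)\<close>.
\<close>

lemma (in prob_space) expectation_clamp:
  fixes Y :: "'a \<Rightarrow> real" and \<Phi> \<Psi> \<phi> :: "real \<Rightarrow> real"
  assumes Y [measurable]: "random_variable borel Y"
    and meas [measurable]: "\<Phi> \<in> borel_measurable borel" "\<phi> \<in> borel_measurable borel"
    and "a \<le> b"
    and \<Phi>: "\<And>s. a \<le> s \<Longrightarrow> s \<le> b \<Longrightarrow> (\<Phi> has_real_derivative \<phi> s) (at s)"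
    and \<phi>: "\<And>s. a \<le> s \<Longrightarrow> s \<le> b \<Longrightarrow> 0 \<le> \<phi> s"
    and \<Psi>: "\<And>s. a \<le> s \<Longrightarrow> s \<le> b \<Longrightarrow> (\<Psi> has_real_derivative \<phi> s * prob {\<omega> \<in> space M. s < Y \<omega>}) (at s)"
  shows "expectation (\<lambda>\<omega>. \<Phi> (max a (min b (Y \<omega>))) - \<Phi> a) = \<Psi> b - \<Psi> a"
proof -
  interpret pair_sigma_finite M lborel ..
  define k where "k s y = ennreal (\<phi> s) * indicator {a..b} s * indicator {s<..} y" for s y :: real
  have mono: "\<Phi> a \<le> \<Phi> x" if "a \<le> x" "x \<le> b" for x
    using that by (intro DERIV_nonneg_imp_nondecreasing[of a x \<Phi>]) (use \<Phi> \<phi> in \<open>meson order_trans\<close>)+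
  have monoP: "\<Psi> a \<le> \<Psi> b"
    using \<open>a \<le> b\<close> by (intro DERIV_nonneg_imp_nondecreasing[of a b \<Psi>])
      (use \<Psi> \<phi> in \<open>meson order_trans measure_nonneg mult_nonneg_nonneg\<close>)+
  have inner: "(\<integral>\<^sup>+s. k s y \<partial>lborel) = ennreal (\<Phi> (max a (min b y)) - \<Phi> a)" for y
  proof (cases "a < y")
    case True
    have "(\<integral>\<^sup>+s. k s y \<partial>lborel) = (\<integral>\<^sup>+s. ennreal (\<phi> s) * indicator {a..min b y} s \<partial>lborel)"
      by (rule nn_integral_cong_AE, rule AE_mp[OF AE_lborel_singleton[of y]])
        (auto simp: k_def indicator_def intro!: AE_I2)
    also have "\<dots> = ennreal (\<Phi> (min b y) - \<Phi> a)"
      by (rule nn_integral_FTC_Icc) (use True \<open>a \<le> b\<close> \<Phi> \<phi> in auto)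
    finally show ?thesis using True \<open>a \<le> b\<close> by (simp add: max_def)
  next
    case False
    then have "k s y = 0" for s by (auto simp: k_def indicator_def)
    then show ?thesis using False \<open>a \<le> b\<close> by (simp add: max_def)
  qed
  have "(\<integral>\<^sup>+\<omega>. ennreal (\<Phi> (max a (min b (Y \<omega>))) - \<Phi> a) \<partial>M) = (\<integral>\<^sup>+\<omega>. (\<integral>\<^sup>+s. k s (Y \<omega>) \<partial>lborel) \<partial>M)"
    by (simp add: inner)
  also have "\<dots> = (\<integral>\<^sup>+s. (\<integral>\<^sup>+\<omega>. k s (Y \<omega>) \<partial>M) \<partial>lborel)"
    by (rule Fubini'[symmetric]) (unfold k_def indicator_def greaterThan_iff atLeastAtMost_iff, measurable)
  also have "\<dots> = (\<integral>\<^sup>+s. ennreal (\<phi> s * prob {\<omega> \<in> space M. s < Y \<omega>}) * indicator {a..b} s \<partial>lborel)"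
  proof (rule nn_integral_cong)
    fix s
    have "(\<integral>\<^sup>+\<omega>. indicator {s<..} (Y \<omega>) \<partial>M) = (\<integral>\<^sup>+\<omega>. indicator {\<omega> \<in> space M. s < Y \<omega>} \<omega> \<partial>M)"
      by (rule nn_integral_cong) (auto simp: indicator_def)
    also have "\<dots> = ennreal (prob {\<omega> \<in> space M. s < Y \<omega>})"
      by (simp add: emeasure_eq_measure)
    finally show "(\<integral>\<^sup>+\<omega>. k s (Y \<omega>) \<partial>M) = ennreal (\<phi> s * prob {\<omega> \<in> space M. s < Y \<omega>}) * indicator {a..b} s"
      using \<phi>[of s] by (cases "s \<in> {a..b}") (auto simp: k_def nn_integral_cmult ennreal_mult)
  qed
  also have "\<dots> = ennreal (\<Psi> b - \<Psi> a)"
    by (rule nn_integral_FTC_Icc) (use \<open>a \<le> b\<close> \<Psi> \<phi> in auto)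
  finally have "(\<integral>\<^sup>+\<omega>. ennreal (\<Phi> (max a (min b (Y \<omega>))) - \<Phi> a) \<partial>M) = ennreal (\<Psi> b - \<Psi> a)" .
  then show ?thesis
    using mono monoP \<open>a \<le> b\<close> by (subst integral_eq_nn_integral) auto
qed

lemma scaled_powr_derivative:
  fixes c s z :: real
  assumes "0 < c" "0 < s" "z \<noteq> 0"
  shows "((\<lambda>s. c / z * (s / c) powr z) has_real_derivative (s / c) powr (z - 1)) (at s)"
proof -
  have "((\<lambda>s. (s / c) powr z) has_real_derivative z * (s / c) powr (z - of_nat 1) * (1 / c)) (at s)"
    by (rule DERIV_fun_powr) (use assms in \<open>auto intro!: derivative_eq_intros\<close>)
  from DERIV_cmult[OF this, of "c / z"] show ?thesis using assms by simp
qed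

lemma pareto_tail_power:
  fixes c p \<alpha> \<beta> :: real
  assumes "0 < c" "0 < p"
  shows "(c * p powr (- (1 / \<alpha>)) / c) powr \<beta> = p powr (- \<beta> / \<alpha>)"
  using assms by (simp add: powr_powr)

context prob_space begin

context
  fixes Y :: "'a \<Rightarrow> real" and c \<alpha> p q :: real
  assumes Y: "random_variable borel Y"
    and tail: "\<And>s. c \<le> s \<Longrightarrow> prob {\<omega> \<in> space M. s < Y \<omega>} = (s / c) powr (- \<alpha>)"
    and c: "0 < c" and \<alpha>: "1 < \<alpha>" and p: "0 < p" "p < q" "q \<le> 1"
begin

lemma pareto_quantile_ge: "c \<le> c * q powr (- (1 / \<alpha>))" "c * q powr (- (1 / \<alpha>)) \<le> c * p powr (- (1 / \<alpha>))"
proof -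
  have "1 \<le> q powr (- (1 / \<alpha>))"
    using powr_mono2'[of "- (1/\<alpha>)" q 1] p \<alpha> by simp
  then show "c \<le> c * q powr (- (1 / \<alpha>))" using c by simp
  show "c * q powr (- (1 / \<alpha>)) \<le> c * p powr (- (1 / \<alpha>))"
    using c p \<alpha> by (intro mult_left_mono powr_mono2') auto
qed

lemma expectation_pareto_clamp:
  defines "t \<equiv> \<lambda>u. c * u powr (- (1 / \<alpha>))"
  shows "expectation (\<lambda>\<omega>. max (t q) (min (t p) (Y \<omega>)) - t q)
    = c * (1 / \<alpha>) * ((q powr (1 - 1 / \<alpha>) - p powr (1 - 1 / \<alpha>)) / (1 - 1 / \<alpha>))"
proof -
  define \<Psi> where "\<Psi> s = c / (1 - \<alpha>) * (s / c) powr (1 - \<alpha>)" for s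
  have t: "c \<le> t q" "t q \<le> t p" using pareto_quantile_ge by (auto simp: t_def)
  have tp: "(t u / c) powr (1 - \<alpha>) = u powr (1 - 1 / \<alpha>)" if "0 < u" for u
    using pareto_tail_power[OF c that, of \<alpha> "1 - \<alpha>"] \<alpha> by (simp add: t_def diff_divide_distrib)
  have "expectation (\<lambda>\<omega>. max (t q) (min (t p) (Y \<omega>)) - t q) = \<Psi> (t p) - \<Psi> (t q)"
  proof (rule expectation_clamp[where \<phi> = "\<lambda>_. 1" and \<Phi> = "\<lambda>s. s", OF Y _ _ t(2)])
    fix s assume "t q \<le> s" "s \<le> t p"
    then have "c \<le> s" using t by simp
    then show "(\<Psi> has_real_derivative 1 * prob {\<omega> \<in> space M. s < Y \<omega>}) (at s)"
      unfolding tail[OF \<open>c \<le> s\<close>] \<Psi>_def using c \<alpha> scaled_powr_derivative[of c s "1 - \<alpha>"] by simp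
  qed (auto intro!: derivative_eq_intros)
  also have "\<dots> = c / (1 - \<alpha>) * (p powr (1 - 1 / \<alpha>) - q powr (1 - 1 / \<alpha>))"
    using p by (simp add: \<Psi>_def tp right_diff_distrib)
  also have "\<dots> = c * (1 / \<alpha>) * ((q powr (1 - 1 / \<alpha>) - p powr (1 - 1 / \<alpha>)) / (1 - 1 / \<alpha>))"
    using \<alpha> by (simp add: field_simps)
  finally show ?thesis .
qed

text \<open>
  Layer cake formula with \<open>\<phi>(s) = 2 (s - t q)\<close>. The antiderivative of \<open>s (s / c) powr (- \<alpha>)\<close> is logarithmic for
  \<open>\<alpha> = 2\<close>, which is the case \<open>\<xi> = 1 / 2\<close> in \<open>pareto_sigma2\<close>.
\<close>

lemma expectation_pareto_clamp_sq:
  defines "t \<equiv> \<lambda>u. c * u powr (- (1 / \<alpha>))"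
  shows "expectation (\<lambda>\<omega>. (max (t q) (min (t p) (Y \<omega>)) - t q)\<^sup>2)
    = 2 * c\<^sup>2 * (1 / \<alpha>) * (if 1 / \<alpha> = 1 / 2 then ln (q / p)
         else (q powr (1 - 2 * (1 / \<alpha>)) - p powr (1 - 2 * (1 / \<alpha>))) / (1 - 2 * (1 / \<alpha>)))
      - 2 * t q * (c * (1 / \<alpha>) * ((q powr (1 - 1 / \<alpha>) - p powr (1 - 1 / \<alpha>)) / (1 - 1 / \<alpha>)))"
proof -
  define P where "P s = (if \<alpha> = 2 then c\<^sup>2 * ln s else c\<^sup>2 / (2 - \<alpha>) * (s / c) powr (2 - \<alpha>))" for s
  define \<Psi> where "\<Psi> s = 2 * P s - 2 * t q * (c / (1 - \<alpha>) * (s / c) powr (1 - \<alpha>))" for s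
  have t: "c \<le> t q" "t q \<le> t p" using pareto_quantile_ge by (auto simp: t_def)
  have tp: "(t u / c) powr (1 - \<alpha>) = u powr (1 - 1 / \<alpha>)" if "0 < u" for u
    using pareto_tail_power[OF c that, of \<alpha> "1 - \<alpha>"] \<alpha> by (simp add: t_def diff_divide_distrib)
  have P': "(P has_real_derivative s * (s / c) powr (- \<alpha>)) (at s)" if "c \<le> s" for s
  proof (cases "\<alpha> = 2")
    case True
    have "(s / c) powr - 2 = c\<^sup>2 / s\<^sup>2"
      using c that powr_realpow[of "s / c" 2] by (simp add: powr_minus power_divide)
    then show ?thesis using c that True unfolding P_def
      by (auto intro!: derivative_eq_intros simp: field_simps power2_eq_square)
  next
    case False
    have "(s / c) powr (1 - \<alpha>) = (s / c) * (s / c) powr (- \<alpha>)"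
      using c that by (simp add: powr_diff powr_minus field_simps)
    moreover have "((\<lambda>s. c * (c / (2 - \<alpha>) * (s / c) powr (2 - \<alpha>))) has_real_derivative c * (s / c) powr (2 - \<alpha> - 1)) (at s)"
      by (rule DERIV_cmult[OF scaled_powr_derivative]) (use c that False in auto)
    ultimately show ?thesis using c that False by (simp add: P_def[abs_def] power2_eq_square mult.assoc)
  qed
  have "expectation (\<lambda>\<omega>. (max (t q) (min (t p) (Y \<omega>)) - t q)\<^sup>2 - (t q - t q)\<^sup>2) = \<Psi> (t p) - \<Psi> (t q)"
  proof (rule expectation_clamp[where \<phi> = "\<lambda>s. 2 * (s - t q)" and \<Phi> = "\<lambda>s. (s - t q)\<^sup>2", OF Y _ _ t(2)])
    fix s assume s: "t q \<le> s" "s \<le> t p"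
    then have "c \<le> s" using t by simp
    have "((\<lambda>s. c / (1 - \<alpha>) * (s / c) powr (1 - \<alpha>)) has_real_derivative (s / c) powr (- \<alpha>)) (at s)"
      using c \<alpha> \<open>c \<le> s\<close> scaled_powr_derivative[of c s "1 - \<alpha>"] by simp
    from DERIV_diff[OF DERIV_cmult[OF P'[OF \<open>c \<le> s\<close>], of 2] DERIV_cmult[OF this, of "2 * t q"]]
    show "(\<Psi> has_real_derivative 2 * (s - t q) * prob {\<omega> \<in> space M. s < Y \<omega>}) (at s)"
      unfolding tail[OF \<open>c \<le> s\<close>] \<Psi>_def by (simp add: algebra_simps)
    show "((\<lambda>s. (s - t q)\<^sup>2) has_real_derivative 2 * (s - t q)) (at s)"
      by (auto intro!: derivative_eq_intros)
  qed auto
  also have "\<dots> = 2 * (P (t p) - P (t q)) - 2 * t q * (c / (1 - \<alpha>) * (t p / c) powr (1 - \<alpha>) - c / (1 - \<alpha>) * (t q / c) powr (1 - \<alpha>))"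
    by (simp add: \<Psi>_def algebra_simps)
  also have "P (t p) - P (t q) = c\<^sup>2 * (1 / \<alpha>) * (if 1 / \<alpha> = 1 / 2 then ln (q / p)
         else (q powr (1 - 2 * (1 / \<alpha>)) - p powr (1 - 2 * (1 / \<alpha>))) / (1 - 2 * (1 / \<alpha>)))"
  proof (cases "\<alpha> = 2")
    case True
    have l: "ln (c * x powr - (1 / 2)) = ln c - ln x / 2" if "0 < x" for x
      using that c by (simp add: ln_mult ln_powr)
    have "P (t p) - P (t q) = c\<^sup>2 * ((ln c - ln p / 2) - (ln c - ln q / 2))"
      using True p l[of p] l[of q] by (simp add: P_def t_def right_diff_distrib)
    also have "\<dots> = c\<^sup>2 * (1 / 2) * ln (q / p)"
      using p by (simp add: ln_div algebra_simps)
    finally show ?thesis using True by simp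
  next
    case False
    have e: "(t u / c) powr (2 - \<alpha>) = u powr (1 - 2 * (1 / \<alpha>))" if "0 < u" for u
      using pareto_tail_power[OF c that, of \<alpha> "2 - \<alpha>"] \<alpha> by (simp add: t_def diff_divide_distrib)
    have "P (t p) - P (t q) = c\<^sup>2 / (2 - \<alpha>) * (p powr (1 - 2 * (1 / \<alpha>)) - q powr (1 - 2 * (1 / \<alpha>)))"
      using False p e[of p] e[of q] by (simp add: P_def right_diff_distrib)
    also have "\<dots> = c\<^sup>2 * (1 / \<alpha>) * ((q powr (1 - 2 * (1 / \<alpha>)) - p powr (1 - 2 * (1 / \<alpha>))) / (1 - 2 * (1 / \<alpha>)))"
    proof -
      have "c\<^sup>2 / (2 - \<alpha>) = - (c\<^sup>2 * (1 / \<alpha>) / (1 - 2 * (1 / \<alpha>)))"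
        using False \<alpha> by (simp add: divide_simps) (simp add: algebra_simps)
      then show ?thesis by (simp add: algebra_simps diff_divide_distrib)
    qed
    finally show ?thesis using False \<alpha> by simp
  qed
  also have "c / (1 - \<alpha>) * (t p / c) powr (1 - \<alpha>) - c / (1 - \<alpha>) * (t q / c) powr (1 - \<alpha>)
      = c / (1 - \<alpha>) * (p powr (1 - 1 / \<alpha>) - q powr (1 - 1 / \<alpha>))"
    using p by (simp add: tp right_diff_distrib)
  also have "c / (1 - \<alpha>) * (p powr (1 - 1 / \<alpha>) - q powr (1 - 1 / \<alpha>))
      = c * (1 / \<alpha>) * ((q powr (1 - 1 / \<alpha>) - p powr (1 - 1 / \<alpha>)) / (1 - 1 / \<alpha>))"
    using \<alpha> by (simp add: field_simps)
  finally show ?thesis by simp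
qed

end

end

text \<open>
  The second moment of a layer minus the squared mean, in the form computed above. Writing \<open>L\<close> for the
  term with the case distinction, the two expressions differ by a multiple of
  \<open>L (1 - 2 \<xi>) - (q powr (1 - 2 \<xi>) - p powr (1 - 2 \<xi>))\<close>, which vanishes in both cases.
\<close>

lemma pareto_sigma2_eq:
  fixes c \<alpha> p q :: real
  assumes "1 < \<alpha>" "0 < p" "0 < q"
  defines "m \<equiv> c * (1 / \<alpha>) * ((q powr (1 - 1 / \<alpha>) - p powr (1 - 1 / \<alpha>)) / (1 - 1 / \<alpha>))"
  shows "2 * c\<^sup>2 * (1 / \<alpha>) * (if 1 / \<alpha> = 1 / 2 then ln (q / p)
         else (q powr (1 - 2 * (1 / \<alpha>)) - p powr (1 - 2 * (1 / \<alpha>))) / (1 - 2 * (1 / \<alpha>)))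
      - 2 * (c * q powr (- (1 / \<alpha>))) * m - m\<^sup>2 = pareto_sigma2 c \<alpha> p q"
proof -
  define \<xi> where "\<xi> = 1 / \<alpha>"
  have \<xi>: "0 < \<xi>" "\<xi> < 1" using assms by (auto simp: \<xi>_def)
  define L where "L = (if \<xi> = 1 / 2 then ln (q / p) else (q powr (1 - 2 * \<xi>) - p powr (1 - 2 * \<xi>)) / (1 - 2 * \<xi>))"
  define x where "x = q powr (- \<xi>)"
  define y where "y = p powr (- \<xi>)"
  have pw: "q powr (1 - \<xi>) = q * x" "p powr (1 - \<xi>) = p * y"
    "q powr (1 - 2 * \<xi>) = q * x\<^sup>2" "p powr (1 - 2 * \<xi>) = p * y\<^sup>2"
    "q powr (2 - 2 * \<xi>) = (q * x)\<^sup>2" "p powr (2 - 2 * \<xi>) = (p * y)\<^sup>2"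
    using assms(2,3) unfolding x_def y_def
    by (simp_all add: powr_minus powr_diff powr_add power2_eq_square field_simps flip: powr_add)
  have L: "L * (1 - 2 * \<xi>) = q * x\<^sup>2 - p * y\<^sup>2"
  proof (cases "\<xi> = 1/2")
    case True
    then have "1 - 2 * \<xi> = 0" by simp
    then show ?thesis using pw(3,4) assms(2,3) by simp
  qed (simp add: L_def pw)
  define w where "w = 1 / (1 - \<xi>)"
  define h where "h = w / 2"
  define k where "k = (x - y) / \<xi>"
  have eqs: "w * (1 - \<xi>) = 1" "k * \<xi> = x - y"
    using \<xi> by (simp_all add: w_def k_def)
  have h: "2 * h = w" by (simp add: h_def)
  have "2 * c\<^sup>2 * \<xi> * L - 2 * (c * x) * (c * \<xi> * ((q * x - p * y) * w))
      - (c * \<xi> * ((q * x - p * y) * w))\<^sup>2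
    = 2 * c\<^sup>2 * \<xi>\<^sup>2 * w * (L + (p * y) * k + (2 * (p * y) * (q * x) - (p * y)\<^sup>2 - (q * x)\<^sup>2) * h)"
  proof -
    have "L = w * (1 - \<xi>) * L" by (simp add: eqs)
    also have "\<dots> = w * (L * (1 - 2 * \<xi>) + L * \<xi>)" by (simp add: algebra_simps)
    also have "\<dots> = w * (q * x\<^sup>2 - p * y\<^sup>2 + L * \<xi>)" by (simp only: L)
    finally have Lw: "2 * c\<^sup>2 * \<xi> * L = 2 * c\<^sup>2 * \<xi> * (w * (q * x\<^sup>2 - p * y\<^sup>2 + L * \<xi>))" by simp
    have "2 * c\<^sup>2 * \<xi>\<^sup>2 * w * (L + (p * y) * k + (2 * (p * y) * (q * x) - (p * y)\<^sup>2 - (q * x)\<^sup>2) * h)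
      = 2 * c\<^sup>2 * \<xi> * w * (\<xi> * L + (p * y) * (k * \<xi>)) + c\<^sup>2 * \<xi>\<^sup>2 * w * (2 * (p * y) * (q * x) - (p * y)\<^sup>2 - (q * x)\<^sup>2) * (2 * h)"
      by (simp add: algebra_simps power2_eq_square)
    also have "\<dots> = 2 * c\<^sup>2 * \<xi> * w * (\<xi> * L + (p * y) * (x - y)) - (c * \<xi> * ((q * x - p * y) * w))\<^sup>2"
      unfolding eqs h by (simp add: algebra_simps power2_eq_square)
    finally show ?thesis unfolding Lw by (simp add: algebra_simps power2_eq_square)
  qed
  moreover have "u / (1 - \<xi>) = u * w" "u / (2 - 2 * \<xi>) = u * h" for u
  proof -
    have "u / z = u * (1 / z)" "u / (2 * z) = u * (1 / z / 2)" for z :: real by simp_all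
    moreover have "2 - 2 * \<xi> = 2 * (1 - \<xi>)" by simp
    ultimately show "u / (1 - \<xi>) = u * w" "u / (2 - 2 * \<xi>) = u * h"
      by (simp_all only: w_def h_def)
  qed
  ultimately have "2 * c\<^sup>2 * \<xi> * L - 2 * (c * x) * (c * \<xi> * ((q * x - p * y) / (1 - \<xi>)))
      - (c * \<xi> * ((q * x - p * y) / (1 - \<xi>)))\<^sup>2
    = 2 * c\<^sup>2 * \<xi>\<^sup>2 / (1 - \<xi>) * (L + (p * y) * ((x - y) / \<xi>) + (2 * (p * y) * (q * x) - (p * y)\<^sup>2 - (q * x)\<^sup>2) / (2 - 2 * \<xi>))"
    by (simp only: k_def)
  then show ?thesis
    unfolding pareto_sigma2_def Let_def m_def \<xi>_def[symmetric]
    unfolding L_def[symmetric] unfolding pw x_def[symmetric] y_def[symmetric]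
    by (simp only: mult.assoc)
qed

lemma pareto_cov_eq:
  fixes c \<alpha> p q p' q' :: real
  assumes "1 < \<alpha>"
  defines "m \<equiv> \<lambda>p q. c * (1 / \<alpha>) * ((q powr (1 - 1 / \<alpha>) - p powr (1 - 1 / \<alpha>)) / (1 - 1 / \<alpha>))"
  shows "m p q * (c * p' powr (- (1 / \<alpha>)) - c * q' powr (- (1 / \<alpha>)) - m p' q') = pareto_cov c \<alpha> p q p' q'"
proof -
  have *: "c * \<xi> * X * (c * P - c * Q - c * \<xi> * Z) = - c\<^sup>2 * \<xi>\<^sup>2 * X * ((Q - P) / \<xi> + Z)"
    if "\<xi> \<noteq> 0" for \<xi> X P Q Z :: real
    using that by (simp add: field_simps power2_eq_square)
  then show ?thesis
    using assms(1) unfolding m_def pareto_cov_def Let_def by (intro *) simp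
qed

text \<open>
  The population counterpart of writing a top sum as rank times threshold plus total excess: the two
  thresholds contribute \<open>q\<close> and \<open>p\<close> times the quantile, and the difference of the excesses is the mean of
  the layer in between.
\<close>

lemma pareto_mu_eq:
  fixes c \<alpha> p q :: real
  assumes "1 < \<alpha>" "0 < p" "0 < q"
  shows "pareto_mu c \<alpha> p q = q * (c * q powr (- (1 / \<alpha>))) - p * (c * p powr (- (1 / \<alpha>)))
    + c * (1 / \<alpha>) * ((q powr (1 - 1 / \<alpha>) - p powr (1 - 1 / \<alpha>)) / (1 - 1 / \<alpha>))"
proof -
  have u: "u * (c * u powr (- (1 / \<alpha>))) = c * u powr (1 - 1 / \<alpha>)" if "0 < u" for u
    using that by (simp add: powr_diff powr_minus field_simps)
  have e: "c * ((q powr (1 - 1 / \<alpha>) - p powr (1 - 1 / \<alpha>)) / (1 - 1 / \<alpha>)) =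
      c * (q powr (1 - 1 / \<alpha>) - p powr (1 - 1 / \<alpha>))
    + c * (1 / \<alpha>) * ((q powr (1 - 1 / \<alpha>) - p powr (1 - 1 / \<alpha>)) / (1 - 1 / \<alpha>))"
    using assms(1) by (simp add: field_simps)
  show ?thesis
    unfolding pareto_mu_def Let_def u[OF assms(3)] u[OF assms(2)] e by (simp only: right_diff_distrib)
qed

lemma pareto_mu_pos:
  assumes "0 < c" "1 < \<alpha>" "0 < p" "p < q"
  shows "0 < pareto_mu c \<alpha> p q"
proof -
  have "p powr (1 - 1 / \<alpha>) < q powr (1 - 1 / \<alpha>)"
    using assms by (intro powr_less_mono2) auto
  then show ?thesis using assms by (simp add: pareto_mu_def Let_def)
qed

section \<open>Linear representation of top sums\<close>

locale pareto_sample = prob_space M for M :: "'a measure" +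
  fixes Y :: "nat \<Rightarrow> 'a \<Rightarrow> real" and c \<alpha> :: real
  assumes indep: "indep_vars (\<lambda>_. borel) Y UNIV"
    and cdf_Y: "\<And>i y. cdf (distr M borel (Y i)) y = pareto_cdf \<alpha> c y"
    and c_pos: "0 < c" and \<alpha>_gt_1: "1 < \<alpha>"
begin

text \<open>
  The threshold that is exceeded with probability \<open>u\<close>, so an upper quantile: it decreases in \<open>u\<close>.
\<close>

definition quantile :: "real \<Rightarrow> real" where
  "quantile u = c * u powr (- (1 / \<alpha>))"

definition top_count :: "nat \<Rightarrow> real \<Rightarrow> nat" where
  "top_count n u = nat \<lfloor>real n * u\<rfloor>"

text \<open>
  The part of \<open>y\<close> between the upper quantiles \<open>quantile q\<close> and \<open>quantile p\<close>, for \<open>p < q\<close>. It is the difference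
  of the excesses \<open>(y - t)\<^sup>+\<close> over the two thresholds.
\<close>

definition layer :: "real \<Rightarrow> real \<Rightarrow> real \<Rightarrow> real" where
  "layer p q y = max (quantile q) (min (quantile p) y) - quantile q"

definition layer_mean :: "real \<Rightarrow> real \<Rightarrow> real" where
  "layer_mean p q = c * (1 / \<alpha>) * ((q powr (1 - 1 / \<alpha>) - p powr (1 - 1 / \<alpha>)) / (1 - 1 / \<alpha>))"

lemma measurable_Y [measurable]: "Y i \<in> borel_measurable M"
  using indep unfolding indep_vars_def by simp

lemma tail: "prob {\<omega> \<in> space M. s < Y i \<omega>} = (if c \<le> s then (s / c) powr (- \<alpha>) else 1)"
proof -
  have "prob {\<omega> \<in> space M. s < Y i \<omega>} = prob (space M - {\<omega> \<in> space M. Y i \<omega> \<le> s})"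
    by (rule arg_cong[where f = prob]) auto
  also have "\<dots> = 1 - pareto_cdf \<alpha> c s"
    by (simp add: prob_compl cdf_distr_eq_prob[symmetric] cdf_Y)
  finally show ?thesis by (simp add: pareto_cdf_def)
qed

lemma AE_Y_gt: "AE \<omega> in M. \<forall>i. c < Y i \<omega>"
proof (subst AE_all_countable, safe)
  fix i
  have "prob {\<omega> \<in> space M. c < Y i \<omega>} = 1" using c_pos by (simp add: tail)
  then show "AE \<omega> in M. c < Y i \<omega>" by (simp add: prob_Collect_eq_1)
qed

lemma distr_Y: "distr M borel (Y i) = distr M borel (Y j)"
  by (rule cdf_unique) (auto simp: cdf_Y fun_eq_iff)

lemma distr_compose:
  assumes [measurable]: "f \<in> borel_measurable borel"
  shows "distr M borel (\<lambda>\<omega>. f (Y i \<omega>)) = distr M borel (\<lambda>\<omega>. f (Y 0 \<omega>))"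
proof -
  have "distr M borel (\<lambda>\<omega>. f (Y i \<omega>)) = distr (distr M borel (Y i)) borel f" for i
    by (simp add: distr_distr o_def)
  then show ?thesis using distr_Y[of i 0] by simp
qed

lemma indep_compose:
  fixes f :: "real \<Rightarrow> real"
  assumes "f \<in> borel_measurable borel"
  shows "indep_vars (\<lambda>_. borel) (\<lambda>i \<omega>. f (Y i \<omega>)) UNIV"
  using indep_vars_compose2[OF indep, of "\<lambda>_. f" "\<lambda>_. borel"] assms by simp

lemma expectation_exceedance:
  "expectation (\<lambda>\<omega>. if t < Y i \<omega> then 1 else 0) = prob {\<omega> \<in> space M. t < Y i \<omega>}"
proof -
  have "expectation (\<lambda>\<omega>. if t < Y i \<omega> then 1 else 0) = expectation (indicator {\<omega> \<in> space M. t < Y i \<omega>})"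
    by (rule Bochner_Integration.integral_cong) (auto simp: indicator_def)
  also have "\<dots> = prob ({\<omega> \<in> space M. t < Y i \<omega>} \<inter> space M)"
    by (rule Bochner_Integration.integral_indicator)
  also have "{\<omega> \<in> space M. t < Y i \<omega>} \<inter> space M = {\<omega> \<in> space M. t < Y i \<omega>}" by auto
  finally show ?thesis .
qed

lemma quantile_ge: "0 < u \<Longrightarrow> u \<le> 1 \<Longrightarrow> c \<le> quantile u"
  using powr_mono2'[of "- (1 / \<alpha>)" u 1] c_pos \<alpha>_gt_1 by (simp add: quantile_def)

lemma quantile_less: "0 < p \<Longrightarrow> p < q \<Longrightarrow> quantile q < quantile p"
  using powr_less_mono2_neg[of "- (1 / \<alpha>)" p q] c_pos \<alpha>_gt_1 by (simp add: quantile_def)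

lemma tail_quantile:
  assumes "0 < u" "u \<le> 1"
  shows "(quantile u / c) powr (- \<alpha>) = u"
  using assms c_pos \<alpha>_gt_1 by (simp add: quantile_def powr_powr)

lemma tail_less:
  assumes "c \<le> s" "s < s'"
  shows "prob {\<omega> \<in> space M. s' < Y i \<omega>} < prob {\<omega> \<in> space M. s < Y i \<omega>}"
proof -
  have "(s' / c) powr (- \<alpha>) < (s / c) powr (- \<alpha>)"
    using assms c_pos \<alpha>_gt_1 by (intro powr_less_mono2_neg) (auto simp: divide_strict_right_mono)
  then show ?thesis using assms by (simp add: tail)
qed

lemma exceedances_OP:
  assumes "0 < u" "u \<le> 1"
  shows "big_OP M (\<lambda>n \<omega>. (exceedances n (\<lambda>i. Y i \<omega>) (quantile u) - real n * u) / sqrt (real n))"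
proof -
  let ?f = "\<lambda>y. if quantile u < y then 1 else (0::real)"
  have "big_OP M (\<lambda>n \<omega>. (\<Sum>i<n. ?f (Y i \<omega>) - u) / sqrt (real n))"
  proof (rule centered_sum_big_OP[where b = 1])
    show "indep_vars (\<lambda>_. borel) (\<lambda>i \<omega>. ?f (Y i \<omega>)) UNIV" by (rule indep_compose) measurable
    show "expectation (\<lambda>\<omega>. ?f (Y i \<omega>)) = u" for i
      unfolding expectation_exceedance tail using quantile_ge tail_quantile assms by simp
  qed auto
  then show ?thesis by (simp add: exceedances_def sum_subtractf)
qed

lemma exceedance_frequency:
  "small_oP M (\<lambda>n \<omega>. exceedances n (\<lambda>i. Y i \<omega>) t / real n - prob {\<omega> \<in> space M. t < Y 0 \<omega>})"
proof -
  let ?f = "\<lambda>y. if t < y then 1 else (0::real)"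
  have "small_oP M (\<lambda>n \<omega>. (\<Sum>i<n. ?f (Y i \<omega>)) / real n - prob {\<omega> \<in> space M. t < Y 0 \<omega>})"
  proof (rule sample_mean_small_oP[where b = 1])
    show "indep_vars (\<lambda>_. borel) (\<lambda>i \<omega>. ?f (Y i \<omega>)) UNIV" by (rule indep_compose) measurable
    show "expectation (\<lambda>\<omega>. ?f (Y i \<omega>)) = prob {\<omega> \<in> space M. t < Y 0 \<omega>}" for i
      unfolding expectation_exceedance tail ..
  qed auto
  then show ?thesis by (simp add: exceedances_def)
qed

lemma top_count_bounds:
  assumes "0 \<le> u"
  shows "real (top_count n u) \<le> real n * u" "real n * u - 1 < real (top_count n u)"
proof -
  have "real (top_count n u) = of_int \<lfloor>real n * u\<rfloor>" using assms by (simp add: top_count_def)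
  then show "real (top_count n u) \<le> real n * u" "real n * u - 1 < real (top_count n u)" by linarith+
qed

lemma top_count_le: "u \<le> 1 \<Longrightarrow> top_count n u \<le> n"
  unfolding top_count_def using mult_left_le[of u "real n"] by (simp add: nat_le_iff floor_le_iff)

lemma eventually_top_count_pos:
  assumes "0 < u"
  shows "\<forall>\<^sub>F n in sequentially. 1 \<le> top_count n u"
proof -
  have "\<forall>\<^sub>F n in sequentially. 1 / u < real n" by (simp add: filterlim_at_top_dense[THEN iffD1, OF filterlim_real_sequentially])
  then show ?thesis
  proof eventually_elim
    case (elim n)
    then have "1 < real n * u" using assms by (simp add: field_simps)
    then have "0 < real (top_count n u)" using top_count_bounds(2)[of u n] assms by linarith
    then show ?case by simp
  qed
qed

text \<open>
  Consistency of the sample quantile, stated in terms of counts: the frequencies of exceedance of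
  \<open>quantile u \<plusminus> \<delta>\<close> converge to numbers strictly on either side of \<open>u\<close>, whereas \<open>top_count n u / n\<close> converges
  to \<open>u\<close>. If \<open>quantile u - \<delta>\<close> is below the minimum size \<open>c\<close>, as for \<open>u = 1\<close>, then all observations
  exceed it and the second inequality holds almost surely.
\<close>

lemma order_stat_bracket:
  assumes u: "0 < u" "u \<le> 1" and "0 < \<delta>"
  shows "whp M (\<lambda>n \<omega>. exceedances n (\<lambda>i. Y i \<omega>) (quantile u + \<delta>) < real (top_count n u) \<and>
    real (top_count n u) \<le> exceedances n (\<lambda>i. Y i \<omega>) (quantile u - \<delta>))"
proof (rule whp_conj)
  define P where "P t = prob {\<omega> \<in> space M. t < Y 0 \<omega>}" for t
  have P: "P (quantile u) = u" using u quantile_ge tail_quantile by (simp add: P_def tail)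
  define \<gamma> where "\<gamma> = (u - P (quantile u + \<delta>)) / 2"
  have "P (quantile u + \<delta>) < P (quantile u)"
    unfolding P_def by (rule tail_less) (use u quantile_ge \<open>0 < \<delta>\<close> in auto)
  then have \<gamma>: "0 < \<gamma>" "P (quantile u + \<delta>) = u - 2 * \<gamma>" by (simp_all add: \<gamma>_def P field_simps)
  have "\<forall>\<^sub>F n in sequentially. 1 / \<gamma> < real n"
    by (simp add: filterlim_at_top_dense[THEN iffD1, OF filterlim_real_sequentially])
  then show "whp M (\<lambda>n \<omega>. exceedances n (\<lambda>i. Y i \<omega>) (quantile u + \<delta>) < real (top_count n u))"
  proof (intro whp_mono[OF small_oP_D[OF exceedance_frequency \<gamma>(1)]], eventually_elim, safe)
    fix n \<omega>
    assume n: "1 / \<gamma> < real n"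
      and "\<bar>exceedances n (\<lambda>i. Y i \<omega>) (quantile u + \<delta>) / real n - prob {\<omega> \<in> space M. quantile u + \<delta> < Y 0 \<omega>}\<bar> \<le> \<gamma>"
    then have "exceedances n (\<lambda>i. Y i \<omega>) (quantile u + \<delta>) / real n \<le> u - \<gamma>"
      unfolding P_def[symmetric] \<gamma>(2) by linarith
    moreover have "0 < real n" using n \<gamma>(1) by (smt (verit) divide_pos_pos)
    ultimately have "exceedances n (\<lambda>i. Y i \<omega>) (quantile u + \<delta>) \<le> (u - \<gamma>) * real n"
      by (simp add: pos_divide_le_eq)
    then have "exceedances n (\<lambda>i. Y i \<omega>) (quantile u + \<delta>) \<le> real n * u - real n * \<gamma>"
      by (simp add: algebra_simps)
    moreover have "1 < real n * \<gamma>" using n \<gamma>(1) by (simp add: field_simps)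
    ultimately show "exceedances n (\<lambda>i. Y i \<omega>) (quantile u + \<delta>) < real (top_count n u)"
      using top_count_bounds(2)[of u n] u by linarith
  qed
  show "whp M (\<lambda>n \<omega>. real (top_count n u) \<le> exceedances n (\<lambda>i. Y i \<omega>) (quantile u - \<delta>))"
  proof (cases "c \<le> quantile u - \<delta>")
    case True
    define \<beta> where "\<beta> = P (quantile u - \<delta>) - u"
    have "P (quantile u) < P (quantile u - \<delta>)"
      unfolding P_def by (rule tail_less) (use True \<open>0 < \<delta>\<close> in auto)
    then have \<beta>: "0 < \<beta>" by (simp add: \<beta>_def P)
    show ?thesis
    proof (intro whp_mono[OF small_oP_D[OF exceedance_frequency \<beta>]] eventually_mono[OF eventually_gt_at_top[of 0]], safe)
      fix n :: nat and \<omega> assume "0 < n"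
        and "\<bar>exceedances n (\<lambda>i. Y i \<omega>) (quantile u - \<delta>) / real n - prob {\<omega> \<in> space M. quantile u - \<delta> < Y 0 \<omega>}\<bar> \<le> \<beta>"
      then have "u \<le> exceedances n (\<lambda>i. Y i \<omega>) (quantile u - \<delta>) / real n"
        unfolding P_def[symmetric] by (simp add: \<beta>_def)
      then have "real n * u \<le> exceedances n (\<lambda>i. Y i \<omega>) (quantile u - \<delta>)"
        using \<open>0 < n\<close> by (simp add: field_simps)
      then show "real (top_count n u) \<le> exceedances n (\<lambda>i. Y i \<omega>) (quantile u - \<delta>)"
        using top_count_bounds(1)[of u n] u by linarith
    qed
  next
    case False
    show ?thesis
    proof (rule whp_AE, rule AE_mp[OF AE_Y_gt], intro AE_I2 impI)
      fix n \<omega> assume "\<forall>i. c < Y i \<omega>"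
      then have "quantile u - \<delta> < Y i \<omega>" for i using False by (meson less_trans not_le)
      then have "exceedances n (\<lambda>i. Y i \<omega>) (quantile u - \<delta>) = real n" by (simp add: exceedances_def)
      then show "real (top_count n u) \<le> exceedances n (\<lambda>i. Y i \<omega>) (quantile u - \<delta>)"
        using top_count_le[OF u(2)] by simp
    qed
  qed
qed

text \<open>
  \<open>top_sum_approx\<close> with arbitrarily small \<open>\<delta>\<close>; the number of exceedances of the quantile deviates from \<open>n u\<close> by
  \<open>O\<^sub>P(\<surd>n)\<close>. Rounding \<open>n u\<close> to an integer costs \<open>O(1)\<close>.
\<close>

lemma top_sum_linear_representation:
  assumes u: "0 < u" "u \<le> 1"
  shows "small_oP M (\<lambda>n \<omega>. (top_sum n (\<lambda>i. Y i \<omega>) (top_count n u)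
    - (real n * u * quantile u + total_excess n (\<lambda>i. Y i \<omega>) (quantile u))) / sqrt (real n))"
proof -
  let ?N = "\<lambda>n \<omega>. exceedances n (\<lambda>i. Y i \<omega>) (quantile u)"
  let ?T = "\<lambda>n \<omega>. top_sum n (\<lambda>i. Y i \<omega>) (top_count n u)"
  let ?E = "\<lambda>n \<omega>. total_excess n (\<lambda>i. Y i \<omega>) (quantile u)"
  have "(\<lambda>n. 1 / sqrt (real n)) \<longlonglongrightarrow> 0" by real_asymp
  then have round: "small_oP M (\<lambda>n \<omega>. (real n * u - real (top_count n u)) / sqrt (real n))"
  proof (intro small_oP_if_whp_le[OF small_oP_if_tendsto] whp_if_eventually always_eventually allI ballI)
    fix n
    have "\<bar>real n * u - real (top_count n u)\<bar> \<le> 1" using top_count_bounds[of u n] u by linarith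
    then show "\<bar>(real n * u - real (top_count n u)) / sqrt (real n)\<bar> \<le> \<bar>1 / sqrt (real n)\<bar>"
      by (simp add: abs_divide divide_right_mono)
  qed
  have OP: "big_OP M (\<lambda>n \<omega>. (?N n \<omega> - real n * u) / sqrt (real n) + (real n * u - real (top_count n u)) / sqrt (real n))"
    by (rule big_OP_add[OF exceedances_OP[OF u] small_oP_imp_big_OP[OF round]])
  have "small_oP M (\<lambda>n \<omega>. (?T n \<omega> - (real (top_count n u) * quantile u + ?E n \<omega>)) / sqrt (real n))"
  proof (rule small_oP_dominated[OF OP])
    fix \<eta> :: real assume "0 < \<eta>"
    from order_stat_bracket[OF u this]
    show "whp M (\<lambda>n \<omega>. \<bar>(?T n \<omega> - (real (top_count n u) * quantile u + ?E n \<omega>)) / sqrt (real n)\<bar>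
      \<le> \<eta> * \<bar>(?N n \<omega> - real n * u) / sqrt (real n) + (real n * u - real (top_count n u)) / sqrt (real n)\<bar>)"
    proof (rule whp_mono, intro eventually_mono[OF eventually_top_count_pos[OF u(1)]] ballI impI)
      fix n \<omega>
      assume "1 \<le> top_count n u" and b: "exceedances n (\<lambda>i. Y i \<omega>) (quantile u + \<eta>) < real (top_count n u) \<and>
        real (top_count n u) \<le> exceedances n (\<lambda>i. Y i \<omega>) (quantile u - \<eta>)"
      have "\<bar>?T n \<omega> - (real (top_count n u) * quantile u + ?E n \<omega>)\<bar> \<le> \<bar>?N n \<omega> - real (top_count n u)\<bar> * \<eta>"
        by (rule top_sum_approx[OF \<open>1 \<le> top_count n u\<close> top_count_le[OF u(2)]]) (use b in auto)
      then have "\<bar>?T n \<omega> - (real (top_count n u) * quantile u + ?E n \<omega>)\<bar> / sqrt (real n) \<le> \<bar>?N n \<omega> - real (top_count n u)\<bar> * \<eta> / sqrt (real n)"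
        by (rule divide_right_mono) simp
      then show "\<bar>(?T n \<omega> - (real (top_count n u) * quantile u + ?E n \<omega>)) / sqrt (real n)\<bar>
        \<le> \<eta> * \<bar>(?N n \<omega> - real n * u) / sqrt (real n) + (real n * u - real (top_count n u)) / sqrt (real n)\<bar>"
        by (simp add: abs_divide add_divide_distrib[symmetric] mult.commute)
    qed
  qed
  from small_oP_diff[OF this small_oP_cmult[OF round, of "quantile u"]]
  show ?thesis
    by (simp add: diff_divide_distrib add_divide_distrib algebra_simps)
qed

lemma layer_measurable [measurable]: "layer p q \<in> borel_measurable borel"
  unfolding layer_def by measurable

lemma layer_bounds:
  assumes "0 < p" "p < q"
  shows "0 \<le> layer p q y" "layer p q y \<le> quantile p - quantile q"
  using quantile_less[OF assms] by (auto simp: layer_def)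

lemma expectation_layer:
  assumes "0 < p" "p < q" "q \<le> 1"
  shows "expectation (\<lambda>\<omega>. layer p q (Y i \<omega>)) = layer_mean p q"
  unfolding layer_def layer_mean_def quantile_def
  by (rule expectation_pareto_clamp) (use assms c_pos \<alpha>_gt_1 tail in auto)

text \<open>
  The difference of the representations at \<open>q\<close> and \<open>p\<close>. The heavy upper tail cancels: both excesses
  contain it, and only the bounded layer remains.
\<close>

lemma block_linear_representation:
  assumes "0 < p" "p < q" "q \<le> 1"
  shows "small_oP M (\<lambda>n \<omega>. sqrt (real n) *
      ((top_sum n (\<lambda>i. Y i \<omega>) (top_count n q) - top_sum n (\<lambda>i. Y i \<omega>) (top_count n p)) / real n - pareto_mu c \<alpha> p q)
      - (\<Sum>i<n. layer p q (Y i \<omega>) - layer_mean p q) / sqrt (real n))" (is "small_oP M ?D")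
proof -
  let ?R = "\<lambda>u n \<omega>. (top_sum n (\<lambda>i. Y i \<omega>) (top_count n u)
    - (real n * u * quantile u + total_excess n (\<lambda>i. Y i \<omega>) (quantile u))) / sqrt (real n)"
  have "small_oP M (\<lambda>n \<omega>. ?R q n \<omega> - ?R p n \<omega>)"
    using assms by (intro small_oP_diff top_sum_linear_representation) auto
  then show ?thesis
  proof (rule small_oP_if_whp_le, intro whp_if_eventually eventually_mono[OF eventually_gt_at_top[of 0]] ballI)
    fix n :: nat and \<omega> assume n: "0 < n"
    let ?Tq = "top_sum n (\<lambda>i. Y i \<omega>) (top_count n q)" and ?Tp = "top_sum n (\<lambda>i. Y i \<omega>) (top_count n p)"
    let ?Eq = "total_excess n (\<lambda>i. Y i \<omega>) (quantile q)" and ?Ep = "total_excess n (\<lambda>i. Y i \<omega>) (quantile p)"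
    define r where "r = sqrt (real n)"
    have r: "0 < r" "r * r = real n" using n by (auto simp: r_def)
    have \<mu>: "pareto_mu c \<alpha> p q = q * quantile q - p * quantile p + layer_mean p q"
      unfolding quantile_def layer_mean_def by (rule pareto_mu_eq) (use assms \<alpha>_gt_1 in auto)
    have "layer p q y = max 0 (y - quantile q) - max 0 (y - quantile p)" for y
      using quantile_less[OF assms(1,2)] by (auto simp: layer_def)
    then have sum: "(\<Sum>i<n. layer p q (Y i \<omega>) - layer_mean p q) = ?Eq - ?Ep - r * r * layer_mean p q"
      by (simp add: total_excess_def sum_subtractf r)
    have "?R q n \<omega> - ?R p n \<omega> =
      r * ((?Tq - ?Tp) / (r * r) - (q * quantile q - p * quantile p + layer_mean p q)) - (?Eq - ?Ep - r * r * layer_mean p q) / r"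
      unfolding r_def[symmetric] r(2)[symmetric] using r(1) by (simp add: field_simps)
    also have "\<dots> = ?D n \<omega>"
      by (simp only: \<mu> sum r(2) r_def[symmetric])
    finally show "\<bar>?D n \<omega>\<bar> \<le> \<bar>?R q n \<omega> - ?R p n \<omega>\<bar>" by simp
  qed
qed

lemma layer_sum_OP:
  assumes "0 < p" "p < q" "q \<le> 1"
  shows "big_OP M (\<lambda>n \<omega>. (\<Sum>i<n. layer p q (Y i \<omega>) - layer_mean p q) / sqrt (real n))"
proof (rule centered_sum_big_OP[where b = "quantile p - quantile q"])
  show "indep_vars (\<lambda>_. borel) (\<lambda>i \<omega>. layer p q (Y i \<omega>)) UNIV" by (rule indep_compose) measurable
  show "expectation (\<lambda>\<omega>. layer p q (Y i \<omega>)) = layer_mean p q" for i by (rule expectation_layer[OF assms])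
  show "\<bar>layer p q (Y i \<omega>)\<bar> \<le> quantile p - quantile q" for i \<omega>
    using layer_bounds[OF assms(1,2), of "Y i \<omega>"] by simp
qed

lemma expectation_layer_sq:
  assumes "0 < p" "p < q" "q \<le> 1"
  shows "expectation (\<lambda>\<omega>. (layer p q (Y i \<omega>))\<^sup>2) - (layer_mean p q)\<^sup>2 = pareto_sigma2 c \<alpha> p q"
proof -
  have "expectation (\<lambda>\<omega>. (layer p q (Y i \<omega>))\<^sup>2) =
    2 * c\<^sup>2 * (1 / \<alpha>) * (if 1 / \<alpha> = 1 / 2 then ln (q / p)
         else (q powr (1 - 2 * (1 / \<alpha>)) - p powr (1 - 2 * (1 / \<alpha>))) / (1 - 2 * (1 / \<alpha>)))
      - 2 * quantile q * layer_mean p q"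
    unfolding layer_def layer_mean_def quantile_def
    by (rule expectation_pareto_clamp_sq) (use assms c_pos \<alpha>_gt_1 tail in auto)
  then show ?thesis
    using pareto_sigma2_eq[of \<alpha> p q c] assms \<alpha>_gt_1 unfolding layer_mean_def quantile_def by simp
qed

text \<open>
  Where the upper layer \<open>layer p q\<close> is not zero, the lower layer is full, so their product is the upper
  layer times a constant.
\<close>

lemma expectation_layer_mult:
  assumes "0 < p" "p < q" "q \<le> p'" "p' < q'" "q' \<le> 1"
  shows "expectation (\<lambda>\<omega>. layer p q (Y i \<omega>) * layer p' q' (Y i \<omega>)) - layer_mean p q * layer_mean p' q'
    = pareto_cov c \<alpha> p q p' q'"
proof -
  have le: "quantile p' \<le> quantile q" using quantile_less[of q p'] assms by (cases "q = p'") auto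
  have eq: "layer p q y * layer p' q' y = (quantile p' - quantile q') * layer p q y" for y
  proof (cases "y \<le> quantile q")
    case True
    then have "layer p q y = 0" using quantile_less[of p q] assms by (auto simp: layer_def)
    then show ?thesis by simp
  next
    case False
    then have "layer p' q' y = quantile p' - quantile q'"
      using le quantile_less[of p' q'] assms by (auto simp: layer_def)
    then show ?thesis by simp
  qed
  have "expectation (\<lambda>\<omega>. layer p q (Y i \<omega>) * layer p' q' (Y i \<omega>)) = (quantile p' - quantile q') * layer_mean p q"
    unfolding eq using expectation_layer[of p q i] assms by simp
  moreover have "layer_mean p q * (quantile p' - quantile q' - layer_mean p' q') = pareto_cov c \<alpha> p q p' q'"
    unfolding layer_mean_def quantile_def by (rule pareto_cov_eq[OF \<alpha>_gt_1])
  ultimately show ?thesis by (simp add: algebra_simps)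
qed

end

section \<open>Covariance of the layers\<close>

locale pareto_shares = pareto_sample +
  fixes K :: nat and p :: "nat \<Rightarrow> real"
  assumes K: "2 \<le> K" and p_pos: "0 < p 1"
    and p_less: "\<And>k. k \<in> {1..K} \<Longrightarrow> p k < p (k + 1)" and p_le_1: "p (K + 1) \<le> 1"
begin

lemma p_mono_less:
  assumes "1 \<le> j" "j < k" "k \<le> K + 1"
  shows "p j < p k"
  using assms(2,3)
proof (induction k)
  case (Suc k)
  then have "p k < p (Suc k)" using p_less[of k] assms(1) by simp
  then show ?case using Suc by (cases "j = k") auto
qed simp

lemma p_mono: "1 \<le> j \<Longrightarrow> j \<le> k \<Longrightarrow> k \<le> K + 1 \<Longrightarrow> p j \<le> p k"
  using p_mono_less[of j k] by (cases "j = k") auto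

lemma p_range:
  assumes "k \<in> {1..K}"
  shows "0 < p k" "p k < p (k + 1)" "p (k + 1) \<le> 1"
  using assms p_mono[of 1 k] p_mono[of "k + 1" "K + 1"] p_pos p_less[of k] p_le_1 by auto

definition layer_k :: "nat \<Rightarrow> real \<Rightarrow> real" where
  "layer_k k = layer (p k) (p (k + 1))"

definition mean_k :: "nat \<Rightarrow> real" where
  "mean_k k = layer_mean (p k) (p (k + 1))"

lemma layer_k_measurable [measurable]: "layer_k k \<in> borel_measurable borel"
  unfolding layer_k_def by measurable

lemma expectation_layer_k: "k \<in> {1..K} \<Longrightarrow> expectation (\<lambda>\<omega>. layer_k k (Y i \<omega>)) = mean_k k"
  unfolding layer_k_def mean_k_def by (rule expectation_layer) (rule p_range; assumption)+

lemma layer_k_bound: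
  assumes "k \<in> {1..K}"
  shows "\<bar>layer_k k y\<bar> \<le> quantile (p 1)"
proof -
  have "quantile (p k) \<le> quantile (p 1)"
    using quantile_less[of "p 1" "p k"] p_mono_less[of 1 k] p_pos assms by (cases "k = 1") auto
  moreover have "0 \<le> quantile (p (k + 1))" using c_pos by (simp add: quantile_def)
  ultimately show ?thesis
    using layer_bounds[OF p_range(1,2)[OF assms], of y] unfolding layer_k_def by linarith
qed

lemma integrable_layer_k: "k \<in> {1..K} \<Longrightarrow> integrable M (\<lambda>\<omega>. layer_k k (Y i \<omega>))"
  by (rule integrable_const_bound[where B = "quantile (p 1)"]) (auto simp del: One_nat_def intro!: AE_I2 layer_k_bound)

lemma integrable_layer_k_mult:
  assumes "j \<in> {1..K}" "k \<in> {1..K}"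
  shows "integrable M (\<lambda>\<omega>. layer_k j (Y i \<omega>) * layer_k k (Y i \<omega>))"
  by (rule integrable_const_bound[where B = "quantile (p 1) * quantile (p 1)"])
    (use assms in \<open>auto simp: abs_mult simp del: One_nat_def intro!: mult_mono' layer_k_bound AE_I2\<close>)

lemma covariance_layer_k:
  assumes "j \<in> {1..K}" "k \<in> {1..K}"
  shows "expectation (\<lambda>\<omega>. layer_k j (Y i \<omega>) * layer_k k (Y i \<omega>)) - mean_k j * mean_k k = Sigma_entry p c \<alpha> j k"
proof -
  have less: "expectation (\<lambda>\<omega>. layer_k j (Y i \<omega>) * layer_k k (Y i \<omega>)) - mean_k j * mean_k k
      = pareto_cov c \<alpha> (p j) (p (j + 1)) (p k) (p (k + 1))"
    if "j \<in> {1..K}" "k \<in> {1..K}" "j < k" for j k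
    unfolding layer_k_def mean_k_def
    by (rule expectation_layer_mult) (use that p_range[of j] p_range[of k] p_mono[of "j + 1" k] in auto)
  consider "j < k" | "j = k" | "k < j" by linarith
  then show ?thesis
  proof cases
    case 1
    then show ?thesis using less[OF assms 1] by (simp add: Sigma_entry_def)
  next
    case 2
    then show ?thesis
      using expectation_layer_sq[OF p_range[OF assms(1)], of i]
      by (simp add: Sigma_entry_def layer_k_def mean_k_def power2_eq_square)
  next
    case 3
    then show ?thesis using less[OF assms(2,1) 3] by (simp add: Sigma_entry_def mult.commute)
  qed
qed

definition layer_comb :: "(nat \<Rightarrow> real) \<Rightarrow> real \<Rightarrow> real" where
  "layer_comb a y = (\<Sum>k\<in>{1..K}. a k * layer_k k y)"

lemma layer_comb_measurable [measurable]: "layer_comb a \<in> borel_measurable borel"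
  unfolding layer_comb_def by measurable

lemma expectation_layer_comb: "expectation (\<lambda>\<omega>. layer_comb a (Y i \<omega>)) = (\<Sum>k\<in>{1..K}. a k * mean_k k)"
  unfolding layer_comb_def
  by (subst Bochner_Integration.integral_sum)
    (auto intro!: integrable_mult_right integrable_layer_k sum.cong simp: expectation_layer_k)

lemma layer_comb_bound: "\<bar>layer_comb a y\<bar> \<le> (\<Sum>k\<in>{1..K}. \<bar>a k\<bar> * quantile (p 1))"
  unfolding layer_comb_def
  by (rule order_trans[OF sum_abs sum_mono]) (auto simp: abs_mult simp del: One_nat_def intro!: mult_left_mono layer_k_bound)

lemma variance_layer_comb:
  "variance (\<lambda>\<omega>. layer_comb a (Y i \<omega>)) = (\<Sum>j\<in>{1..K}. \<Sum>k\<in>{1..K}. a j * Sigma_entry p c \<alpha> j k * a k)"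
proof -
  have int: "integrable M (\<lambda>\<omega>. a j * a k * (layer_k j (Y i \<omega>) * layer_k k (Y i \<omega>)))"
    if "j \<in> {1..K}" "k \<in> {1..K}" for j k
    using integrable_layer_k_mult[OF that] by (rule integrable_mult_right)
  have sq: "(layer_comb a y)\<^sup>2 = (\<Sum>j\<in>{1..K}. \<Sum>k\<in>{1..K}. a j * a k * (layer_k j y * layer_k k y))" for y
    unfolding layer_comb_def power2_eq_square sum_product by (intro sum.cong refl) (simp add: mult_ac)
  have 1: "integrable M (\<lambda>\<omega>. layer_comb a (Y i \<omega>))"
    unfolding layer_comb_def by (intro Bochner_Integration.integrable_sum integrable_mult_right integrable_layer_k)
  have 2: "integrable M (\<lambda>\<omega>. (layer_comb a (Y i \<omega>))\<^sup>2)"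
    unfolding sq by (intro Bochner_Integration.integrable_sum int)
  have "variance (\<lambda>\<omega>. layer_comb a (Y i \<omega>)) =
      expectation (\<lambda>\<omega>. (layer_comb a (Y i \<omega>))\<^sup>2) - (\<Sum>k\<in>{1..K}. a k * mean_k k)\<^sup>2"
    using variance_eq[OF 1 2] by (simp only: expectation_layer_comb)
  also have "expectation (\<lambda>\<omega>. (layer_comb a (Y i \<omega>))\<^sup>2) =
      (\<Sum>j\<in>{1..K}. \<Sum>k\<in>{1..K}. a j * a k * expectation (\<lambda>\<omega>. layer_k j (Y i \<omega>) * layer_k k (Y i \<omega>)))"
    unfolding sq using int
    by (simp only: Bochner_Integration.integral_sum Bochner_Integration.integrable_sum integral_mult_right_zero cong: sum.cong)
  also have "(\<Sum>k\<in>{1..K}. a k * mean_k k)\<^sup>2 = (\<Sum>j\<in>{1..K}. \<Sum>k\<in>{1..K}. a j * a k * (mean_k j * mean_k k))"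
    unfolding power2_eq_square sum_product by (intro sum.cong refl) (simp add: mult_ac)
  finally have "variance (\<lambda>\<omega>. layer_comb a (Y i \<omega>)) = (\<Sum>j\<in>{1..K}. \<Sum>k\<in>{1..K}.
      a j * a k * expectation (\<lambda>\<omega>. layer_k j (Y i \<omega>) * layer_k k (Y i \<omega>)) - a j * a k * (mean_k j * mean_k k))"
    by (simp only: sum_subtractf)
  also have "\<dots> = (\<Sum>j\<in>{1..K}. \<Sum>k\<in>{1..K}. a j * Sigma_entry p c \<alpha> j k * a k)"
  proof (intro sum.cong refl)
    fix j k assume "j \<in> {1..K}" "k \<in> {1..K}"
    then show "a j * a k * expectation (\<lambda>\<omega>. layer_k j (Y i \<omega>) * layer_k k (Y i \<omega>)) - a j * a k * (mean_k j * mean_k k)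
      = a j * Sigma_entry p c \<alpha> j k * a k"
      unfolding right_diff_distrib[symmetric] by (simp only: covariance_layer_k) simp
  qed
  finally show ?thesis .
qed

lemma ex_in_event_if_AE:
  assumes "AE \<omega> in M. P \<omega>" "E \<in> events" "0 < prob E"
  shows "\<exists>\<omega>\<in>E. P \<omega>"
proof (rule ccontr)
  assume "\<not> ?thesis"
  with assms(1) have "AE \<omega> in M. \<omega> \<notin> E" by (auto elim: eventually_mono)
  then have "prob E = 0" using assms(2) by (simp add: prob_eq_0)
  then show False using assms(3) by simp
qed

text \<open>
  If the variance vanished, \<open>layer_comb a (Y)\<close> would be almost surely constant. But both halves of the \<open>k\<close>-th
  interval between quantiles carry mass, and there the combination is affine with slope \<open>a k\<close>.
\<close>

lemma variance_layer_comb_pos: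
  assumes k: "k \<in> {1..K}" "a k \<noteq> 0"
  shows "0 < variance (\<lambda>\<omega>. layer_comb a (Y i \<omega>))"
proof (rule ccontr)
  let ?m = "expectation (\<lambda>\<omega>. layer_comb a (Y i \<omega>))"
  define B where "B = (\<Sum>k\<in>{1..K}. \<bar>a k\<bar> * quantile (p 1))"
  assume "\<not> ?thesis"
  then have "variance (\<lambda>\<omega>. layer_comb a (Y i \<omega>)) = 0"
    using variance_positive[of "\<lambda>\<omega>. layer_comb a (Y i \<omega>)"] by linarith
  moreover have "integrable M (\<lambda>\<omega>. (layer_comb a (Y i \<omega>) - ?m)\<^sup>2)"
  proof (rule integrable_const_bound[where B = "(B + \<bar>?m\<bar>)\<^sup>2"], intro AE_I2)
    fix \<omega>
    have "\<bar>layer_comb a (Y i \<omega>) - ?m\<bar> \<le> \<bar>B + \<bar>?m\<bar>\<bar>" using layer_comb_bound[of a "Y i \<omega>"] unfolding B_def by linarith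
    then show "norm ((layer_comb a (Y i \<omega>) - ?m)\<^sup>2) \<le> (B + \<bar>?m\<bar>)\<^sup>2" by (simp add: abs_le_square_iff)
  qed measurable
  ultimately have AE: "AE \<omega> in M. layer_comb a (Y i \<omega>) = ?m"
    by (subst (asm) integral_nonneg_eq_0_iff_AE) auto
  define l where "l = quantile (p (k + 1))"
  define r where "r = quantile (p k)"
  have lr: "c \<le> l" "l < r"
    using quantile_ge quantile_less p_range[OF k(1)] unfolding l_def r_def by (auto intro: less_imp_le less_trans)
  define s where "s = (l + r) / 2"
  have s: "l < s" "s < r" using lr by (auto simp: s_def)
  have prob_Ioc: "0 < prob {\<omega> \<in> space M. x < Y i \<omega> \<and> Y i \<omega> \<le> y}" if "c \<le> x" "x < y" for x y
  proof -
    have "prob {\<omega> \<in> space M. x < Y i \<omega> \<and> Y i \<omega> \<le> y} =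
        prob ({\<omega> \<in> space M. x < Y i \<omega>} - {\<omega> \<in> space M. y < Y i \<omega>})"
      by (rule arg_cong[where f = prob]) auto
    also have "\<dots> = prob {\<omega> \<in> space M. x < Y i \<omega>} - prob {\<omega> \<in> space M. y < Y i \<omega>}"
      using that by (intro finite_measure_Diff) auto
    finally show ?thesis using tail_less[OF that, of i] by simp
  qed
  obtain \<omega> where \<omega>: "l < Y i \<omega>" "Y i \<omega> \<le> s" "layer_comb a (Y i \<omega>) = ?m"
    using ex_in_event_if_AE[OF AE _ prob_Ioc[of l s]] s lr by auto
  obtain \<omega>' where \<omega>': "s < Y i \<omega>'" "Y i \<omega>' \<le> r" "layer_comb a (Y i \<omega>') = ?m"
    using ex_in_event_if_AE[OF AE _ prob_Ioc[of s r]] s lr by auto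
  define x where "x = Y i \<omega>"
  define y where "y = Y i \<omega>'"
  have xy: "l < x" "x < y" "y \<le> r" using \<omega> \<omega>' by (auto simp: x_def y_def)
  have const: "layer_k j x = layer_k j y" if j: "j \<in> {1..K}" "j \<noteq> k" for j
  proof -
    have q: "quantile (p (j + 1)) < quantile (p j)"
      using quantile_less p_range[OF j(1)] by simp
    consider "j < k" | "k < j" using j by linarith
    then show ?thesis
    proof cases
      case 1
      then have "p (j + 1) \<le> p k" using j k by (intro p_mono) auto
      then have "r \<le> quantile (p (j + 1))"
        using quantile_less[of "p (j + 1)" "p k"] p_range[OF j(1)] unfolding r_def by (cases "p (j + 1) = p k") auto
      then show ?thesis using q xy by (auto simp: layer_k_def layer_def)
    next
      case 2
      then have "p (k + 1) \<le> p j" using j k by (intro p_mono) auto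
      then have "quantile (p j) \<le> l"
        using quantile_less[of "p (k + 1)" "p j"] p_range[OF k(1)] unfolding l_def by (cases "p (k + 1) = p j") auto
      then show ?thesis using q xy by (auto simp: layer_k_def layer_def)
    qed
  qed
  have "layer_comb a y - layer_comb a x = (\<Sum>j\<in>{1..K}. a j * (layer_k j y - layer_k j x))"
    by (simp add: layer_comb_def sum_subtractf right_diff_distrib)
  also have "\<dots> = (\<Sum>j\<in>{1..K}. if j = k then a k * (layer_k k y - layer_k k x) else 0)"
    using const by (intro sum.cong) auto
  also have "\<dots> = a k * (layer_k k y - layer_k k x)" using k by simp
  also have "layer_k k z = max l (min r z) - l" for z
    by (simp add: layer_k_def layer_def l_def r_def)
  then have "layer_k k y - layer_k k x = y - x" using xy by simp
  finally show False using \<omega>(3) \<omega>'(3) k(2) xy by (simp add: x_def y_def)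
qed

end

section \<open>Asymptotic normality of the estimator\<close>

context pareto_shares
begin

lemma mu_k_pos: "k \<in> {1..K} \<Longrightarrow> 0 < mu_k p c \<alpha> k"
  unfolding mu_k_def by (rule pareto_mu_pos[OF c_pos \<alpha>_gt_1 p_range(1,2)])

lemma share_ratio_derivative_neg:
  assumes "i < K - 1" "1 < b"
  shows "\<exists>D<0. ((\<lambda>a. r_k K p c a (Suc i)) has_real_derivative D) (at b)"
  using assms p_range[of "Suc i"] p_mono[of "Suc i + 1" K] p_less[of K]
  by (intro r_k_derivative_neg c_pos) auto

definition block_dev :: "nat \<Rightarrow> 'a \<Rightarrow> nat \<Rightarrow> real" where
  "block_dev n \<omega> k = (top_sum n (\<lambda>i. Y i \<omega>) (top_count n (p (k + 1))) - top_sum n (\<lambda>i. Y i \<omega>) (top_count n (p k))) / real n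
    - mu_k p c \<alpha> k"

lemma block_dev_representation:
  assumes "k \<in> {1..K}"
  shows "small_oP M (\<lambda>n \<omega>. sqrt (real n) * block_dev n \<omega> k - (\<Sum>i<n. layer_k k (Y i \<omega>) - mean_k k) / sqrt (real n))"
  unfolding block_dev_def mu_k_def layer_k_def mean_k_def
  by (rule block_linear_representation[OF p_range[OF assms]])

lemma block_dev_OP:
  assumes "k \<in> {1..K}"
  shows "big_OP M (\<lambda>n \<omega>. sqrt (real n) * block_dev n \<omega> k)"
proof -
  have "big_OP M (\<lambda>n \<omega>. (\<Sum>i<n. layer_k k (Y i \<omega>) - mean_k k) / sqrt (real n))"
    unfolding layer_k_def mean_k_def by (rule layer_sum_OP[OF p_range[OF assms]])
  from big_OP_add[OF small_oP_imp_big_OP[OF block_dev_representation[OF assms]] this]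
  show ?thesis by (simp only: diff_add_cancel)
qed

lemma block_dev_small:
  assumes "k \<in> {1..K}"
  shows "small_oP M (\<lambda>n \<omega>. block_dev n \<omega> k)"
proof -
  have "(\<lambda>n. 1 / sqrt (real n)) \<longlonglongrightarrow> 0" by real_asymp
  from small_oP_tendsto_mult_big_OP[OF this block_dev_OP[OF assms]]
  show ?thesis
  proof (rule small_oP_if_whp_le, intro whp_if_eventually eventually_mono[OF eventually_gt_at_top[of 0]] ballI)
    fix n :: nat and \<omega> assume "0 < n"
    then show "\<bar>block_dev n \<omega> k\<bar> \<le> \<bar>1 / sqrt (real n) * (sqrt (real n) * block_dev n \<omega> k)\<bar>" by simp
  qed
qed

text \<open>
  The total income cancels from the ratios of shares, being positive on a sample above \<open>c\<close>.
\<close>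

lemma normalized_shares_eq:
  assumes "0 < n" "\<And>i. c < Y i \<omega>" "i < K - 1"
  shows "vec_index (normalized_shares K p (\<lambda>i. Y i \<omega>) n) i =
    (mu_k p c \<alpha> (Suc i) + block_dev n \<omega> (Suc i)) / (mu_k p c \<alpha> K + block_dev n \<omega> K)"
proof -
  let ?T = "\<lambda>k. top_sum n (\<lambda>i. Y i \<omega>) (top_count n (p k))"
  define t where "t = top_sum n (\<lambda>i. Y i \<omega>) n"
  have "t = (\<Sum>i<n. Y i \<omega>)"
    using sum_list_map_descending[of "\<lambda>x. x" "\<lambda>i. Y i \<omega>" n] by (simp add: t_def top_sum_eq_sum_list)
  also have "\<dots> > 0" using assms(1) c_pos less_trans[OF c_pos assms(2)] by (intro sum_pos) auto
  finally have t: "0 < t" .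
  have share: "top_share n (\<lambda>i. Y i \<omega>) p k = ?T k / t" for k
    by (simp add: top_share_def top_sum_def t_def top_count_def)
  have dev: "mu_k p c \<alpha> k + block_dev n \<omega> k = (?T (k + 1) - ?T k) / real n" for k
    by (simp add: block_dev_def)
  have "vec_index (normalized_shares K p (\<lambda>i. Y i \<omega>) n) i =
      (?T (Suc i + 1) / t - ?T (Suc i) / t) / (?T (K + 1) / t - ?T K / t)"
    using assms(3) by (simp add: normalized_shares_def share)
  also have "\<dots> = (?T (Suc i + 1) - ?T (Suc i)) / (?T (K + 1) - ?T K)"
    using t by (simp add: diff_divide_distrib[symmetric])
  finally show ?thesis using assms(1) by (simp add: dev)
qed

text \<open>
  The theorem in coordinates. The deterministic linearisation applies with high probability, since
  block sums and weights are consistent, and is multiplied by \<open>\<surd>n\<close>; the remainder is then \<open>\<eta>\<close> times a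
  tight variable for each \<open>\<eta>\<close>.
\<close>

lemma estimator_asymptotically_normal:
  fixes w :: "nat \<Rightarrow> nat \<Rightarrow> real" and R :: "nat \<Rightarrow> real" and What :: "nat \<Rightarrow> 'a \<Rightarrow> nat \<Rightarrow> nat \<Rightarrow> real"
    and \<alpha>hat :: "nat \<Rightarrow> 'a \<Rightarrow> real"
  assumes A: "A \<subseteq> {1<..}" "compact A" "\<alpha> \<in> interior A"
    and R: "\<And>i. i < K - 1 \<Longrightarrow> ((\<lambda>a. r_k K p c a (Suc i)) has_real_derivative R i) (at \<alpha>)"
    and What: "\<And>i j. i < K - 1 \<Longrightarrow> j < K - 1 \<Longrightarrow> small_oP M (\<lambda>n \<omega>. What n \<omega> i j - w i j)"
    and pd: "\<And>v. \<exists>i<K - 1. v i \<noteq> 0 \<Longrightarrow> 0 < bilin (K - 1) w v v"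
    and sym: "\<And>i j. i < K - 1 \<Longrightarrow> j < K - 1 \<Longrightarrow> w i j = w j i"
    and \<alpha>hat [measurable]: "\<And>n. \<alpha>hat n \<in> borel_measurable M"
    and \<alpha>hat_in: "\<And>n \<omega>. \<omega> \<in> space M \<Longrightarrow> \<alpha>hat n \<omega> \<in> A"
    and arg_min: "\<And>n \<omega> b. \<omega> \<in> space M \<Longrightarrow> b \<in> A \<Longrightarrow>
      bilin (K - 1) (What n \<omega>) (\<lambda>i. r_k K p c (\<alpha>hat n \<omega>) (Suc i) - vec_index (normalized_shares K p (\<lambda>i. Y i \<omega>) n) i)
          (\<lambda>i. r_k K p c (\<alpha>hat n \<omega>) (Suc i) - vec_index (normalized_shares K p (\<lambda>i. Y i \<omega>) n) i)
        \<le> bilin (K - 1) (What n \<omega>) (\<lambda>i. r_k K p c b (Suc i) - vec_index (normalized_shares K p (\<lambda>i. Y i \<omega>) n) i)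
          (\<lambda>i. r_k K p c b (Suc i) - vec_index (normalized_shares K p (\<lambda>i. Y i \<omega>) n) i)"
  defines "a \<equiv> influence K w R (mu_k p c \<alpha>)"
  shows "weak_conv_m (\<lambda>n. distr M borel (\<lambda>\<omega>. sqrt (real n) * (\<alpha>hat n \<omega> - \<alpha>)))
    (normal_law 0 (\<Sum>j\<in>{1..K}. \<Sum>k\<in>{1..K}. a j * Sigma_entry p c \<alpha> j k * a k))"
proof -
  let ?d = "K - 1" and ?f = "\<lambda>a i. r_k K p c a (Suc i)" and ?\<mu> = "mu_k p c \<alpha>"
  have d: "0 < ?d" "1 \<le> K" using K by auto
  note neg = share_ratio_derivative_neg
  have R_neg: "R i < 0" if "i < ?d" for i
    using neg[OF that \<alpha>_gt_1] DERIV_unique[OF R[OF that]] by auto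
  have R_nz: "\<exists>i<?d. R i \<noteq> 0" using R_neg[OF d(1)] d(1) by (metis less_irrefl)
  have "\<exists>C. \<forall>b\<in>A. \<bar>b - \<alpha>\<bar> \<le> C * \<bar>?f b 0 - ?f \<alpha> 0\<bar>"
  proof (rule inverse_lipschitz_at[OF A(2) _ _ _ R[OF d(1)]])
    show "\<alpha> \<in> A" using A(3) interior_subset by blast
    show "isCont (\<lambda>b. ?f b 0) b" if "b \<in> A" for b
      using neg[OF d(1), of b] that A(1) by (auto intro: DERIV_isCont)
    show "?f b 0 \<noteq> ?f \<alpha> 0" if b: "b \<in> A" "b \<noteq> \<alpha>" for b
    proof -
      have dec: "?f y 0 < ?f x 0" if "1 < x" "x < y" for x y
      proof (rule DERIV_neg_imp_decreasing[OF that(2)])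
        fix z assume "x \<le> z" "z \<le> y"
        then show "\<exists>D. ((\<lambda>b. ?f b 0) has_real_derivative D) (at z) \<and> D < 0"
          using neg[OF d(1), of z] that(1) by auto
      qed
      show ?thesis using dec[of b \<alpha>] dec[of \<alpha> b] b A(1) \<alpha>_gt_1 by (cases "b < \<alpha>") force+
    qed
    show "R 0 \<noteq> 0" using R_neg[OF d(1)] by simp
  qed
  then obtain C where C: "\<And>b. b \<in> A \<Longrightarrow> \<bar>b - \<alpha>\<bar> \<le> C * \<bar>?f b 0 - ?f \<alpha> 0\<bar>" by blast
  have lip: "\<bar>b - \<alpha>\<bar> \<le> \<bar>C\<bar> * l1_norm ?d (\<lambda>i. ?f b i - ?f \<alpha> i)" if "b \<in> A" for b
  proof -
    have "C * \<bar>?f b 0 - ?f \<alpha> 0\<bar> \<le> \<bar>C\<bar> * \<bar>?f b 0 - ?f \<alpha> 0\<bar>" by (intro mult_right_mono) auto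
    also have "\<bar>?f b 0 - ?f \<alpha> 0\<bar> \<le> l1_norm ?d (\<lambda>i. ?f b i - ?f \<alpha> i)"
      unfolding l1_norm_def using d(1) by (intro member_le_sum[of 0 _ "\<lambda>i. \<bar>?f b i - ?f \<alpha> i\<bar>"]) auto
    then have "\<bar>C\<bar> * \<bar>?f b 0 - ?f \<alpha> 0\<bar> \<le> \<bar>C\<bar> * l1_norm ?d (\<lambda>i. ?f b i - ?f \<alpha> i)"
      by (rule mult_left_mono) simp
    finally show ?thesis using C[OF that] by linarith
  qed
  have \<mu>K: "0 < ?\<mu> K" using mu_k_pos[of K] d by simp
  define Z where "Z n \<omega> = sqrt (real n) * (\<alpha>hat n \<omega> - \<alpha>)" for n \<omega>
  define L where "L n \<omega> = (\<Sum>k\<in>{1..K}. a k * (sqrt (real n) * block_dev n \<omega> k))" for n \<omega>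
  have OP: "big_OP M (\<lambda>n \<omega>. \<Sum>k\<in>{1..K}. \<bar>sqrt (real n) * block_dev n \<omega> k\<bar>)"
    by (intro big_OP_sum big_OP_abs block_dev_OP) auto
  have "small_oP M (\<lambda>n \<omega>. Z n \<omega> - L n \<omega>)"
  proof (rule small_oP_dominated[OF OP])
    fix \<eta> :: real assume \<eta>: "0 < \<eta>"
    obtain \<delta> where \<delta>: "0 < \<delta>"
      "\<And>w' s y b. \<lbrakk>\<And>i j. i < ?d \<Longrightarrow> j < ?d \<Longrightarrow> \<bar>w' i j - w i j\<bar> \<le> \<delta>; \<And>k. k \<in> {1..K} \<Longrightarrow> \<bar>y k\<bar> \<le> \<delta>;
        \<And>i. i < ?d \<Longrightarrow> s i = (?\<mu> (Suc i) + y (Suc i)) / (?\<mu> K + y K); b \<in> A;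
        \<And>b'. b' \<in> A \<Longrightarrow> bilin ?d w' (\<lambda>i. ?f b i - s i) (\<lambda>i. ?f b i - s i)
          \<le> bilin ?d w' (\<lambda>i. ?f b' i - s i) (\<lambda>i. ?f b' i - s i)\<rbrakk>
       \<Longrightarrow> \<bar>b - \<alpha> - (\<Sum>k\<in>{1..K}. a k * y k)\<bar> \<le> \<eta> * (\<Sum>k\<in>{1..K}. \<bar>y k\<bar>)"
      unfolding a_def
    proof (rule estimator_linearization[of K ?\<mu> ?f \<alpha> A R "\<bar>C\<bar>" w \<eta>], goal_cases)
      case (11 \<delta>)
      show ?case by (rule 11(1)) (fact 11(2), fact 11(3))
    qed (rule d(2) \<mu>K r_k_def A(3) R R_nz lip pd sym \<eta>; assumption?; assumption?)+
    have "whp M (\<lambda>n \<omega>. \<forall>ij\<in>{..<?d} \<times> {..<?d}. \<bar>What n \<omega> (fst ij) (snd ij) - w (fst ij) (snd ij)\<bar> \<le> \<delta>)"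
      by (intro whp_finite_ball small_oP_D[OF What \<delta>(1)]) auto
    moreover have "whp M (\<lambda>n \<omega>. \<forall>k\<in>{1..K}. \<bar>block_dev n \<omega> k\<bar> \<le> \<delta>)"
      by (intro whp_finite_ball small_oP_D[OF block_dev_small \<delta>(1)]) auto
    moreover have "whp M (\<lambda>n \<omega>. \<forall>i. c < Y i \<omega>)" by (rule whp_AE[OF AE_Y_gt])
    ultimately have "whp M (\<lambda>n \<omega>. (\<forall>ij\<in>{..<?d} \<times> {..<?d}. \<bar>What n \<omega> (fst ij) (snd ij) - w (fst ij) (snd ij)\<bar> \<le> \<delta>) \<and>
        (\<forall>k\<in>{1..K}. \<bar>block_dev n \<omega> k\<bar> \<le> \<delta>) \<and> (\<forall>i. c < Y i \<omega>))"
      by (intro whp_conj)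
    then show "whp M (\<lambda>n \<omega>. \<bar>Z n \<omega> - L n \<omega>\<bar> \<le> \<eta> * \<bar>\<Sum>k\<in>{1..K}. \<bar>sqrt (real n) * block_dev n \<omega> k\<bar>\<bar>)"
    proof (rule whp_mono, intro eventually_mono[OF eventually_gt_at_top[of 0]] ballI impI, elim conjE)
      fix n :: nat and \<omega>
      assume n: "0 < n" and \<omega>: "\<omega> \<in> space M"
        and W: "\<forall>ij\<in>{..<?d} \<times> {..<?d}. \<bar>What n \<omega> (fst ij) (snd ij) - w (fst ij) (snd ij)\<bar> \<le> \<delta>"
        and dev: "\<forall>k\<in>{1..K}. \<bar>block_dev n \<omega> k\<bar> \<le> \<delta>" and pos: "\<forall>i. c < Y i \<omega>"
      have "\<bar>\<alpha>hat n \<omega> - \<alpha> - (\<Sum>k\<in>{1..K}. a k * block_dev n \<omega> k)\<bar> \<le> \<eta> * (\<Sum>k\<in>{1..K}. \<bar>block_dev n \<omega> k\<bar>)"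
      proof (rule \<delta>(2)[of "What n \<omega>" "block_dev n \<omega>" "\<lambda>i. vec_index (normalized_shares K p (\<lambda>i. Y i \<omega>) n) i" "\<alpha>hat n \<omega>"])
        show "\<bar>What n \<omega> i j - w i j\<bar> \<le> \<delta>" if "i < ?d" "j < ?d" for i j using W that by force
        show "\<bar>block_dev n \<omega> k\<bar> \<le> \<delta>" if "k \<in> {1..K}" for k using dev that by blast
        show "vec_index (normalized_shares K p (\<lambda>i. Y i \<omega>) n) i =
          (?\<mu> (Suc i) + block_dev n \<omega> (Suc i)) / (?\<mu> K + block_dev n \<omega> K)" if "i < ?d" for i
          using normalized_shares_eq[OF n _ that] pos by blast
        show "\<alpha>hat n \<omega> \<in> A" by (rule \<alpha>hat_in[OF \<omega>])
      qed (rule arg_min[OF \<omega>])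
      then have "sqrt (real n) * \<bar>\<alpha>hat n \<omega> - \<alpha> - (\<Sum>k\<in>{1..K}. a k * block_dev n \<omega> k)\<bar>
          \<le> sqrt (real n) * (\<eta> * (\<Sum>k\<in>{1..K}. \<bar>block_dev n \<omega> k\<bar>))"
        by (rule mult_left_mono) simp
      moreover have "Z n \<omega> - L n \<omega> = sqrt (real n) * (\<alpha>hat n \<omega> - \<alpha> - (\<Sum>k\<in>{1..K}. a k * block_dev n \<omega> k))"
        by (simp add: Z_def L_def sum_distrib_left right_diff_distrib mult_ac)
      moreover have "(\<Sum>k\<in>{1..K}. \<bar>sqrt (real n) * block_dev n \<omega> k\<bar>) = sqrt (real n) * (\<Sum>k\<in>{1..K}. \<bar>block_dev n \<omega> k\<bar>)"
        by (simp add: sum_distrib_left abs_mult)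
      ultimately show "\<bar>Z n \<omega> - L n \<omega>\<bar> \<le> \<eta> * \<bar>\<Sum>k\<in>{1..K}. \<bar>sqrt (real n) * block_dev n \<omega> k\<bar>\<bar>"
        by (simp add: abs_mult sum_nonneg mult_ac)
    qed
  qed
  moreover have "small_oP M (\<lambda>n \<omega>. \<Sum>k\<in>{1..K}. a k *
      (sqrt (real n) * block_dev n \<omega> k - (\<Sum>i<n. layer_k k (Y i \<omega>) - mean_k k) / sqrt (real n)))"
    by (intro small_oP_sum small_oP_cmult block_dev_representation) auto
  ultimately have "small_oP M (\<lambda>n \<omega>. (Z n \<omega> - L n \<omega>) + (\<Sum>k\<in>{1..K}. a k *
      (sqrt (real n) * block_dev n \<omega> k - (\<Sum>i<n. layer_k k (Y i \<omega>) - mean_k k) / sqrt (real n))))"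
    by (rule small_oP_add)
  moreover have "(Z n \<omega> - L n \<omega>) + (\<Sum>k\<in>{1..K}. a k *
      (sqrt (real n) * block_dev n \<omega> k - (\<Sum>i<n. layer_k k (Y i \<omega>) - mean_k k) / sqrt (real n)))
    = Z n \<omega> - (\<Sum>i<n. layer_comb a (Y i \<omega>) - (\<Sum>k\<in>{1..K}. a k * mean_k k)) / sqrt (real n)" for n \<omega>
  proof -
    have "(\<Sum>k\<in>{1..K}. a k * ((\<Sum>i<n. layer_k k (Y i \<omega>) - mean_k k) / sqrt (real n)))
      = (\<Sum>k\<in>{1..K}. \<Sum>i<n. a k * (layer_k k (Y i \<omega>) - mean_k k)) / sqrt (real n)"
      by (simp add: sum_distrib_left sum_divide_distrib)
    also have "(\<Sum>k\<in>{1..K}. \<Sum>i<n. a k * (layer_k k (Y i \<omega>) - mean_k k))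
      = (\<Sum>i<n. \<Sum>k\<in>{1..K}. a k * (layer_k k (Y i \<omega>) - mean_k k))" by (rule sum.swap)
    also have "\<dots> = (\<Sum>i<n. layer_comb a (Y i \<omega>) - (\<Sum>k\<in>{1..K}. a k * mean_k k))"
      by (simp add: layer_comb_def right_diff_distrib sum_subtractf)
    finally show ?thesis by (simp add: L_def right_diff_distrib sum_subtractf)
  qed
  ultimately have diff: "small_oP M (\<lambda>n \<omega>. Z n \<omega> -
      (\<Sum>i<n. layer_comb a (Y i \<omega>) - (\<Sum>k\<in>{1..K}. a k * mean_k k)) / sqrt (real n))"
    by (simp only:)
  \<comment> \<open>Moving the ratios in the direction \<open>R\<close>, by changing all block sums but the last, moves the
    estimator at unit speed. Hence the influence vector is not zero.\<close>
  define y where "y k = (if k < K then ?\<mu> K * R (k - 1) else 0)" for k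
  have "(\<Sum>k\<in>{1..K}. a k * y k) =
      bilin ?d w R (\<lambda>i. (y (Suc i) - ?\<mu> (Suc i) / ?\<mu> K * y K) / ?\<mu> K) / bilin ?d w R R"
    unfolding a_def by (rule sum_influence[OF d(2)]) (rule sym; assumption)
  also have "bilin ?d w R (\<lambda>i. (y (Suc i) - ?\<mu> (Suc i) / ?\<mu> K * y K) / ?\<mu> K) = bilin ?d w R R"
    unfolding bilin_def y_def using \<mu>K by (intro sum.cong refl) auto
  finally have "(\<Sum>k\<in>{1..K}. a k * y k) = 1" using pd[OF R_nz] by simp
  then have "\<exists>k\<in>{1..K}. a k \<noteq> 0" by (intro ccontr[of "\<exists>k\<in>{1..K}. a k \<noteq> 0"]) simp
  then have V: "0 < variance (\<lambda>\<omega>. layer_comb a (Y 0 \<omega>))" by (auto intro: variance_layer_comb_pos)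
  have "weak_conv_m (\<lambda>n. distr M borel (Z n)) (normal_law 0 (variance (\<lambda>\<omega>. layer_comb a (Y 0 \<omega>))))"
  proof (rule weak_conv_normal_law_if_diff_small_oP[OF _ _ _ _ _ V _ diff])
    show "indep_vars (\<lambda>_. borel) (\<lambda>i \<omega>. layer_comb a (Y i \<omega>)) UNIV" by (rule indep_compose) measurable
    show "distr M borel (\<lambda>\<omega>. layer_comb a (Y i \<omega>)) = distr M borel (\<lambda>\<omega>. layer_comb a (Y 0 \<omega>))" for i
      by (rule distr_compose) measurable
    show "\<bar>layer_comb a (Y i \<omega>)\<bar> \<le> (\<Sum>k\<in>{1..K}. \<bar>a k\<bar> * quantile (p 1))" for i \<omega> by (rule layer_comb_bound)
    show "expectation (\<lambda>\<omega>. layer_comb a (Y i \<omega>)) = (\<Sum>k\<in>{1..K}. a k * mean_k k)" for i by (rule expectation_layer_comb)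
    show "variance (\<lambda>\<omega>. layer_comb a (Y i \<omega>)) = variance (\<lambda>\<omega>. layer_comb a (Y 0 \<omega>))" for i by (simp only: variance_layer_comb)
    show "Z n \<in> borel_measurable M" for n unfolding Z_def by measurable
  qed
  then show ?thesis unfolding variance_layer_comb by (simp only: Z_def[abs_def])
qed

end

lemma quad_form_share_distance:
  assumes "B \<in> carrier_mat (K - 1) (K - 1)"
  shows "quad_form B (r_vec K p c b - normalized_shares K p y n) =
    bilin (K - 1) (\<lambda>i j. B $$ (i, j)) (\<lambda>i. r_k K p c b (Suc i) - vec_index (normalized_shares K p y n) i)
      (\<lambda>i. r_k K p c b (Suc i) - vec_index (normalized_shares K p y n) i)"
proof -
  define s where "s = normalized_shares K p y n"
  have s: "dim_vec s = K - 1" by (simp add: s_def normalized_shares_def)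
  then have "r_vec K p c b - s \<in> carrier_vec (K - 1)" by (intro carrier_vecI) simp
  moreover have "vec_index (r_vec K p c b - s) i = r_k K p c b (Suc i) - vec_index s i" if "i < K - 1" for i
    using that s by (simp add: r_vec_def)
  ultimately show ?thesis
    unfolding s_def[symmetric] by (simp add: quad_form_eq_bilin[OF assms] bilin_def)
qed

theorem theorem3p4:
  fixes M :: "'a measure"
    and K :: nat
    and p :: "nat \<Rightarrow> real"
    and A :: "real set"
    and \<alpha>\<^sub>0 c :: real
    and Y :: "nat \<Rightarrow> 'a \<Rightarrow> real"
    and What :: "nat \<Rightarrow> 'a \<Rightarrow> real Matrix.mat"
    and W :: "real Matrix.mat"
    and \<alpha>hat :: "nat \<Rightarrow> 'a \<Rightarrow> real"
  assumes M: "prob_space M"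
    and K: "2 \<le> K"
    and p: "0 < p 1" "\<And>k. k \<in> {1..K} \<Longrightarrow> p k < p (k + 1)" "p (K + 1) \<le> 1"
    and A: "A \<subseteq> {1<..}" "compact A" "\<alpha>\<^sub>0 \<in> interior A"
    and c: "0 < c"
    and Y_indep: "prob_space.indep_vars M (\<lambda>_. borel) Y UNIV"
    and Y_pareto: "\<And>i y. cdf (distr M borel (Y i)) y = pareto_cdf \<alpha>\<^sub>0 c y"
    and What_measurable: "\<And>n i j. i < K - 1 \<Longrightarrow> j < K - 1 \<Longrightarrow>
           (\<lambda>\<omega>. What n \<omega> $$ (i, j)) \<in> borel_measurable M"
    and What_pos_def: "\<And>n \<omega>. \<omega> \<in> space M \<Longrightarrow>
           symmetric_mat (What n \<omega>) \<and> pos_def_mat (K - 1) (What n \<omega>)"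
    and What_conv: "\<And>i j. i < K - 1 \<Longrightarrow> j < K - 1 \<Longrightarrow>
           conv_in_prob M (\<lambda>n \<omega>. What n \<omega> $$ (i, j)) (W $$ (i, j))"
    and W_pos_def: "pos_def_mat (K - 1) W"
    and \<alpha>hat_measurable: "\<And>n. \<alpha>hat n \<in> borel_measurable M"
    and \<alpha>hat_argmin: "\<And>n \<omega>. \<omega> \<in> space M \<Longrightarrow>
           is_arg_min
             (\<lambda>\<alpha>. quad_form (What n \<omega>)
                    (r_vec K p c \<alpha> - normalized_shares K p (\<lambda>i. Y i \<omega>) n))
             (\<lambda>\<alpha>. \<alpha> \<in> A) (\<alpha>hat n \<omega>)"
  shows "weak_conv_m
           (\<lambda>n. distr M borel (\<lambda>\<omega>. sqrt (real n) * (\<alpha>hat n \<omega> - \<alpha>\<^sub>0)))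
           (normal_law 0 (asymp_variance W (Omega_mat K p c \<alpha>\<^sub>0) (grad_r K p c \<alpha>\<^sub>0)))"
proof -
  interpret prob_space M by (rule M)
  have "1 < \<alpha>\<^sub>0" using A(1,3) interior_subset by blast
  interpret pareto_shares M Y c \<alpha>\<^sub>0 K p
    by unfold_locales (use Y_indep Y_pareto c \<open>1 < \<alpha>\<^sub>0\<close> K p in auto)
  let ?d = "K - 1" and ?w = "\<lambda>i j. W $$ (i, j)" and ?R = "\<lambda>i. vec_index (grad_r K p c \<alpha>\<^sub>0) i"
  have conv: "small_oP M (\<lambda>n \<omega>. What n \<omega> $$ (i, j) - W $$ (i, j))" if "i < ?d" "j < ?d" for i j
    by (rule small_oP_if_conv_in_prob) (use What_measurable What_conv that in auto)
  have What_carrier: "What n \<omega> \<in> carrier_mat ?d ?d" if "\<omega> \<in> space M" for n \<omega>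
    using What_pos_def[OF that] by (simp add: pos_def_mat_def)
  have W_carrier: "W \<in> carrier_mat ?d ?d" using W_pos_def by (simp add: pos_def_mat_def)
  \<comment> \<open>Positive definiteness of \<open>W\<close> as defined does not include symmetry, which \<open>W\<close> inherits as a limit of
    symmetric matrices.\<close>
  have sym: "W $$ (i, j) = W $$ (j, i)" if ij: "i < ?d" "j < ?d" for i j
  proof (rule limit_in_prob_unique[OF conv[OF ij]])
    from conv[OF ij(2,1)] show "small_oP M (\<lambda>n \<omega>. What n \<omega> $$ (i, j) - W $$ (j, i))"
    proof (rule small_oP_if_whp_le, intro whp_if_eventually always_eventually allI ballI)
      fix n \<omega> assume \<omega>: "\<omega> \<in> space M"
      have "transpose_mat (What n \<omega>) $$ (i, j) = What n \<omega> $$ (j, i)"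
        using What_carrier[OF \<omega>, of n] ij by simp
      then show "\<bar>What n \<omega> $$ (i, j) - W $$ (j, i)\<bar> \<le> \<bar>What n \<omega> $$ (j, i) - W $$ (j, i)\<bar>"
        using What_pos_def[OF \<omega>, of n] by (simp add: symmetric_mat_def)
    qed
  qed
  have R: "((\<lambda>a. r_k K p c a (Suc i)) has_real_derivative ?R i) (at \<alpha>\<^sub>0)" if i: "i < ?d" for i
  proof -
    obtain D where D: "((\<lambda>a. r_k K p c a (Suc i)) has_real_derivative D) (at \<alpha>\<^sub>0)"
      using share_ratio_derivative_neg[OF i \<open>1 < \<alpha>\<^sub>0\<close>] by blast
    then have "deriv (\<lambda>a. r_k K p c a (Suc i)) \<alpha>\<^sub>0 = D" by (rule DERIV_imp_deriv)
    then show ?thesis using D i by (simp add: grad_r_def)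
  qed
  note obj = quad_form_share_distance[OF What_carrier]
  have V: "asymp_variance W (Omega_mat K p c \<alpha>\<^sub>0) (grad_r K p c \<alpha>\<^sub>0) =
    (\<Sum>j\<in>{1..K}. \<Sum>k\<in>{1..K}. influence K ?w ?R (mu_k p c \<alpha>\<^sub>0) j * Sigma_entry p c \<alpha>\<^sub>0 j k
      * influence K ?w ?R (mu_k p c \<alpha>\<^sub>0) k)"
    by (rule asymp_variance_eq) (use K W_carrier sym in \<open>auto simp: grad_r_def\<close>)
  show ?thesis
    unfolding V
  proof (rule estimator_asymptotically_normal[OF A R conv _ sym \<alpha>hat_measurable])
    show "0 < bilin ?d ?w v v" if "\<exists>i<?d. v i \<noteq> 0" for v
      by (rule pos_def_mat_imp_bilin[OF W_pos_def that])
    show "\<alpha>hat n \<omega> \<in> A" if "\<omega> \<in> space M" for n \<omega>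
      using \<alpha>hat_argmin[OF that, of n] by (simp add: is_arg_min_def)
    show "bilin ?d (\<lambda>i j. What n \<omega> $$ (i, j)) (\<lambda>i. r_k K p c (\<alpha>hat n \<omega>) (Suc i) - vec_index (normalized_shares K p (\<lambda>i. Y i \<omega>) n) i)
          (\<lambda>i. r_k K p c (\<alpha>hat n \<omega>) (Suc i) - vec_index (normalized_shares K p (\<lambda>i. Y i \<omega>) n) i)
        \<le> bilin ?d (\<lambda>i j. What n \<omega> $$ (i, j)) (\<lambda>i. r_k K p c b (Suc i) - vec_index (normalized_shares K p (\<lambda>i. Y i \<omega>) n) i)
          (\<lambda>i. r_k K p c b (Suc i) - vec_index (normalized_shares K p (\<lambda>i. Y i \<omega>) n) i)" if "\<omega> \<in> space M" "b \<in> A" for n \<omega> b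
    proof -
      have "\<not> quad_form (What n \<omega>) (r_vec K p c b - normalized_shares K p (\<lambda>i. Y i \<omega>) n)
          < quad_form (What n \<omega>) (r_vec K p c (\<alpha>hat n \<omega>) - normalized_shares K p (\<lambda>i. Y i \<omega>) n)"
        using \<alpha>hat_argmin[OF that(1), of n] that(2) unfolding is_arg_min_def by blast
      then show ?thesis unfolding obj[OF that(1)] by (simp only: not_less)
    qed
  qed
qed

end
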